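(* Suppose that Assumption A (stated in the context) holds, and let $(\Delta z,\Delta\lambda,\Delta s)$ be the exact primal-dual step at $(z,\lambda,s)$. When the step $(\widehat{\Delta z},\widehat{\Delta\lambda},\widehat{\Delta s})$ is calculated in the finite-precision environment described in the context by using the procedure condensed (where, in particular, a backward stable method is used to solve the linear system for the $\widehat{\Delta z}$ component), we have $$(\Delta z-\widehat{\Delta z},\;U^T(\Delta\lambda_{\mathcal{B}}-\widehat{\Delta\lambda}_{\mathcal{B}}),\;\Delta s-\widehat{\Delta s})=\delta_{\mathbf u},$$ $$V^T(\Delta\lambda_{\mathcal{B}}-\widehat{\Delta\lambda}_{\mathcal{B}})=\delta_{\mathbf u}/\mu,\qquad \Delta\lambda_{\mathcal{N}}-\widehat{\Delta\lambda}_{\mathcal{N}}=\mu\,\delta_{\mathbf u}.$$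
   Context: (NLP) is $\min_z\phi(z)$ subject to $g(z)\le0$, where $\phi:\mathbb{R}^n\to\mathbb{R}$ and $g:\mathbb{R}^n\to\mathbb{R}^m$ are twice Lipschitz continuously differentiable. $\mathcal{L}(z,\lambda)=\phi(z)+\lambda^Tg(z)$; $\mathcal{L}_z$, $\mathcal{L}_{zz}$ are its gradient and Hessian in $z$. $\nabla g(z)=[\nabla g_1(z),\dots,\nabla g_m(z)]$. KKT conditions: $\mathcal{L}_z(z,\lambda)=0$, $g(z)\le0$, $\lambda\ge0$, $\lambda^Tg(z)=0$. $\mathcal{S}_\lambda$ is the set of $\lambda^*$ such that $(z^*,\lambda^* )$ satisfies the KKT conditions, $\mathcal{S}=\{z^*\}\times\mathcal{S}_\lambda$, $\delta(z,\lambda)$ is the Euclidean distance from $(z,\lambda)$ to $\mathcal{S}$. $\mathcal{B}=\{i:g_i(z^* )=0\}$, $\mathcal{N}=\{1,\dots,m\}\setminus\mathcal{B}$, $\mathcal{B}_+=\{i\in\mathcal{B}:\lambda_i^*>0\text{ for some }\lambda^*\in\mathcal{S}_\lambda\}$. Subscripts $\mathcal{B},\mathcal{N}$ denote subvectors/submatrices; $\nabla g_{\mathcal{B}}(z)$ has columns $\nabla g_i(z)$, $i\in\mathcal{B}$. $S=\mathrm{diag}(s)$, $\Lambda=\mathrm{diag}(\lambda)$, $D=\Lambda^{-1}S$ (with diagonal blocks $D_{\mathcal{B}},D_{\mathcal{N}}$), $e=(1,\dots,1)^T$. SVD: $\nabla g_{\mathcal{B}}(z^* )=\begin{bmatrix}\hat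 U&\hat V\end{bmatrix}\begin{bmatrix}\Sigma&0\\ 0&0\end{bmatrix}\begin{bmatrix}U^T\\ V^T\end{bmatrix}=\hat U\Sigma U^T$ with $[\hat U\ \hat V]$, $[U\ V]$ orthogonal and $\Sigma$ diagonal with positive diagonal. $\sigma_{\min}$ denotes smallest eigenvalue. Assumption A. (a) $z^*$ is a solution of (NLP), so the KKT conditions hold ($\mathcal{S}_\lambda\neq\emptyset$). MFCQ: there is $\bar y$ with $\nabla g_{\mathcal{B}}(z^* )^T\bar y<0$. Second-order conditions: there is $\xi>0$ with $w^T\mathcal{L}_{zz}(z^*,\lambda^* )w\ge\xi\|w\|^2$ for all $\lambda^*\in\mathcal{S}_\lambda$ and all $w$ with $\nabla g_i(z^* )^Tw=0$ ($i\in\mathcal{B}_+$), $\nabla g_i(z^* )^Tw\le0$ ($i\in\mathcal{B}\setminus\mathcal{B}_+$). SC: some $\lambda^*\in\mathcal{S}_\lambda$ has $\lambda_i^*>0$ for all $i\in\mathcal{B}$. The current iterate $(z,\lambda,s)$ satisfies, with $\mu=\lambda^Ts/m$ and fixed constants $C>0$, $\gamma\in(0,1)$: $\|\mathcal{L}_z(z,\lambda)\|\le C\mu$, $\|g(z)+s\|\le C\mu$, $(\lambda,s)>0$, $\lambda_is_i\ge\gamma\mu$ for all $i$. The vector $t\in\mathbb{R}^m$ satisfies $t=O(\mu^2)$. (b) For a sufficiently large $\beta>0$: $\mathbf u/\mu\ll1$, $\mathbf u\ll1$, $\sigma_{\min}(\Sigma)\ge\beta\max(\mu^{1/3},\mathbf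 u/\mu)$, and $\sigma_{\min}(\hat V^T\mathcal{L}_{zz}(z^*,\lambda^* )\hat V)\ge\beta\max(\mu^{1/3},\mathbf u/\mu)$ for all $\lambda^*\in\mathcal{S}_\lambda$. Exact step: the solution of $$\begin{bmatrix} \mathcal{L}_{zz}(z,\lambda) & \nabla g(z) & 0\\ \nabla g(z)^T & 0 & I\\ 0 & S & \Lambda\end{bmatrix}\begin{bmatrix}\Delta z\\ \Delta\lambda\\ \Delta s\end{bmatrix}=-\begin{bmatrix}\mathcal{L}_z(z,\lambda)\\ g(z)+s\\ S\Lambda e+t\end{bmatrix}.$$ Procedure condensed: given $(z,\lambda,s)$, form and solve $[\mathcal{L}_{zz}(z,\lambda)+\nabla g(z)D^{-1}\nabla g(z)^T]\Delta z=-\mathcal{L}_z(z,\lambda)-\nabla g(z)D^{-1}[g(z)-\Lambda^{-1}t]$ by a backward stable algorithm; then set $\Delta\lambda=D^{-1}[g(z)-\Lambda^{-1}t+\nabla g(z)^T\Delta z]$; then set $\Delta s=-(g(z)+s)-\nabla g(z)^T\Delta z$. Finite-precision environment: $z,\lambda,s,t$ are floating-point vectors. $\mathbf u$ is the unit roundoff: for floating-point numbers $x,y$ and $\mathrm{op}\in\{+,-,\times,/\}$, $fl(x\,\mathrm{op}\,y)=(x\,\mathrm{op}\,y)(1+\epsilon)$ with $|\epsilon|\le\mathbf u$. The computed values of $\mathcal{L}_{zz}(z,\lambda)$, $\mathcal{L}_z(z,\lambda)$, $\nabla g(z)$, $g(z)$ are $\mathcal{L}_{zz}(z,\lambda)+\bar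 F$, $\mathcal{L}_z(z,\lambda)+\bar f$, $\nabla g(z)+F$, $g(z)+f$ with $\bar F,\bar f,F,f$ all of size $\delta_{\mathbf u}$. The computed $D^{-1}$ is $(D+G)^{-1}$ with $G$ diagonal, $G_{\mathcal{B}}=\mu\,\delta_{\mathbf u}$, $G_{\mathcal{N}}=\delta_{\mathbf u}/\mu$. Roundoff in forming the linear system from these computed quantities and in the backward stable solve is accounted for by a matrix $\hat F=\delta_{\mathbf u}/\mu$ and a vector $\hat f=\delta_{\mathbf u}$: $\widehat{\Delta z}$ is the exact solution of $$[\mathcal{L}_{zz}(z,\lambda)+\bar F+(\nabla g(z)+F)(D+G)^{-1}(\nabla g(z)+F)^T+\hat F]\widehat{\Delta z}=-\mathcal{L}_z(z,\lambda)-\bar f-(\nabla g(z)+F)(D+G)^{-1}[g(z)+f-\Lambda^{-1}t]+\hat f.$$ Then $\widehat{\Delta\lambda}$ and $\widehat{\Delta s}$ are obtained by carrying out the last two assignments of the procedure in floating-point arithmetic (each operation obeying the model above), using $\widehat{\Delta z}$ and the computed values of $g(z)$, $\nabla g(z)$, $D^{-1}$. Conventions: $O(\epsilon)$ means norm at most a constant times $\epsilon$; $\delta_{\mathbf u}$ denotes any quantity of norm at most a constant times $\mathbf u$. Precisely: for fixed problem, $z^*$, $C,\gamma$ and every choice of the constants implicit in the hypotheses, there exist $\epsilon,\eta,\beta_0,K'>0$ depending only on these such that, whenever the hypotheses hold with $\delta(z,\lambda)\le\epsilon$, $\mu\le\epsilon$, $\mathbf u/\mu\le\eta$, $\mathbf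 u\le\eta$, $\beta\ge\beta_0$, the conclusions hold with all implied constants equal to $K'$. *)

theory Defs
  imports
    "Jordan_Normal_Form.Char_Poly"
    "HOL-Analysis.Analysis"
    "HOL-Library.Multiset"
    "HOL-Library.Extended_Real"
begin

text \<open>Only \<^const>\<open>eigenvalue\<close> and the matrices of variable size are taken from
  \<^theory>\<open>Jordan_Normal_Form.Char_Poly\<close>; everything of fixed dimension uses the
  Cartesian types of \<^theory>\<open>HOL-Analysis.Analysis\<close>, whose notation is kept.\<close>

no_notation vec_index (infixl \<open>$\<close> 100)
no_notation scalar_prod (infix \<open>\<bullet>\<close> 70)

section \<open>The nonlinear program\<close>

definition grad :: "(real ^ 'n \<Rightarrow> real) \<Rightarrow> real ^ 'n \<Rightarrow> real ^ 'n" where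
  "grad f x = (\<chi> j. frechet_derivative f (at x) (axis j 1))"

definition hess :: "(real ^ 'n \<Rightarrow> real) \<Rightarrow> real ^ 'n \<Rightarrow> real ^ 'n ^ 'n" where
  "hess f x = jacobian (grad f) (at x)"

text \<open>Lipschitz continuity of the Hessian is required locally, which is implied by
  Lipschitz continuity on the whole space.\<close>

definition twice_lipschitz_differentiable :: "(real ^ 'n \<Rightarrow> real) \<Rightarrow> bool" where
  "twice_lipschitz_differentiable f \<longleftrightarrow>
     (\<forall>x. f differentiable (at x)) \<and>
     (\<forall>x. grad f differentiable (at x)) \<and>
     (\<forall>x. \<exists>r>0. \<exists>L. L-lipschitz_on (cball x r) (hess f))"

text \<open>The \<open>n \<times> m\<close> matrix whose columns are the gradients of the components of \<open>g\<close>, i.e. the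
  transpose of the Jacobian.\<close>

definition nabla :: "(real ^ 'n \<Rightarrow> real ^ 'm) \<Rightarrow> real ^ 'n \<Rightarrow> real ^ 'm ^ 'n" where
  "nabla g z = (\<chi> j i. grad (\<lambda>y. g y $ i) z $ j)"

definition Lagr :: "(real ^ 'n \<Rightarrow> real) \<Rightarrow> (real ^ 'n \<Rightarrow> real ^ 'm) \<Rightarrow> real ^ 'n \<Rightarrow> real ^ 'm \<Rightarrow> real" where
  "Lagr \<phi> g z lam = \<phi> z + lam \<bullet> g z"

definition Lagr_z :: "(real ^ 'n \<Rightarrow> real) \<Rightarrow> (real ^ 'n \<Rightarrow> real ^ 'm) \<Rightarrow> real ^ 'n \<Rightarrow> real ^ 'm \<Rightarrow> real ^ 'n" where
  "Lagr_z \<phi> g z lam = grad (\<lambda>y. Lagr \<phi> g y lam) z"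

definition Lagr_zz :: "(real ^ 'n \<Rightarrow> real) \<Rightarrow> (real ^ 'n \<Rightarrow> real ^ 'm) \<Rightarrow> real ^ 'n \<Rightarrow> real ^ 'm \<Rightarrow> real ^ 'n ^ 'n" where
  "Lagr_zz \<phi> g z lam = hess (\<lambda>y. Lagr \<phi> g y lam) z"

definition feasible :: "(real ^ 'n \<Rightarrow> real ^ 'm) \<Rightarrow> real ^ 'n \<Rightarrow> bool" where
  "feasible g z \<longleftrightarrow> (\<forall>i. g z $ i \<le> 0)"

text \<open>Solutions are local minimizers; this includes the global ones.\<close>

definition nlp_solution :: "(real ^ 'n \<Rightarrow> real) \<Rightarrow> (real ^ 'n \<Rightarrow> real ^ 'm) \<Rightarrow> real ^ 'n \<Rightarrow> bool" where
  "nlp_solution \<phi> g zs \<longleftrightarrow>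
     feasible g zs \<and> (\<exists>r>0. \<forall>z\<in>ball zs r. feasible g z \<longrightarrow> \<phi> zs \<le> \<phi> z)"

definition KKT :: "(real ^ 'n \<Rightarrow> real) \<Rightarrow> (real ^ 'n \<Rightarrow> real ^ 'm) \<Rightarrow> real ^ 'n \<Rightarrow> real ^ 'm \<Rightarrow> bool" where
  "KKT \<phi> g z lam \<longleftrightarrow>
     Lagr_z \<phi> g z lam = 0 \<and> (\<forall>i. g z $ i \<le> 0) \<and> (\<forall>i. 0 \<le> lam $ i) \<and> lam \<bullet> g z = 0"

definition multipliers :: "(real ^ 'n \<Rightarrow> real) \<Rightarrow> (real ^ 'n \<Rightarrow> real ^ 'm) \<Rightarrow> real ^ 'n \<Rightarrow> (real ^ 'm) set" where
  "multipliers \<phi> g zs = {lam. KKT \<phi> g zs lam}"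

definition sol_dist :: "(real ^ 'n \<Rightarrow> real) \<Rightarrow> (real ^ 'n \<Rightarrow> real ^ 'm) \<Rightarrow> real ^ 'n \<Rightarrow> real ^ 'n \<Rightarrow> real ^ 'm \<Rightarrow> real" where
  "sol_dist \<phi> g zs z lam = infdist (z, lam) ({zs} \<times> multipliers \<phi> g zs)"

definition active :: "(real ^ 'n \<Rightarrow> real ^ 'm) \<Rightarrow> real ^ 'n \<Rightarrow> 'm set" where
  "active g zs = {i. g zs $ i = 0}"

definition inactive :: "(real ^ 'n \<Rightarrow> real ^ 'm) \<Rightarrow> real ^ 'n \<Rightarrow> 'm set" where
  "inactive g zs = UNIV - active g zs"

definition active_plus :: "(real ^ 'n \<Rightarrow> real) \<Rightarrow> (real ^ 'n \<Rightarrow> real ^ 'm) \<Rightarrow> real ^ 'n \<Rightarrow> 'm set" where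
  "active_plus \<phi> g zs = {i \<in> active g zs. \<exists>lam\<in>multipliers \<phi> g zs. lam $ i > 0}"

definition MFCQ :: "(real ^ 'n \<Rightarrow> real ^ 'm) \<Rightarrow> real ^ 'n \<Rightarrow> bool" where
  "MFCQ g zs \<longleftrightarrow> (\<exists>y. \<forall>i\<in>active g zs. column i (nabla g zs) \<bullet> y < 0)"

definition second_order_conditions :: "(real ^ 'n \<Rightarrow> real) \<Rightarrow> (real ^ 'n \<Rightarrow> real ^ 'm) \<Rightarrow> real ^ 'n \<Rightarrow> bool" where
  "second_order_conditions \<phi> g zs \<longleftrightarrow>
     (\<exists>\<xi>>0. \<forall>lam\<in>multipliers \<phi> g zs. \<forall>w.
        (\<forall>i\<in>active_plus \<phi> g zs. column i (nabla g zs) \<bullet> w = 0) \<and>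
        (\<forall>i\<in>active g zs - active_plus \<phi> g zs. column i (nabla g zs) \<bullet> w \<le> 0)
        \<longrightarrow> w \<bullet> (Lagr_zz \<phi> g zs lam *v w) \<ge> \<xi> * (norm w)\<^sup>2)"

definition strict_complementarity :: "(real ^ 'n \<Rightarrow> real) \<Rightarrow> (real ^ 'n \<Rightarrow> real ^ 'm) \<Rightarrow> real ^ 'n \<Rightarrow> bool" where
  "strict_complementarity \<phi> g zs \<longleftrightarrow>
     (\<exists>lam\<in>multipliers \<phi> g zs. \<forall>i\<in>active g zs. lam $ i > 0)"

section \<open>Singular value decomposition of the active constraint gradients\<close>

text \<open>The orthogonal factors are given by their columns. \<open>P 0, \<dots>, P (n - 1)\<close> are the columns of
  \<open>[Uhat Vhat]\<close> and \<open>Q 0, \<dots>, Q (card B - 1)\<close> those of \<open>[U V]\<close>, where \<open>n = CARD('n)\<close>, \<open>B\<close> is the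
  active set and the coordinates of \<open>Q j\<close> are indexed by \<open>B\<close>. In both cases the first \<open>r\<close> columns
  form \<open>Uhat\<close> resp. \<open>U\<close>, and \<open>\<sigma> 0, \<dots>, \<sigma> (r - 1)\<close> is the diagonal of \<open>\<Sigma>\<close>.\<close>

definition active_svd ::
  "(real ^ 'n \<Rightarrow> real ^ 'm) \<Rightarrow> real ^ 'n \<Rightarrow> nat \<Rightarrow> (nat \<Rightarrow> real ^ 'n) \<Rightarrow> (nat \<Rightarrow> real) \<Rightarrow> (nat \<Rightarrow> 'm \<Rightarrow> real) \<Rightarrow> bool" where
  "active_svd g zs r P \<sigma> Q \<longleftrightarrow>
     r \<le> CARD('n) \<and> r \<le> card (active g zs) \<and>
     (\<forall>i<CARD('n). \<forall>j<CARD('n). P i \<bullet> P j = (if i = j then 1 else 0)) \<and>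
     (\<forall>i<card (active g zs). \<forall>j<card (active g zs).
        (\<Sum>k\<in>active g zs. Q i k * Q j k) = (if i = j then 1 else 0)) \<and>
     (\<forall>j<r. \<sigma> j > 0) \<and>
     (\<forall>l. \<forall>k\<in>active g zs. nabla g zs $ l $ k = (\<Sum>j<r. P j $ l * \<sigma> j * Q j k))"

text \<open>Smallest eigenvalue; \<open>\<infinity>\<close> for the empty matrix, so that a lower bound on it is void when
  \<open>\<Sigma>\<close> or \<open>Vhat\<close> has no columns.\<close>

definition sigma_min :: "real Matrix.mat \<Rightarrow> ereal" where
  "sigma_min A = (INF k\<in>{k. eigenvalue A k}. ereal k)"

definition Sigma_mat :: "nat \<Rightarrow> (nat \<Rightarrow> real) \<Rightarrow> real Matrix.mat" where
  "Sigma_mat r \<sigma> = Matrix.mat r r (\<lambda>(i, j). if i = j then \<sigma> i else 0)"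

text \<open>\<open>Vhat\<^sup>T H Vhat\<close>, the columns of \<open>Vhat\<close> being \<open>P r, \<dots>, P (n - 1)\<close>.\<close>

definition reduced_mat :: "nat \<Rightarrow> (nat \<Rightarrow> real ^ 'n) \<Rightarrow> real ^ 'n ^ 'n \<Rightarrow> real Matrix.mat" where
  "reduced_mat r P H =
     Matrix.mat (CARD('n) - r) (CARD('n) - r) (\<lambda>(i, j). P (r + i) \<bullet> (H *v P (r + j)))"

section \<open>The exact step\<close>

definition diagm :: "real ^ 'm \<Rightarrow> real ^ 'm ^ 'm" where
  "diagm v = (\<chi> i j. if i = j then v $ i else 0)"

definition exact_step ::
  "(real ^ 'n \<Rightarrow> real) \<Rightarrow> (real ^ 'n \<Rightarrow> real ^ 'm) \<Rightarrow> real ^ 'n \<Rightarrow> real ^ 'm \<Rightarrow> real ^ 'm \<Rightarrow> real ^ 'm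
   \<Rightarrow> real ^ 'n \<Rightarrow> real ^ 'm \<Rightarrow> real ^ 'm \<Rightarrow> bool" where
  "exact_step \<phi> g z lam s t dz dlam ds \<longleftrightarrow>
     Lagr_zz \<phi> g z lam *v dz + nabla g z *v dlam = - Lagr_z \<phi> g z lam \<and>
     transpose (nabla g z) *v dz + ds = - (g z + s) \<and>
     diagm s *v dlam + diagm lam *v ds = - (diagm s *v (diagm lam *v (\<chi> i. 1)) + t)"

definition mu :: "real ^ 'm \<Rightarrow> real ^ 'm \<Rightarrow> real" where
  "mu lam s = (lam \<bullet> s) / CARD('m)"

section \<open>Floating-point arithmetic\<close>

datatype fop = FAdd | FSub | FMul | FDiv

fun exact_op :: "fop \<Rightarrow> real \<Rightarrow> real \<Rightarrow> real" where
  "exact_op FAdd x y = x + y"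
| "exact_op FSub x y = x - y"
| "exact_op FMul x y = x * y"
| "exact_op FDiv x y = x / y"

text \<open>\<open>FP\<close> is the set of floating-point numbers and \<open>fl op x y\<close> the computed value of \<open>x op y\<close>.
  As usual, changing the sign of a floating-point number is exact, and overflow and
  underflow are not modelled.\<close>

definition fp_arithmetic :: "real \<Rightarrow> real set \<Rightarrow> (fop \<Rightarrow> real \<Rightarrow> real \<Rightarrow> real) \<Rightarrow> bool" where
  "fp_arithmetic u FP fl \<longleftrightarrow>
     u > 0 \<and>
     (\<forall>x\<in>FP. - x \<in> FP) \<and>
     (\<forall>opr. \<forall>x\<in>FP. \<forall>y\<in>FP. (opr = FDiv \<longrightarrow> y \<noteq> 0) \<longrightarrow>
        fl opr x y \<in> FP \<and>
        (\<exists>\<epsilon>. \<bar>\<epsilon>\<bar> \<le> u \<and> fl opr x y = exact_op opr x y * (1 + \<epsilon>)))"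

text \<open>\<open>fl_sum fl A v\<close>: the sum of the terms in \<open>A\<close>, evaluated by floating-point additions and
  subtractions and sign changes in some order, gives \<open>v\<close>. No order of evaluation is singled out.\<close>

inductive fl_sum :: "(fop \<Rightarrow> real \<Rightarrow> real \<Rightarrow> real) \<Rightarrow> real multiset \<Rightarrow> real \<Rightarrow> bool"
  for fl :: "fop \<Rightarrow> real \<Rightarrow> real \<Rightarrow> real" where
  single: "fl_sum fl {#x#} x"
| neg: "fl_sum fl A x \<Longrightarrow> fl_sum fl (image_mset uminus A) (- x)"
| add: "fl_sum fl A x \<Longrightarrow> fl_sum fl B y \<Longrightarrow> fl_sum fl (A + B) (fl FAdd x y)"
| sub: "fl_sum fl A x \<Longrightarrow> fl_sum fl B y \<Longrightarrow> fl_sum fl (A + image_mset uminus B) (fl FSub x y)"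

section \<open>The computed step\<close>

text \<open>The diagonal of \<open>(D + G)\<^sup>-\<^sup>1\<close>, where \<open>D = \<Lambda>\<^sup>-\<^sup>1 S\<close> and the diagonal of \<open>G\<close> is the vector \<open>G\<close>.\<close>

definition Dinv_computed :: "real ^ 'm \<Rightarrow> real ^ 'm \<Rightarrow> real ^ 'm \<Rightarrow> real ^ 'm" where
  "Dinv_computed lam s G = (\<chi> i. inverse (s $ i / lam $ i + G $ i))"

text \<open>In the following definitions \<open>A\<close>, \<open>c\<close> and \<open>dinv\<close> are the computed values of the constraint
  gradients, of the constraints and of the diagonal of \<open>D\<^sup>-\<^sup>1\<close>.\<close>

definition computed_dz ::
  "(real ^ 'n \<Rightarrow> real) \<Rightarrow> (real ^ 'n \<Rightarrow> real ^ 'm) \<Rightarrow> real ^ 'n \<Rightarrow> real ^ 'm \<Rightarrow> real ^ 'm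
   \<Rightarrow> real ^ 'm ^ 'n \<Rightarrow> real ^ 'm \<Rightarrow> real ^ 'm
   \<Rightarrow> real ^ 'n ^ 'n \<Rightarrow> real ^ 'n \<Rightarrow> real ^ 'n ^ 'n \<Rightarrow> real ^ 'n \<Rightarrow> real ^ 'n \<Rightarrow> bool" where
  "computed_dz \<phi> g z lam t A c dinv Fbar fbar Fhat fhat dz \<longleftrightarrow>
     (Lagr_zz \<phi> g z lam + Fbar + A ** diagm dinv ** transpose A + Fhat) *v dz =
       - Lagr_z \<phi> g z lam - fbar
       - A *v (diagm dinv *v (c - (\<chi> i. t $ i / lam $ i)))
       + fhat"

text \<open>\<open>dinv * [c - \<Lambda>\<^sup>-\<^sup>1 t + A\<^sup>T dz]\<close> and \<open>-(c + s) - A\<^sup>T dz\<close>, evaluated in floating-point arithmetic.\<close>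

definition computed_dlam ::
  "(fop \<Rightarrow> real \<Rightarrow> real \<Rightarrow> real) \<Rightarrow> real ^ 'm \<Rightarrow> real ^ 'm \<Rightarrow> real ^ 'm ^ 'n \<Rightarrow> real ^ 'm \<Rightarrow> real ^ 'm
   \<Rightarrow> real ^ 'n \<Rightarrow> real ^ 'm \<Rightarrow> bool" where
  "computed_dlam fl lam t A c dinv dz dlam \<longleftrightarrow>
     (\<forall>i. \<exists>b.
        fl_sum fl ({# c $ i, - fl FDiv (t $ i) (lam $ i) #}
          + {# fl FMul (A $ j $ i) (dz $ j). j \<in># mset_set UNIV #}) b \<and>
        dlam $ i = fl FMul (dinv $ i) b)"

definition computed_ds ::
  "(fop \<Rightarrow> real \<Rightarrow> real \<Rightarrow> real) \<Rightarrow> real ^ 'm \<Rightarrow> real ^ 'm ^ 'n \<Rightarrow> real ^ 'm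
   \<Rightarrow> real ^ 'n \<Rightarrow> real ^ 'm \<Rightarrow> bool" where
  "computed_ds fl s A c dz ds \<longleftrightarrow>
     (\<forall>i. fl_sum fl ({# - (c $ i), - (s $ i) #}
        + {# - fl FMul (A $ j $ i) (dz $ j). j \<in># mset_set UNIV #}) (ds $ i))"

text \<open>The sizes of the perturbations, with implied constant \<open>K\<close>; \<open>m\<close> is the value of \<open>\<mu>\<close>.\<close>

definition perturbation_bounds ::
  "(real ^ 'n \<Rightarrow> real ^ 'm) \<Rightarrow> real ^ 'n \<Rightarrow> real \<Rightarrow> real \<Rightarrow> real
   \<Rightarrow> real ^ 'n ^ 'n \<Rightarrow> real ^ 'n \<Rightarrow> real ^ 'm ^ 'n \<Rightarrow> real ^ 'm \<Rightarrow> real ^ 'm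
   \<Rightarrow> real ^ 'n ^ 'n \<Rightarrow> real ^ 'n \<Rightarrow> bool" where
  "perturbation_bounds g zs K u m Fbar fbar F f G Fhat fhat \<longleftrightarrow>
     norm Fbar \<le> K * u \<and> norm fbar \<le> K * u \<and> norm F \<le> K * u \<and> norm f \<le> K * u \<and>
     (\<forall>i\<in>active g zs. \<bar>G $ i\<bar> \<le> K * m * u) \<and>
     (\<forall>i\<in>inactive g zs. \<bar>G $ i\<bar> \<le> K * u / m) \<and>
     norm Fhat \<le> K * u / m \<and> norm fhat \<le> K * u"

definition fp_vec :: "real set \<Rightarrow> real ^ 'k \<Rightarrow> bool" where
  "fp_vec FP v \<longleftrightarrow> (\<forall>i. v $ i \<in> FP)"

definition iterate_conditions ::
  "(real ^ 'n \<Rightarrow> real) \<Rightarrow> (real ^ 'n \<Rightarrow> real ^ 'm) \<Rightarrow> real \<Rightarrow> real \<Rightarrow> real ^ 'n \<Rightarrow> real ^ 'm \<Rightarrow> real ^ 'm \<Rightarrow> bool" where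
  "iterate_conditions \<phi> g C \<gamma> z lam s \<longleftrightarrow>
     norm (Lagr_z \<phi> g z lam) \<le> C * mu lam s \<and>
     norm (g z + s) \<le> C * mu lam s \<and>
     (\<forall>i. lam $ i > 0) \<and> (\<forall>i. s $ i > 0) \<and>
     (\<forall>i. lam $ i * s $ i \<ge> \<gamma> * mu lam s)"

definition conditioning_bounds ::
  "(real ^ 'n \<Rightarrow> real) \<Rightarrow> (real ^ 'n \<Rightarrow> real ^ 'm) \<Rightarrow> real ^ 'n \<Rightarrow> nat \<Rightarrow> (nat \<Rightarrow> real ^ 'n) \<Rightarrow> (nat \<Rightarrow> real)
   \<Rightarrow> real \<Rightarrow> real \<Rightarrow> real \<Rightarrow> bool" where
  "conditioning_bounds \<phi> g zs r P \<sigma> \<beta> u m \<longleftrightarrow>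
     sigma_min (Sigma_mat r \<sigma>) \<ge> ereal (\<beta> * max (m powr (1/3)) (u / m)) \<and>
     (\<forall>lams\<in>multipliers \<phi> g zs.
        sigma_min (reduced_mat r P (Lagr_zz \<phi> g zs lams)) \<ge> ereal (\<beta> * max (m powr (1/3)) (u / m)))"

end

theory Submission
  imports Defs "HOL-Library.Landau_Symbols"
begin

text \<open>Strict complementarity makes every second-order direction a null vector of
  \<open>\<nabla>g\<^sub>B(z\<^sup>*)\<^sup>T\<close>, so the Hessian of the Lagrangian is positive definite on that null
  space. Pairing \<open>L\<^sub>z(z, \<lambda>)\<close> with \<open>z - z\<^sup>*\<close> and comparing with a strictly complementary
  multiplier bounds \<open>\<parallel>z - z\<^sup>*\<parallel>\<^sup>2\<close>, \<open>s\<^sub>B\<close> and \<open>\<lambda>\<^sub>N\<close> by \<open>O(\<mu>)\<close>, whence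
  \<open>\<lambda>\<^sub>B\<close> and \<open>s\<^sub>N\<close> are bounded away from zero; pairing with the null space component
  improves this to \<open>z - z\<^sup>* = O(\<mu>)\<close>.

  The step with rounding and the exact step, as well as their difference, satisfy a system
  \<open>H v + A y = a\<close>, \<open>e\<^sub>i y\<^sub>i = (A\<^sup>T v)\<^sub>i + b\<^sub>i\<close> with \<open>e\<^sub>B\<close> of order \<open>\<mu>\<close> and
  \<open>e\<^sub>N\<close> of order at least \<open>1/\<mu>\<close>. An energy estimate shows that data of size \<open>\<theta>\<close> give
  \<open>v = O(\<theta>)\<close> and \<open>y\<^sub>B = O(\<theta>/\<mu>)\<close>. For the computed step \<open>\<theta> = \<mu>\<close>; this makes the data of
  the difference \<open>O(u)\<close>, which gives all bounds except the one on \<open>U\<^sup>T y\<^sub>B\<close>. The latter follows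
  because \<open>A y = a - H v = O(u)\<close> and \<open>A\<^sub>B\<close> is within \<open>O(\<mu>)\<close> of \<open>\<nabla>g\<^sub>B(z\<^sup>*)\<close>.

  Since all constants are uniform, it suffices to argue by contradiction along a sequence of
  counterexamples, so that every estimate becomes a Landau symbol with respect to a filter.\<close>

section \<open>The condensed linear system\<close>

text \<open>The first equation then says nothing about the component of \<open>y\<^sub>B\<close>
  along V; only the diagonal \<open>e\<^sub>B\<close> of order \<mu> controls it, so a factor \<mu>
  is lost in this direction. For the same reason \<open>lam\<close> need not converge, and it is
  compared with a nearby multiplier that moves along with it.

  The computed step must be measured before it is compared with the exact one, because some of its
  perturbations are not O(u) by themselves: \<open>Fhat\<close> and the inactive part of
  \<open>G\<close> are only O(u/\<mu>). They become O(u) after multiplication by \<open>dz'\<close>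
  and by the inactive multiplier steps, both of which are O(\<mu>). Rounding in the multiplier
  formula is kept out of the linear systems by an intermediate step \<open>y'\<close>, the exact
  value of that formula at the computed \<open>dz'\<close>.\<close>

lemma norm_matrix_vector_mult_le:
  fixes A :: "real ^ 'n ^ 'm"
  shows "norm (A *v x) \<le> norm A * norm x"
proof -
  have "norm (A *v x) \<le> L2_set (\<lambda>i. norm (A $ i) * norm x) UNIV"
    unfolding norm_vec_def[of "A *v x"]
    by (rule L2_set_mono) (auto simp: matrix_vector_mul_component Cauchy_Schwarz_ineq2)
  also have "\<dots> = norm A * norm x"
    by (simp add: norm_vec_def L2_set_left_distrib)
  finally show ?thesis .
qed

lemma norm_transpose: "norm (transpose A) = norm (A :: real ^ 'n ^ 'm)"
proof -
  have sq: "norm B = sqrt (\<Sum>i\<in>UNIV. \<Sum>j\<in>UNIV. (B $ i $ j)\<^sup>2)" for B :: "real ^ 'k ^ 'l"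
    by (simp add: norm_vec_def L2_set_def sum_nonneg)
  show ?thesis
    unfolding sq transpose_def by (simp, rule sum.swap)
qed

lemma inner_matrix_vector_transpose:
  fixes A :: "real ^ 'n ^ 'm"
  shows "x \<bullet> (A *v y) = (transpose A *v x) \<bullet> y"
  by (simp add: dot_lmul_matrix)

lemma three_squares: "(x + y + z)\<^sup>2 \<le> 3 * (x\<^sup>2 + y\<^sup>2 + (z :: real)\<^sup>2)"
proof -
  have "0 \<le> (x - y)\<^sup>2 + (y - z)\<^sup>2 + (x - z)\<^sup>2" by simp
  then show ?thesis by (simp add: power2_eq_square algebra_simps)
qed

text \<open>Coercivity is available only at \<open>v\<close>, later the null space component of
  \<open>w\<close>. Young's inequality spends half of it on the cross terms, and \<open>(norm
  w)\<^sup>2 \<le> 2 * (norm v)\<^sup>2 + 2 * (norm (w - v))\<^sup>2\<close> costs another half;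
  hence \<xi> / 4.\<close>

lemma quadratic_form_lower_bound:
  fixes H :: "real ^ 'n ^ 'n"
  assumes \<xi>: "\<xi> > 0" and M: "norm H \<le> M"
    and v: "\<xi> * (norm v)\<^sup>2 \<le> v \<bullet> (H *v v)"
  shows "\<xi> / 4 * (norm w)\<^sup>2 - (\<xi> / 2 + 2 * M\<^sup>2 / \<xi> + M) * (norm (w - v))\<^sup>2 \<le> w \<bullet> (H *v w)"
proof -
  define r where "r = w - v"
  have M0: "0 \<le> M" using M norm_ge_zero[of H] by linarith
  have bd: "\<bar>x \<bullet> (H *v y)\<bar> \<le> M * (norm x * norm y)" for x y
  proof -
    have "\<bar>x \<bullet> (H *v y)\<bar> \<le> norm x * norm (H *v y)" by (rule Cauchy_Schwarz_ineq2)
    also have "\<dots> \<le> norm x * (M * norm y)"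
      by (intro mult_left_mono order_trans[OF norm_matrix_vector_mult_le] mult_right_mono M) auto
    finally show ?thesis by (simp add: mult_ac)
  qed
  have w: "w = v + r" by (simp add: r_def)
  have "w \<bullet> (H *v w) = v \<bullet> (H *v v) + v \<bullet> (H *v r) + r \<bullet> (H *v v) + r \<bullet> (H *v r)"
    unfolding w by (simp add: inner_add_left inner_add_right matrix_vector_right_distrib)
  then have 1: "w \<bullet> (H *v w) \<ge> \<xi> * (norm v)\<^sup>2 - 2 * (M * norm r * norm v) - M * (norm r)\<^sup>2"
    using v bd[of v r] bd[of r v] bd[of r r] by (simp add: power2_eq_square mult_ac)
  have 2: "2 * (M * norm r * norm v) \<le> \<xi> / 2 * (norm v)\<^sup>2 + 2 * M\<^sup>2 / \<xi> * (norm r)\<^sup>2"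
  proof -
    have "0 \<le> (\<xi> * norm v - 2 * M * norm r)\<^sup>2 / (2 * \<xi>)" using \<xi> by simp
    also have "\<dots> = \<xi> / 2 * (norm v)\<^sup>2 + 2 * M\<^sup>2 / \<xi> * (norm r)\<^sup>2 - 2 * (M * norm r * norm v)"
      using \<xi> by (simp add: field_simps power2_eq_square)
    finally show ?thesis by linarith
  qed
  have 3: "(norm w)\<^sup>2 \<le> 2 * (norm v)\<^sup>2 + 2 * (norm r)\<^sup>2"
  proof -
    have "(norm w)\<^sup>2 \<le> (norm v + norm r)\<^sup>2"
      unfolding w by (rule power_mono[OF norm_triangle_ineq]) simp
    also have "\<dots> \<le> 2 * (norm v)\<^sup>2 + 2 * (norm r)\<^sup>2"
      using sum_squares_bound[of "norm v" "norm r"] by (simp add: power2_sum)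
    finally show ?thesis .
  qed
  have "\<xi> / 4 * (norm w)\<^sup>2 \<le> \<xi> / 4 * (2 * (norm v)\<^sup>2 + 2 * (norm r)\<^sup>2)"
    using 3 \<xi> by (intro mult_left_mono) auto
  then show ?thesis
    using 1 2 unfolding r_def[symmetric] by (simp add: algebra_simps)
qed

text \<open>Pairing the first equation with \<open>w\<close> and inserting the second controls
  \<open>y\<close> with weight \<mu>, whereas the distance of \<open>w\<close> from the null space
  costs only a multiple of \<open>\<mu>\<^sup>2 * (norm y)\<^sup>2\<close>, which small \<mu>
  absorbs. Since \<open>b \<bullet> y\<close> contributes a term of order
  \<open>\<theta>\<^sup>2 / \<mu>\<close>, this gives the right order for \<open>y\<close> but would
  lose a factor \<open>sqrt \<mu>\<close> in \<open>w\<close>. A second pairing, with the null space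
  component \<open>v\<close>, avoids that loss.\<close>

lemma condensed_system_bound:
  fixes As :: "real ^ 'm ^ 'n" and \<kappa> \<xi> M c K :: real
  assumes proj: "\<And>w. \<exists>v. transpose As *v v = 0 \<and> norm (w - v) \<le> \<kappa> * norm (transpose As *v w)"
    and \<kappa>: "\<kappa> > 0" and \<xi>: "\<xi> > 0" and M: "M > 0" and c: "c > 0" and K: "K > 0"
  obtains \<mu>0 K' where "\<mu>0 > 0" "K' > 0"
    "\<And>H A e w y a b \<mu> \<theta>. \<lbrakk>0 < \<mu>; \<mu> \<le> \<mu>0; 0 \<le> \<theta>; norm H \<le> M;
       \<And>v. transpose As *v v = 0 \<Longrightarrow> \<xi> * (norm v)\<^sup>2 \<le> v \<bullet> (H *v v);
       norm (A - As) \<le> M * \<mu>; \<And>i. c * \<mu> \<le> e $ i; \<And>i. e $ i \<le> K * \<mu>;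
       H *v w + A *v y = a; \<And>i. e $ i * y $ i = (transpose A *v w) $ i + b $ i;
       norm a \<le> \<theta>; norm b \<le> \<theta>\<rbrakk> \<Longrightarrow> norm w \<le> K' * \<theta> \<and> norm y \<le> K' * \<theta> / \<mu>"
proof -
  \<comment> \<open>With \<open>p = norm (transpose As *v w)\<close>, the distance of
    \<open>w\<close> from the null space is at most \<open>\<kappa> * p\<close>, so
    \<open>E * p\<^sup>2\<close> bounds the loss in
    \<open>quadratic_form_lower_bound\<close>.\<close>
  define E where "E = (\<xi> / 2 + 2 * M\<^sup>2 / \<xi> + M) * \<kappa>\<^sup>2"
  have E: "E > 0" using \<xi> M \<kappa> by (simp add: E_def add_pos_nonneg)
  \<comment> \<open>Apart from \<mu> \<le> 1, the bounds on \<mu> keep the \<open>y\<close> part of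
    \<open>E * p\<^sup>2\<close> below half of \<open>c * \<mu> * (norm y)\<^sup>2\<close>, its
    \<open>w\<close> part below \<open>\<xi> / 8 * (norm w)\<^sup>2\<close>, and the feedback of
    \<open>w\<close> in the second pairing below \<open>\<xi> / 2 * norm w\<close>.\<close>
  define \<mu>0 where "\<mu>0 = min (min 1 (c / (6 * E * K\<^sup>2))) (min (sqrt (\<xi> / (24 * E * M\<^sup>2))) (\<xi> / (2 * M * (\<xi> * \<kappa> + M * \<kappa> + 1))))"
  have \<mu>0: "\<mu>0 > 0" unfolding \<mu>0_def using c E K \<xi> M \<kappa> by (auto simp: add_pos_pos)
  define K1 where "K1 = 4 / c * (3 * E + 2 / \<xi> + 1 / c)"
  define K2 where "K2 = sqrt K1"
  have K1: "K1 > 0" unfolding K1_def using c E \<xi> by (simp add: add_pos_pos)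
  then have K2: "K2 > 0" by (simp add: K2_def)
  define K3 where "K3 = 2 / \<xi> * (1 + M * K2 + (M + \<xi>) * \<kappa> * (K * K2 + 1))"
  have K3: "K3 > 0" unfolding K3_def using \<xi> M K2 \<kappa> K by (simp add: add_pos_pos)
  show ?thesis
  proof (rule that[of \<mu>0 "max K2 K3"])
    show "\<mu>0 > 0" by fact
    show "max K2 K3 > 0" using K3 by simp
    fix H :: "real ^ 'n ^ 'n" and A :: "real ^ 'm ^ 'n" and e y b :: "real ^ 'm" and w a :: "real ^ 'n"
      and \<mu> \<theta> :: real
    assume \<mu>: "0 < \<mu>" and \<mu>le: "\<mu> \<le> \<mu>0" and \<theta>: "0 \<le> \<theta>" and HM: "norm H \<le> M"
      and Hv: "\<And>v. transpose As *v v = 0 \<Longrightarrow> \<xi> * (norm v)\<^sup>2 \<le> v \<bullet> (H *v v)"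
      and AM: "norm (A - As) \<le> M * \<mu>" and el: "\<And>i. c * \<mu> \<le> e $ i" and eu: "\<And>i. e $ i \<le> K * \<mu>"
      and eq1: "H *v w + A *v y = a" and eq2: "\<And>i. e $ i * y $ i = (transpose A *v w) $ i + b $ i"
      and a: "norm a \<le> \<theta>" and b: "norm b \<le> \<theta>"
    have \<mu>1: "\<mu> \<le> 1" and \<mu>2: "\<mu> \<le> c / (6 * E * K\<^sup>2)" and \<mu>3: "\<mu> \<le> sqrt (\<xi> / (24 * E * M\<^sup>2))"
      and \<mu>4: "\<mu> \<le> \<xi> / (2 * M * (\<xi> * \<kappa> + M * \<kappa> + 1))"
      using \<mu>le by (simp_all add: \<mu>0_def)
    have Aw: "transpose A *v w = (\<chi> i. e $ i * y $ i) - b"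
      by (simp add: vec_eq_iff eq2)
    have ey: "norm (\<chi> i. e $ i * y $ i) \<le> K * \<mu> * norm y"
    proof -
      have "norm (\<chi> i. e $ i * y $ i) \<le> L2_set (\<lambda>i. K * \<mu> * norm (y $ i)) UNIV"
        unfolding norm_vec_def
      proof (rule L2_set_mono)
        fix i
        have "0 \<le> e $ i" using el[of i] c \<mu> by (meson dual_order.trans less_imp_le mult_pos_pos)
        then show "norm ((\<chi> i. e $ i * y $ i) $ i) \<le> K * \<mu> * norm (y $ i)"
          using eu[of i] by (simp add: abs_mult mult_right_mono)
      qed simp
      also have "\<dots> = K * \<mu> * norm y"
        using K \<mu> by (simp add: norm_vec_def L2_set_right_distrib)
      finally show ?thesis .
    qed
    obtain v where v0: "transpose As *v v = 0" and v: "norm (w - v) \<le> \<kappa> * norm (transpose As *v w)"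
      using proj by blast
    define p where "p = norm (transpose As *v w)"
    have p: "p \<le> K * \<mu> * norm y + \<theta> + M * \<mu> * norm w"
    proof -
      have TA: "transpose As *v w = (\<chi> i. e $ i * y $ i) - b - transpose (A - As) *v w"
        unfolding Aw[symmetric]
        by (simp add: vec_eq_iff transpose_def matrix_vector_mult_def sum_subtractf left_diff_distrib)
      have "p \<le> norm (\<chi> i. e $ i * y $ i) + norm b + norm (transpose (A - As) *v w)"
        unfolding p_def TA
        using norm_triangle_ineq4[of "(\<chi> i. e $ i * y $ i) - b" "transpose (A - As) *v w"]
          norm_triangle_ineq4[of "\<chi> i. e $ i * y $ i" b] by linarith
      also have "norm (transpose (A - As) *v w) \<le> M * \<mu> * norm w"
        by (rule order_trans[OF norm_matrix_vector_mult_le]) (simp add: norm_transpose AM mult_right_mono)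
      finally show ?thesis using ey b by linarith
    qed
    have p0: "0 \<le> p" by (simp add: p_def)
    have r: "norm (w - v) \<le> \<kappa> * p" using v by (simp add: p_def)
    have energy: "w \<bullet> (H *v w) + (\<Sum>i\<in>UNIV. e $ i * (y $ i)\<^sup>2) = a \<bullet> w + b \<bullet> y"
    proof -
      have "w \<bullet> (H *v w) + (transpose A *v w) \<bullet> y = a \<bullet> w"
        unfolding eq1[symmetric] inner_matrix_vector_transpose[symmetric]
        by (simp add: inner_add_right inner_commute[of _ w])
      moreover have "(transpose A *v w) \<bullet> y = (\<Sum>i\<in>UNIV. e $ i * (y $ i)\<^sup>2) - b \<bullet> y"
        unfolding Aw by (simp add: inner_diff_left) (simp add: inner_vec_def power2_eq_square mult_ac)
      ultimately show ?thesis by linarith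
    qed
    have ey2: "c * \<mu> * (norm y)\<^sup>2 \<le> (\<Sum>i\<in>UNIV. e $ i * (y $ i)\<^sup>2)"
    proof -
      have "(norm y)\<^sup>2 = (\<Sum>i\<in>UNIV. (y $ i)\<^sup>2)"
        by (simp add: norm_vec_def L2_set_def sum_nonneg)
      then show ?thesis
        by (simp add: sum_distrib_left) (intro sum_mono mult_right_mono el, auto)
    qed
    have E1: "\<xi> / 4 * (norm w)\<^sup>2 - E * p\<^sup>2 \<le> w \<bullet> (H *v w)"
    proof -
      have "(norm (w - v))\<^sup>2 \<le> \<kappa>\<^sup>2 * p\<^sup>2"
        using power_mono[OF r, of 2] by (simp add: power_mult_distrib)
      then have "(\<xi> / 2 + 2 * M\<^sup>2 / \<xi> + M) * (norm (w - v))\<^sup>2 \<le> E * p\<^sup>2"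
        unfolding E_def mult.assoc using \<xi> M by (intro mult_left_mono) auto
      then show ?thesis
        using quadratic_form_lower_bound[OF \<xi> HM Hv[OF v0], of w] by linarith
    qed
    have ab: "a \<bullet> w + b \<bullet> y \<le> \<theta> * norm w + \<theta> * norm y"
      by (intro add_mono order_trans[OF norm_cauchy_schwarz] mult_right_mono a b) auto
    have p2: "E * p\<^sup>2 \<le> c / 2 * \<mu> * (norm y)\<^sup>2 + 3 * E * \<theta>\<^sup>2 + \<xi> / 8 * (norm w)\<^sup>2"
    proof -
      have "p\<^sup>2 \<le> (K * \<mu> * norm y + \<theta> + M * \<mu> * norm w)\<^sup>2"
        by (rule power_mono[OF p p0])
      also have "\<dots> \<le> 3 * ((K * \<mu> * norm y)\<^sup>2 + \<theta>\<^sup>2 + (M * \<mu> * norm w)\<^sup>2)"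
        by (rule three_squares)
      finally have "E * p\<^sup>2 \<le> E * (3 * ((K * \<mu> * norm y)\<^sup>2 + \<theta>\<^sup>2 + (M * \<mu> * norm w)\<^sup>2))"
        using E by (intro mult_left_mono) auto
      also have "\<dots> = (3 * E * K\<^sup>2 * \<mu>) * (\<mu> * (norm y)\<^sup>2) + 3 * E * \<theta>\<^sup>2 + (3 * E * M\<^sup>2 * \<mu>\<^sup>2) * (norm w)\<^sup>2"
        by (simp add: power2_eq_square algebra_simps)
      also have "\<dots> \<le> (c / 2) * (\<mu> * (norm y)\<^sup>2) + 3 * E * \<theta>\<^sup>2 + (\<xi> / 8) * (norm w)\<^sup>2"
      proof (intro add_mono mult_right_mono order_refl)
        show "3 * E * K\<^sup>2 * \<mu> \<le> c / 2"
          using \<mu>2 E K by (simp add: field_simps)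
        have "\<mu>\<^sup>2 \<le> \<xi> / (24 * E * M\<^sup>2)"
          using \<mu>3 \<mu> \<xi> E M by (metis less_imp_le real_le_rsqrt real_sqrt_le_iff real_sqrt_abs abs_of_pos)
        then show "3 * E * M\<^sup>2 * \<mu>\<^sup>2 \<le> \<xi> / 8"
          using E M by (simp add: field_simps)
      qed (use \<mu> E in auto)
      finally show ?thesis by (simp add: mult_ac)
    qed
    have tw: "\<theta> * norm w \<le> \<xi> / 8 * (norm w)\<^sup>2 + 2 / \<xi> * \<theta>\<^sup>2"
    proof -
      have "0 \<le> (\<xi> * norm w - 4 * \<theta>)\<^sup>2 / (8 * \<xi>)" using \<xi> by simp
      also have "\<dots> = \<xi> / 8 * (norm w)\<^sup>2 + 2 / \<xi> * \<theta>\<^sup>2 - \<theta> * norm w"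
        using \<xi> by (simp add: field_simps power2_eq_square)
      finally show ?thesis by linarith
    qed
    have ty: "\<theta> * norm y \<le> c / 4 * \<mu> * (norm y)\<^sup>2 + \<theta>\<^sup>2 / (c * \<mu>)"
    proof -
      have "0 \<le> (c * \<mu> * norm y - 2 * \<theta>)\<^sup>2 / (4 * (c * \<mu>))" using c \<mu> by simp
      also have "\<dots> = c / 4 * \<mu> * (norm y)\<^sup>2 + \<theta>\<^sup>2 / (c * \<mu>) - \<theta> * norm y"
        using c \<mu> by (simp add: field_simps power2_eq_square)
      finally show ?thesis by linarith
    qed
    \<comment> \<open>The coefficient \<xi> / 4 of \<open>(norm w)\<^sup>2\<close> is used up
      completely, one half in \<open>p2\<close> and one half in \<open>tw\<close>, so that only
      \<open>y\<close> is estimated here.\<close>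
    have "c / 4 * \<mu> * (norm y)\<^sup>2 \<le> (3 * E + 2 / \<xi>) * \<theta>\<^sup>2 + \<theta>\<^sup>2 / (c * \<mu>)"
      using energy ey2 E1 ab p2 tw ty by (simp add: algebra_simps)
    also have "\<dots> \<le> (3 * E + 2 / \<xi>) * \<theta>\<^sup>2 / \<mu> + \<theta>\<^sup>2 / (c * \<mu>)"
    proof -
      have "(3 * E + 2 / \<xi>) * \<theta>\<^sup>2 * 1 \<le> (3 * E + 2 / \<xi>) * \<theta>\<^sup>2 * (1 / \<mu>)"
        using \<mu> \<mu>1 E \<xi> by (intro mult_left_mono) (auto simp: field_simps)
      then show ?thesis by simp
    qed
    finally have "(norm y)\<^sup>2 \<le> K1 * \<theta>\<^sup>2 / \<mu>\<^sup>2"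
      using c \<mu> \<xi> by (simp add: K1_def field_simps power2_eq_square)
    then have "norm y \<le> sqrt (K1 * \<theta>\<^sup>2 / \<mu>\<^sup>2)" by (rule real_le_rsqrt)
    then have y: "norm y \<le> K2 * \<theta> / \<mu>"
      using \<theta> \<mu> by (simp add: K2_def real_sqrt_mult real_sqrt_divide)
    then have \<mu>y: "\<mu> * norm y \<le> K2 * \<theta>" using \<mu> by (simp add: field_simps)
    have p': "p \<le> (K * K2 + 1) * \<theta> + M * \<mu> * norm w"
    proof -
      have "K * (\<mu> * norm y) \<le> K * (K2 * \<theta>)" using \<mu>y K by (intro mult_left_mono) auto
      then show ?thesis using p by (simp only: algebra_simps)
    qed
    \<comment> \<open>As \<open>v \<bullet> (As *v y) = 0\<close>, the large vector \<open>y\<close>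
      enters only through \<open>A - As\<close>, and \<open>\<mu> * norm y\<close> is already
      O(\<theta>). All terms are linear in \<open>norm v\<close>, which can be divided out.\<close>
    have v1: "\<xi> * norm v \<le> \<theta> + M * \<kappa> * p + M * (\<mu> * norm y)"
    proof -
      have "v \<bullet> (H *v v) = v \<bullet> a - v \<bullet> ((A - As) *v y) - v \<bullet> (H *v (w - v))"
      proof -
        have "v \<bullet> (As *v y) = 0" by (simp add: inner_matrix_vector_transpose v0 del: transpose_matrix_vector)
        then show ?thesis
          unfolding eq1[symmetric]
          by (simp add: inner_add_right inner_diff_right matrix_vector_mult_diff_distrib matrix_vector_mult_diff_rdistrib)
      qed
      also have "\<dots> \<le> norm v * norm a + norm v * norm ((A - As) *v y) + norm v * norm (H *v (w - v))"
        using Cauchy_Schwarz_ineq2[of v a] Cauchy_Schwarz_ineq2[of v "(A - As) *v y"]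
          Cauchy_Schwarz_ineq2[of v "H *v (w - v)"] by linarith
      also have "\<dots> \<le> norm v * \<theta> + norm v * (M * \<mu> * norm y) + norm v * (M * (\<kappa> * p))"
      proof (intro add_mono mult_left_mono a)
        show "norm ((A - As) *v y) \<le> M * \<mu> * norm y"
          by (rule order_trans[OF norm_matrix_vector_mult_le]) (simp add: AM mult_right_mono)
        show "norm (H *v (w - v)) \<le> M * (\<kappa> * p)"
          by (rule order_trans[OF norm_matrix_vector_mult_le]) (use HM r M in \<open>intro mult_mono, auto\<close>)
      qed auto
      finally have *: "norm v * (\<xi> * norm v) \<le> norm v * (\<theta> + M * \<kappa> * p + M * (\<mu> * norm y))"
        using Hv[OF v0] by (simp add: power2_eq_square algebra_simps)
      show ?thesis
      proof (cases "v = 0")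
        case True
        then show ?thesis using \<theta> M \<kappa> p0 \<mu> by simp
      next
        case False
        then show ?thesis using * by simp
      qed
    qed
    have "norm w \<le> norm v + \<kappa> * p"
      using r norm_triangle_sub[of w v] by linarith
    then have "\<xi> * norm w \<le> \<xi> * (norm v + \<kappa> * p)"
      using \<xi> by (intro mult_left_mono) auto
    also have "\<dots> \<le> \<theta> + M * (K2 * \<theta>) + (M + \<xi>) * \<kappa> * p"
    proof -
      have "M * (\<mu> * norm y) \<le> M * (K2 * \<theta>)" using \<mu>y M by (intro mult_left_mono) auto
      then show ?thesis using v1 by (simp only: algebra_simps)
    qed
    also have "\<dots> \<le> \<theta> + M * (K2 * \<theta>) + (M + \<xi>) * \<kappa> * ((K * K2 + 1) * \<theta> + M * \<mu> * norm w)"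
      using p' \<xi> M \<kappa> by (intro add_left_mono mult_left_mono) auto
    also have "\<dots> = \<xi> / 2 * K3 * \<theta> + ((M + \<xi>) * \<kappa> * M * \<mu>) * norm w"
      using \<xi> by (simp add: K3_def field_simps)
    also have "\<dots> \<le> \<xi> / 2 * K3 * \<theta> + \<xi> / 2 * norm w"
    proof (intro add_left_mono mult_right_mono)
      have "(M + \<xi>) * \<kappa> * M * \<mu> \<le> (2 * M * (\<xi> * \<kappa> + M * \<kappa> + 1)) * \<mu> / 2"
        using M \<mu> by (simp add: field_simps)
      also have "\<dots> \<le> \<xi> / 2"
        using \<mu>4 M \<xi> \<kappa> by (simp add: field_simps add_pos_pos pos_le_divide_eq)
      finally show "(M + \<xi>) * \<kappa> * M * \<mu> \<le> \<xi> / 2" .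
    qed auto
    finally have w: "norm w \<le> K3 * \<theta>"
      using \<xi> by (simp add: field_simps)
    have "K3 * \<theta> \<le> max K2 K3 * \<theta>" "K2 * \<theta> / \<mu> \<le> max K2 K3 * \<theta> / \<mu>"
      using \<theta> \<mu> by (auto intro!: mult_right_mono divide_right_mono)
    then show "norm w \<le> max K2 K3 * \<theta> \<and> norm y \<le> max K2 K3 * \<theta> / \<mu>"
      using w y by linarith
  qed
qed

section \<open>Rounding errors\<close>

text \<open>Guards against truncation in the exponents \<open>size A - 1\<close> below.\<close>

lemma fl_sum_nonempty: "fl_sum fl A v \<Longrightarrow> size A \<ge> 1"
  by (induction rule: fl_sum.induct) auto

lemma fp_arithmetic_op:
  assumes "fp_arithmetic u FP fl" "x \<in> FP" "y \<in> FP" "opr = FDiv \<Longrightarrow> y \<noteq> 0"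
  shows "fl opr x y \<in> FP" "\<bar>fl opr x y - exact_op opr x y\<bar> \<le> u * \<bar>exact_op opr x y\<bar>"
proof -
  obtain \<epsilon> where *: "fl opr x y \<in> FP" "\<bar>\<epsilon>\<bar> \<le> u" "fl opr x y = exact_op opr x y * (1 + \<epsilon>)"
    using assms unfolding fp_arithmetic_def by blast
  show "fl opr x y \<in> FP" by fact
  have "\<bar>fl opr x y - exact_op opr x y\<bar> = \<bar>\<epsilon>\<bar> * \<bar>exact_op opr x y\<bar>"
    by (simp add: *(3) algebra_simps flip: abs_mult)
  then show "\<bar>fl opr x y - exact_op opr x y\<bar> \<le> u * \<bar>exact_op opr x y\<bar>"
    using *(2) by (simp add: mult_right_mono)
qed

lemma fp_arithmetic_uminus: "fp_arithmetic u FP fl \<Longrightarrow> x \<in> FP \<Longrightarrow> - x \<in> FP"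
  by (simp add: fp_arithmetic_def)

text \<open>One node of an evaluation tree. A sum of \<open>a\<close> terms takes
  \<open>a - 1\<close> additions, hence the exponents; both errors are enlarged to the common factor
  \<open>c\<close>, and the operation at the node contributes one more factor
  \<open>1 + u\<close>.\<close>

lemma rounded_addition_error:
  fixes u x y v SA SB TA TB :: real
  assumes u: "u \<ge> 0" and a: "a \<ge> 1" and b: "b \<ge> (1 :: nat)"
    and x: "\<bar>x - SA\<bar> \<le> ((1 + u) ^ (a - 1) - 1) * TA" and y: "\<bar>y - SB\<bar> \<le> ((1 + u) ^ (b - 1) - 1) * TB"
    and SA: "\<bar>SA\<bar> \<le> TA" and SB: "\<bar>SB\<bar> \<le> TB"
    and v: "\<bar>v - (x + y)\<bar> \<le> u * \<bar>x + y\<bar>"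
  shows "\<bar>v - (SA + SB)\<bar> \<le> ((1 + u) ^ (a + b - 1) - 1) * (TA + TB)"
proof -
  define c where "c = (1 + u) ^ (a + b - 2)"
  have TA: "0 \<le> TA" and TB: "0 \<le> TB" using SA SB by linarith+
  have "(1 + u) ^ (a - 1) \<le> c" "(1 + u) ^ (b - 1) \<le> c"
    unfolding c_def using u a b by (auto intro!: power_increasing)
  then have "((1 + u) ^ (a - 1) - 1) * TA \<le> (c - 1) * TA" "((1 + u) ^ (b - 1) - 1) * TB \<le> (c - 1) * TB"
    using TA TB by (auto intro!: mult_right_mono)
  then have x': "\<bar>x - SA\<bar> \<le> (c - 1) * TA" and y': "\<bar>y - SB\<bar> \<le> (c - 1) * TB"
    using x y by linarith+
  have "\<bar>x + y\<bar> \<le> c * (TA + TB)"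
    using x' y' SA SB by (simp add: algebra_simps)
  then have "u * \<bar>x + y\<bar> \<le> u * (c * (TA + TB))" using u by (rule mult_left_mono)
  then have "\<bar>v - (SA + SB)\<bar> \<le> ((1 + u) * c - 1) * (TA + TB)"
    using v x' y' by (simp add: algebra_simps)
  moreover have "a + b - 1 = Suc (a + b - 2)" using a b by simp
  ultimately show ?thesis by (simp add: c_def)
qed

lemma sum_mset_abs_le: "\<bar>\<Sum>\<^sub># A\<bar> \<le> (\<Sum>a\<in>#A. \<bar>a :: real\<bar>)"
  by (induction A) auto

text \<open>The bound depends only on the number of terms, since every bracketing uses the same
  number of rounded operations and sign changes are exact. The error is relative to the sum of the
  absolute values, because cancellation may make the sum itself arbitrarily small.\<close>

lemma fl_sum_error:
  assumes fp: "fp_arithmetic u FP fl"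
  shows "fl_sum fl A v \<Longrightarrow> set_mset A \<subseteq> FP \<Longrightarrow>
    v \<in> FP \<and> \<bar>v - \<Sum>\<^sub># A\<bar> \<le> ((1 + u) ^ (size A - 1) - 1) * (\<Sum>a\<in>#A. \<bar>a\<bar>)"
proof (induction rule: fl_sum.induct)
  case (single x)
  then show ?case by simp
next
  case (neg A x)
  have "set_mset A \<subseteq> FP"
    using neg.prems fp_arithmetic_uminus[OF fp] by force
  moreover have "\<Sum>\<^sub># (image_mset uminus A) = - \<Sum>\<^sub># A"
    by (induction A) auto
  ultimately show ?case
    using neg.IH fp_arithmetic_uminus[OF fp]
    by (simp add: multiset.map_comp comp_def abs_minus_commute[of x "\<Sum>\<^sub># A"])
next
  case (add A x B y)
  have u: "u \<ge> 0" using fp by (simp add: fp_arithmetic_def)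
  have x: "x \<in> FP" "\<bar>x - \<Sum>\<^sub># A\<bar> \<le> ((1 + u) ^ (size A - 1) - 1) * (\<Sum>a\<in>#A. \<bar>a\<bar>)"
    and y: "y \<in> FP" "\<bar>y - \<Sum>\<^sub># B\<bar> \<le> ((1 + u) ^ (size B - 1) - 1) * (\<Sum>a\<in>#B. \<bar>a\<bar>)"
    using add by auto
  have v: "\<bar>fl FAdd x y - (x + y)\<bar> \<le> u * \<bar>x + y\<bar>"
    using fp_arithmetic_op(2)[OF fp x(1) y(1), of FAdd] by simp
  show ?case
    using rounded_addition_error[OF u fl_sum_nonempty[OF add.hyps(1)] fl_sum_nonempty[OF add.hyps(2)]
        x(2) y(2) sum_mset_abs_le sum_mset_abs_le v] fp_arithmetic_op(1)[OF fp x(1) y(1), of FAdd]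
    by simp
next
  case (sub A x B y)
  have u: "u \<ge> 0" using fp by (simp add: fp_arithmetic_def)
  have neg: "\<Sum>\<^sub># (image_mset uminus B) = - \<Sum>\<^sub># B"
    by (induction B) auto
  have "set_mset B \<subseteq> FP"
    using sub.prems fp_arithmetic_uminus[OF fp] by force
  then have x: "x \<in> FP" "\<bar>x - \<Sum>\<^sub># A\<bar> \<le> ((1 + u) ^ (size A - 1) - 1) * (\<Sum>a\<in>#A. \<bar>a\<bar>)"
    and y: "y \<in> FP" "\<bar>y - \<Sum>\<^sub># B\<bar> \<le> ((1 + u) ^ (size B - 1) - 1) * (\<Sum>a\<in>#B. \<bar>a\<bar>)"
    using sub by auto
  \<comment> \<open>A rounded subtraction is a rounded addition of \<open>- y\<close>, whose error
    as an approximation of the negated sum is that of \<open>y\<close>.\<close>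
  have y': "\<bar>- y - - \<Sum>\<^sub># B\<bar> \<le> ((1 + u) ^ (size B - 1) - 1) * (\<Sum>a\<in>#B. \<bar>a\<bar>)"
    using y(2) by linarith
  have B: "\<bar>- \<Sum>\<^sub># B\<bar> \<le> (\<Sum>a\<in>#B. \<bar>a\<bar>)"
    using sum_mset_abs_le[of B] by simp
  have v: "\<bar>fl FSub x y - (x + - y)\<bar> \<le> u * \<bar>x + - y\<bar>"
    using fp_arithmetic_op(2)[OF fp x(1) y(1), of FSub] by simp
  show ?case
    using rounded_addition_error[OF u fl_sum_nonempty[OF sub.hyps(1)] fl_sum_nonempty[OF sub.hyps(2)]
        x(2) y' sum_mset_abs_le B v] fp_arithmetic_op(1)[OF fp x(1) y(1), of FSub]
    by (simp add: neg multiset.map_comp comp_def)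
qed

lemma power_one_plus_le:
  fixes u :: real
  assumes "0 \<le> u" "u \<le> 1"
  shows "(1 + u) ^ N - 1 \<le> 2 ^ N * u"
proof -
  \<comment> \<open>The chord of the convex function \<open>(1 + u) ^ N\<close> over the interval
    from 0 to 1. The sharper factor \<open>2 ^ N - 1\<close> is what makes the induction
    close.\<close>
  have "(1 + u) ^ N - 1 \<le> (2 ^ N - 1) * u"
  proof (induction N)
    case (Suc N)
    have "(1 + u) ^ Suc N - 1 = (1 + u) * ((1 + u) ^ N - 1) + u" by (simp add: algebra_simps)
    also have "\<dots> \<le> 2 * ((2 ^ N - 1) * u) + u"
      using Suc assms by (intro add_right_mono mult_mono) auto
    finally show ?case by (simp add: algebra_simps)
  qed simp
  then show ?thesis using assms by (simp add: algebra_simps)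
qed

text \<open>The terms of the sums evaluated below are themselves rounded; \<open>a k\<close> is the exact value of
  the \<open>k\<close>-th term.\<close>

lemma fl_sum_rounded_terms_error:
  fixes a b :: "'k \<Rightarrow> real"
  assumes fp: "fp_arithmetic u FP fl" and u: "u \<le> 1" and I: "finite I"
    and sum: "fl_sum fl {# b k. k \<in># mset_set I #} v"
    and b: "\<And>k. k \<in> I \<Longrightarrow> b k \<in> FP" "\<And>k. k \<in> I \<Longrightarrow> \<bar>b k - a k\<bar> \<le> u * \<bar>a k\<bar>"
  shows "v \<in> FP" "\<bar>v - (\<Sum>k\<in>I. a k)\<bar> \<le> 2 ^ (card I + 2) * u * (\<Sum>k\<in>I. \<bar>a k\<bar>)"
proof -
  have u0: "0 \<le> u" using fp by (simp add: fp_arithmetic_def)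
  define N where "N = card I"
  define T where "T = (\<Sum>k\<in>I. \<bar>a k\<bar>)"
  have T: "0 \<le> T" by (simp add: T_def sum_nonneg)
  have S: "(\<Sum>x\<in>#{# b k. k \<in># mset_set I #}. h x) = (\<Sum>k\<in>I. h (b k))" for h :: "real \<Rightarrow> real"
    by (simp add: multiset.map_comp comp_def sum_unfold_sum_mset)
  have vb: "v \<in> FP \<and> \<bar>v - (\<Sum>k\<in>I. b k)\<bar> \<le> ((1 + u) ^ (N - 1) - 1) * (\<Sum>k\<in>I. \<bar>b k\<bar>)"
    using fl_sum_error[OF fp sum] b(1) I S[of abs] S[of "\<lambda>x. x"] by (auto simp: N_def)
  then show "v \<in> FP" ..
  note v = conjunct2[OF vb]
  have 1: "(\<Sum>k\<in>I. \<bar>b k\<bar>) \<le> 2 * T"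
  proof -
    have "\<bar>b k\<bar> \<le> 2 * \<bar>a k\<bar>" if "k \<in> I" for k
      using b(2)[OF that] mult_right_mono[OF u, of "\<bar>a k\<bar>"] by simp
    then show ?thesis unfolding T_def sum_distrib_left by (rule sum_mono)
  qed
  have 2: "(1 + u) ^ (N - 1) - 1 \<le> 2 ^ N * u"
  proof -
    have "(1 + u) ^ (N - 1) - 1 \<le> 2 ^ (N - 1) * u" by (rule power_one_plus_le[OF u0 u])
    also have "\<dots> \<le> 2 ^ N * u" using u0 by (intro mult_right_mono power_increasing) auto
    finally show ?thesis .
  qed
  \<comment> \<open>The additions contribute \<open>2 * 2 ^ N\<close> and the rounded terms at most
    \<open>2 ^ N\<close>; together they stay below the factor \<open>2 ^ (N + 2)\<close>.\<close>
  have "\<bar>v - (\<Sum>k\<in>I. b k)\<bar> \<le> (2 ^ N * u) * (2 * T)"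
    by (rule order_trans[OF v]) (use 1 2 u0 in \<open>intro mult_mono, auto simp: sum_nonneg\<close>)
  moreover have "\<bar>(\<Sum>k\<in>I. b k) - (\<Sum>k\<in>I. a k)\<bar> \<le> u * T"
    unfolding sum_subtractf[symmetric] T_def sum_distrib_left
    by (rule order_trans[OF sum_abs sum_mono]) (use b in auto)
  moreover have "u * T \<le> 2 ^ N * u * T"
    using u0 T by (simp add: mult_le_cancel_right1 mult_right_mono)
  moreover have "0 \<le> 2 ^ N * u * T" using u0 T by simp
  ultimately show "\<bar>v - (\<Sum>k\<in>I. a k)\<bar> \<le> 2 ^ (card I + 2) * u * (\<Sum>k\<in>I. \<bar>a k\<bar>)"
    unfolding T_def[symmetric] N_def[symmetric] by (simp add: algebra_simps)
qed

lemma computed_ds_error: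
  fixes A :: "real ^ 'm ^ 'n"
  assumes fp: "fp_arithmetic u FP fl" and u: "u \<le> 1"
    and A: "\<forall>j. fp_vec FP (A $ j)" and c: "fp_vec FP c" and s: "fp_vec FP s" and dz: "fp_vec FP dz"
    and ds: "computed_ds fl s A c dz ds"
  shows "\<bar>ds $ i - (- (c $ i) - s $ i - (transpose A *v dz) $ i)\<bar> \<le>
    2 ^ (CARD('n) + 4) * u * (\<bar>c $ i\<bar> + \<bar>s $ i\<bar> + (\<Sum>j\<in>UNIV. \<bar>A $ j $ i * dz $ j\<bar>))"
proof -
  \<comment> \<open>An index set of CARD('n) + 2 elements for the terms: \<open>None\<close> for the
    constraint value, \<open>Some None\<close> for the slack, and \<open>Some (Some j)\<close> for
    the j-th product.\<close>
  define I where "I = insert (Some None) (insert None ((\<lambda>j. Some (Some j)) ` (UNIV :: 'n set)))"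
  define b where "b k = (case k of None \<Rightarrow> - (c $ i) | Some None \<Rightarrow> - (s $ i)
    | Some (Some j) \<Rightarrow> - fl FMul (A $ j $ i) (dz $ j))" for k
  define a where "a k = (case k of None \<Rightarrow> - (c $ i) | Some None \<Rightarrow> - (s $ i)
    | Some (Some j) \<Rightarrow> - (A $ j $ i * dz $ j))" for k
  have I: "finite I" "card I = CARD('n) + 2"
    unfolding I_def by (auto simp: card_insert_if card_image inj_on_def)
  have inj: "inj (\<lambda>j :: 'n. Some (Some j))" by (simp add: inj_on_def)
  have "mset_set I = {# Some None, None #} + image_mset (\<lambda>j. Some (Some j)) (mset_set (UNIV :: 'n set))"
    unfolding I_def using inj by (simp add: image_mset_mset_set image_iff)
  then have M: "{# b k. k \<in># mset_set I #} = {# - (c $ i), - (s $ i) #}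
        + {# - fl FMul (A $ j $ i) (dz $ j). j \<in># mset_set UNIV #}"
    by (simp add: b_def multiset.map_comp comp_def)
  have S: "(\<Sum>k\<in>I. h k) = h (Some None) + h None + (\<Sum>j\<in>UNIV. h (Some (Some j)))" for h :: "_ \<Rightarrow> real"
    unfolding I_def using inj by (simp add: image_iff sum.reindex)
  have u0: "0 \<le> u" using fp by (simp add: fp_arithmetic_def)
  have "\<bar>ds $ i - (\<Sum>k\<in>I. a k)\<bar> \<le> 2 ^ (card I + 2) * u * (\<Sum>k\<in>I. \<bar>a k\<bar>)"
  proof (rule fl_sum_rounded_terms_error(2)[OF fp u I(1), of b])
    show "fl_sum fl {# b k. k \<in># mset_set I #} (ds $ i)"
      using ds unfolding M computed_ds_def by blast
    fix k assume "k \<in> I"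
    have mul: "fl FMul (A $ j $ i) (dz $ j) \<in> FP"
      "\<bar>fl FMul (A $ j $ i) (dz $ j) - A $ j $ i * dz $ j\<bar> \<le> u * \<bar>A $ j $ i * dz $ j\<bar>" for j
      using fp_arithmetic_op[OF fp, of "A $ j $ i" "dz $ j" FMul] A dz by (auto simp: fp_vec_def)
    show "b k \<in> FP"
      using c s mul fp_arithmetic_uminus[OF fp] by (auto simp: b_def fp_vec_def split: option.split)
    show "\<bar>b k - a k\<bar> \<le> u * \<bar>a k\<bar>"
      using mul(2) u0 by (auto simp: b_def a_def abs_minus_commute split: option.split)
  qed
  moreover define N where "N = CARD('n) + 4"
  moreover have N: "card I + 2 = N" by (simp add: I(2) N_def)
  ultimately show ?thesis
    unfolding S N unfolding N_def[symmetric]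
    by (simp add: a_def transpose_def matrix_vector_mult_def sum_negf algebra_simps)
qed

text \<open>Compared with the sum alone, the final product with \<open>dinv\<close> costs two more
  powers of 2. Keeping the absolute values of the terms, each multiplied by \<open>dinv\<close>, is
  essential: for active constraints every term is O(\<mu>) and compensates the size 1/\<mu> of
  \<open>dinv\<close>.\<close>

lemma computed_dlam_error:
  fixes A :: "real ^ 'm ^ 'n"
  assumes fp: "fp_arithmetic u FP fl" and u: "u \<le> 1"
    and A: "\<forall>j. fp_vec FP (A $ j)" and c: "fp_vec FP c" and t: "fp_vec FP t" and lam: "fp_vec FP lam"
    and dz: "fp_vec FP dz" and dinv: "fp_vec FP dinv" and lam0: "lam $ i \<noteq> 0"
    and dlam: "computed_dlam fl lam t A c dinv dz dlam"
  shows "\<bar>dlam $ i - dinv $ i * (c $ i - t $ i / lam $ i + (transpose A *v dz) $ i)\<bar> \<le>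
    2 ^ (CARD('n) + 6) * u * (\<bar>dinv $ i\<bar> * (\<bar>c $ i\<bar> + \<bar>t $ i / lam $ i\<bar> + (\<Sum>j\<in>UNIV. \<bar>A $ j $ i * dz $ j\<bar>)))"
proof -
  define I where "I = insert (Some None) (insert None ((\<lambda>j. Some (Some j)) ` (UNIV :: 'n set)))"
  define b where "b k = (case k of None \<Rightarrow> - fl FDiv (t $ i) (lam $ i) | Some None \<Rightarrow> c $ i
    | Some (Some j) \<Rightarrow> fl FMul (A $ j $ i) (dz $ j))" for k
  define a where "a k = (case k of None \<Rightarrow> - (t $ i / lam $ i) | Some None \<Rightarrow> c $ i
    | Some (Some j) \<Rightarrow> A $ j $ i * dz $ j)" for k
  have I: "finite I" "card I = CARD('n) + 2"
    unfolding I_def by (auto simp: card_insert_if card_image inj_on_def)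
  have inj: "inj (\<lambda>j :: 'n. Some (Some j))" by (simp add: inj_on_def)
  have "mset_set I = {# Some None, None #} + image_mset (\<lambda>j. Some (Some j)) (mset_set (UNIV :: 'n set))"
    unfolding I_def using inj by (simp add: image_mset_mset_set image_iff)
  then have M: "{# b k. k \<in># mset_set I #} = {# c $ i, - fl FDiv (t $ i) (lam $ i) #}
          + {# fl FMul (A $ j $ i) (dz $ j). j \<in># mset_set UNIV #}"
    by (simp add: b_def multiset.map_comp comp_def)
  have S: "(\<Sum>k\<in>I. h k) = h (Some None) + h None + (\<Sum>j\<in>UNIV. h (Some (Some j)))" for h :: "_ \<Rightarrow> real"
    unfolding I_def using inj by (simp add: image_iff sum.reindex)
  have u0: "0 \<le> u" using fp by (simp add: fp_arithmetic_def)
  define T where "T = \<bar>c $ i\<bar> + \<bar>t $ i / lam $ i\<bar> + (\<Sum>j\<in>UNIV. \<bar>A $ j $ i * dz $ j\<bar>)"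
  define X where "X = c $ i - t $ i / lam $ i + (transpose A *v dz) $ i"
  obtain v where sum: "fl_sum fl {# b k. k \<in># mset_set I #} v" and v: "dlam $ i = fl FMul (dinv $ i) v"
    using dlam unfolding M computed_dlam_def by blast
  have bFP: "b k \<in> FP" and ba: "\<bar>b k - a k\<bar> \<le> u * \<bar>a k\<bar>" for k
  proof -
    have mul: "fl FMul (A $ j $ i) (dz $ j) \<in> FP"
      "\<bar>fl FMul (A $ j $ i) (dz $ j) - A $ j $ i * dz $ j\<bar> \<le> u * \<bar>A $ j $ i * dz $ j\<bar>" for j
      using fp_arithmetic_op[OF fp, of "A $ j $ i" "dz $ j" FMul] A dz by (auto simp: fp_vec_def)
    have dv: "fl FDiv (t $ i) (lam $ i) \<in> FP"
      "\<bar>fl FDiv (t $ i) (lam $ i) - t $ i / lam $ i\<bar> \<le> u * \<bar>t $ i / lam $ i\<bar>"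
      using fp_arithmetic_op[OF fp, of "t $ i" "lam $ i" FDiv] t lam lam0 by (auto simp: fp_vec_def)
    show "b k \<in> FP"
      using c mul dv fp_arithmetic_uminus[OF fp] by (auto simp: b_def fp_vec_def split: option.split)
    show "\<bar>b k - a k\<bar> \<le> u * \<bar>a k\<bar>"
      using mul(2) dv(2) u0 by (auto simp: b_def a_def abs_minus_commute split: option.split)
  qed
  have vFP: "v \<in> FP" and v1: "\<bar>v - (\<Sum>k\<in>I. a k)\<bar> \<le> 2 ^ (card I + 2) * u * (\<Sum>k\<in>I. \<bar>a k\<bar>)"
    using fl_sum_rounded_terms_error[OF fp u I(1) sum, of a] bFP ba by auto
  have Xa: "(\<Sum>k\<in>I. a k) = X" and Ta: "(\<Sum>k\<in>I. \<bar>a k\<bar>) = T"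
    unfolding S X_def T_def by (simp_all add: a_def transpose_def matrix_vector_mult_def)
  have T0: "0 \<le> T" by (simp add: T_def sum_nonneg)
  have XT: "\<bar>X\<bar> \<le> T" unfolding Xa[symmetric] Ta[symmetric] by (rule sum_abs)
  define N where "N = CARD('n) + 4"
  have N: "card I + 2 = N" by (simp add: I(2) N_def)
  have v1': "\<bar>v - X\<bar> \<le> 2 ^ N * u * T" using v1 unfolding Xa Ta N .
  have v2: "\<bar>dlam $ i - dinv $ i * v\<bar> \<le> u * (\<bar>dinv $ i\<bar> * \<bar>v\<bar>)"
    using fp_arithmetic_op(2)[OF fp, of "dinv $ i" v FMul] dinv vFP by (simp add: fp_vec_def v abs_mult)
  have v3: "\<bar>v\<bar> \<le> 2 ^ Suc N * T"
  proof -
    have "2 ^ N * u * T \<le> 2 ^ N * 1 * T" using u T0 by (intro mult_right_mono mult_left_mono) auto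
    then have "2 ^ N * u * T \<le> 2 ^ N * T" by (simp only: mult_1_right)
    moreover have "T \<le> 2 ^ N * T" using T0 by (simp add: mult_le_cancel_right1)
    moreover have "2 ^ Suc N * T = 2 ^ N * T + 2 ^ N * T" by simp
    ultimately show ?thesis using v1' XT by linarith
  qed
  \<comment> \<open>The two errors are that of the last multiplication and that of the bracket
    scaled by \<open>dinv\<close>; \<open>2 ^ Suc N + 2 ^ N\<close> is at most
    \<open>2 ^ (N + 2)\<close>.\<close>
  have "\<bar>dlam $ i - dinv $ i * X\<bar> \<le> \<bar>dlam $ i - dinv $ i * v\<bar> + \<bar>dinv $ i * (v - X)\<bar>"
    by (simp add: algebra_simps)
  also have "\<dots> \<le> u * (\<bar>dinv $ i\<bar> * (2 ^ Suc N * T)) + \<bar>dinv $ i\<bar> * (2 ^ N * u * T)"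
  proof (rule add_mono)
    show "\<bar>dlam $ i - dinv $ i * v\<bar> \<le> u * (\<bar>dinv $ i\<bar> * (2 ^ Suc N * T))"
      by (rule order_trans[OF v2]) (intro mult_left_mono v3 u0 abs_ge_zero)
    show "\<bar>dinv $ i * (v - X)\<bar> \<le> \<bar>dinv $ i\<bar> * (2 ^ N * u * T)"
      unfolding abs_mult by (intro mult_left_mono v1' abs_ge_zero)
  qed
  also have "\<dots> \<le> 2 ^ (N + 2) * u * (\<bar>dinv $ i\<bar> * T)"
    using u0 T0 by (simp add: algebra_simps)
  also have "N + 2 = CARD('n) + 6" by (simp add: N_def)
  finally show ?thesis unfolding X_def T_def .
qed

section \<open>Derivatives of the Lagrangian\<close>

lemma has_derivative_grad:
  fixes f :: "real ^ 'n \<Rightarrow> real"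
  assumes "f differentiable (at x)"
  shows "(f has_derivative (\<lambda>h. grad f x \<bullet> h)) (at x)"
proof -
  define f' where "f' = frechet_derivative f (at x)"
  have der: "(f has_derivative f') (at x)"
    using assms unfolding f'_def frechet_derivative_works .
  then have lin: "linear f'" by (rule has_derivative_linear)
  have "f' h = grad f x \<bullet> h" for h
  proof -
    have "f' h = f' (\<Sum>i\<in>UNIV. (h $ i) *\<^sub>R axis i 1)"
      by (simp add: basis_expansion flip: scalar_mult_eq_scaleR)
    also have "\<dots> = (\<Sum>i\<in>UNIV. h $ i * f' (axis i 1))"
      by (simp add: linear_sum[OF lin] linear_cmul[OF lin])
    also have "\<dots> = grad f x \<bullet> h"
      by (simp add: grad_def f'_def inner_vec_def mult.commute)
    finally show ?thesis .
  qed
  then have "f' = (\<lambda>h. grad f x \<bullet> h)" by auto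
  then show ?thesis using der by simp
qed

lemma grad_eqI:
  assumes "(f has_derivative (\<lambda>h. v \<bullet> h)) (at x)"
  shows "grad f x = v"
  unfolding grad_def frechet_derivative_at[OF assms, symmetric] by (simp add: vec_eq_iff inner_axis)

lemma has_derivative_hess:
  assumes "grad f differentiable (at x)"
  shows "(grad f has_derivative (\<lambda>h. hess f x *v h)) (at x)"
  using assms unfolding hess_def jacobian_works .

lemma hess_eqI:
  assumes "(grad f has_derivative (\<lambda>h. A *v h)) (at x)"
  shows "hess f x = A"
  unfolding hess_def jacobian_def frechet_derivative_at[OF assms, symmetric] by simp

lemma nabla_mult_eq_sum:
  "nabla g z *v lam = (\<Sum>i\<in>UNIV. lam $ i *\<^sub>R grad (\<lambda>y. g y $ i) z)"
  by (simp add: vec_eq_iff matrix_vector_mult_def nabla_def mult.commute)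

lemma column_nabla: "column i (nabla g z) = grad (\<lambda>y. g y $ i) z"
  by (simp add: vec_eq_iff column_def nabla_def)

lemma Lagr_z_eq:
  assumes "\<phi> differentiable (at z)" "\<And>i. (\<lambda>y. g y $ i) differentiable (at z)"
  shows "Lagr_z \<phi> g z lam = grad \<phi> z + nabla g z *v lam"
  unfolding Lagr_z_def
proof (rule grad_eqI)
  have "((\<lambda>y. \<phi> y + (\<Sum>i\<in>UNIV. lam $ i * (g y $ i))) has_derivative
      (\<lambda>h. grad \<phi> z \<bullet> h + (\<Sum>i\<in>UNIV. lam $ i * (grad (\<lambda>y. g y $ i) z \<bullet> h)))) (at z)"
    by (intro has_derivative_add has_derivative_sum has_derivative_mult_right has_derivative_grad assms)
  then show "((\<lambda>y. Lagr \<phi> g y lam) has_derivative (\<lambda>h. (grad \<phi> z + nabla g z *v lam) \<bullet> h)) (at z)"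
    by (simp add: Lagr_def inner_vec_def[of lam] nabla_mult_eq_sum inner_add_left inner_sum_left)
qed

lemma Lagr_zz_eq:
  assumes "\<And>z. \<phi> differentiable (at z)" "\<And>i z. (\<lambda>y. g y $ i) differentiable (at z)"
    and "grad \<phi> differentiable (at z)" "\<And>i. grad (\<lambda>y. g y $ i) differentiable (at z)"
  shows "Lagr_zz \<phi> g z lam = hess \<phi> z + (\<Sum>i\<in>UNIV. lam $ i *\<^sub>R hess (\<lambda>y. g y $ i) z)"
  unfolding Lagr_zz_def
proof (rule hess_eqI)
  have *: "(\<Sum>i\<in>I. c i *\<^sub>R B i) *v h = (\<Sum>i\<in>I. c i *\<^sub>R (B i *v h))"
    for I :: "'b set" and c and B :: "'b \<Rightarrow> real ^ 'a ^ 'a" and h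
    by (induction I rule: infinite_finite_induct)
      (auto simp: matrix_vector_mult_add_rdistrib scaleR_matrix_vector_assoc)
  have "grad (\<lambda>y. Lagr \<phi> g y lam) = (\<lambda>y. grad \<phi> y + (\<Sum>i\<in>UNIV. lam $ i *\<^sub>R grad (\<lambda>y. g y $ i) y))"
    using Lagr_z_eq[OF assms(1,2)] unfolding Lagr_z_def nabla_mult_eq_sum by auto
  moreover have "((\<lambda>y. grad \<phi> y + (\<Sum>i\<in>UNIV. lam $ i *\<^sub>R grad (\<lambda>y. g y $ i) y)) has_derivative
      (\<lambda>h. hess \<phi> z *v h + (\<Sum>i\<in>UNIV. lam $ i *\<^sub>R (hess (\<lambda>y. g y $ i) z *v h)))) (at z)"
    by (intro has_derivative_add has_derivative_sum has_derivative_scaleR_right has_derivative_hess assms)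
  ultimately show "(grad (\<lambda>y. Lagr \<phi> g y lam) has_derivative
      (\<lambda>h. (hess \<phi> z + (\<Sum>i\<in>UNIV. lam $ i *\<^sub>R hess (\<lambda>y. g y $ i) z)) *v h)) (at z)"
    by (simp add: matrix_vector_mult_add_rdistrib *)
qed

lemma twice_lipschitz_differentiableD:
  assumes "twice_lipschitz_differentiable f"
  shows "f differentiable (at x)" "grad f differentiable (at x)" "isCont (hess f) x"
proof -
  show "f differentiable (at x)" "grad f differentiable (at x)"
    using assms by (auto simp: twice_lipschitz_differentiable_def)
  obtain r L where "r > 0" and L: "L-lipschitz_on (cball x r) (hess f)"
    using assms by (meson twice_lipschitz_differentiable_def)
  then show "isCont (hess f) x"
    using continuous_on_interior[OF lipschitz_on_continuous_on[OF L]] by (simp add: interior_cball)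
qed

lemma grad_taylor:
  fixes f :: "real ^ 'n \<Rightarrow> real"
  assumes f: "twice_lipschitz_differentiable f" and e: "e > 0"
  shows "\<exists>d>0. \<forall>y. norm (y - x) < d \<longrightarrow>
    norm (grad f y - grad f x - hess f x *v (y - x)) \<le> e * norm (y - x)"
  using has_derivative_hess[OF twice_lipschitz_differentiableD(2)[OF f], of x] e
  unfolding has_derivative_at_alt by blast

text \<open>The mean value theorem along the segment, applied to the second-order remainder
  \<open>h\<close>: its derivative is the remainder of the gradient paired with \<open>w\<close>, so
  the tolerance \<open>e\<close> carries over from \<open>grad_taylor\<close>.\<close>

lemma function_taylor:
  fixes f :: "real ^ 'n \<Rightarrow> real"
  assumes f: "twice_lipschitz_differentiable f" and e: "e > 0"
  shows "\<exists>d>0. \<forall>y. norm (y - x) < d \<longrightarrow>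
    \<bar>f y - f x - grad f x \<bullet> (y - x) - 1/2 * ((y - x) \<bullet> (hess f x *v (y - x)))\<bar> \<le> e * (norm (y - x))\<^sup>2"
proof -
  obtain d where d: "d > 0" and gd: "\<And>y. norm (y - x) < d \<Longrightarrow>
    norm (grad f y - grad f x - hess f x *v (y - x)) \<le> e * norm (y - x)"
    using grad_taylor[OF f e] by blast
  have "\<bar>f y - f x - grad f x \<bullet> (y - x) - 1/2 * ((y - x) \<bullet> (hess f x *v (y - x)))\<bar> \<le> e * (norm (y - x))\<^sup>2"
    if y: "norm (y - x) < d" for y
  proof -
    define w where "w = y - x"
    define q where "q = w \<bullet> (hess f x *v w)"
    define h where "h \<tau> = f (x + \<tau> *\<^sub>R w) - \<tau> * (grad f x \<bullet> w) - \<tau>\<^sup>2 / 2 * q" for \<tau>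
    define h' where "h' \<tau> = (grad f (x + \<tau> *\<^sub>R w) - grad f x) \<bullet> w - \<tau> * q" for \<tau>
    have h: "(h has_real_derivative h' \<tau>) (at \<tau>)" for \<tau>
    proof -
      have "((\<lambda>\<tau>. f (x + \<tau> *\<^sub>R w)) has_derivative (\<lambda>k. grad f (x + \<tau> *\<^sub>R w) \<bullet> (k *\<^sub>R w))) (at \<tau>)"
        by (rule has_derivative_compose[where f = "\<lambda>\<tau>. x + \<tau> *\<^sub>R w", OF _ has_derivative_grad[OF twice_lipschitz_differentiableD(1)[OF f]]])
          (auto intro!: derivative_eq_intros)
      then have "((\<lambda>\<tau>. f (x + \<tau> *\<^sub>R w)) has_real_derivative grad f (x + \<tau> *\<^sub>R w) \<bullet> w) (at \<tau>)"
        by (simp add: has_field_derivative_def mult.commute[of _ "_ \<bullet> _"] mult_commute_abs)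
      then show ?thesis
        unfolding h_def h'_def by (auto intro!: derivative_eq_intros simp: inner_diff_left)
    qed
    obtain \<tau> where \<tau>: "0 < \<tau>" "\<tau> < 1" and mvt: "h 1 - h 0 = (1 - 0) * h' \<tau>"
      using MVT2[of 0 1 h h'] h by auto
    have "norm (x + \<tau> *\<^sub>R w - x) \<le> norm w"
      using \<tau> by (simp add: mult_left_le_one_le)
    then have nd: "norm (x + \<tau> *\<^sub>R w - x) < d" using y by (simp add: w_def)
    have "h' \<tau> = (grad f (x + \<tau> *\<^sub>R w) - grad f x - hess f x *v (x + \<tau> *\<^sub>R w - x)) \<bullet> w"
      by (simp add: h'_def q_def inner_diff_left matrix_vector_mult_scaleR inner_commute[of w])
    also have "\<bar>\<dots>\<bar> \<le> norm (grad f (x + \<tau> *\<^sub>R w) - grad f x - hess f x *v (x + \<tau> *\<^sub>R w - x)) * norm w"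
      by (rule Cauchy_Schwarz_ineq2)
    also have "\<dots> \<le> e * norm (x + \<tau> *\<^sub>R w - x) * norm w"
      by (intro mult_right_mono gd nd) auto
    also have "\<dots> \<le> e * norm w * norm w"
      using \<tau> e by (intro mult_right_mono mult_left_mono) (auto simp: mult_left_le_one_le)
    finally have "\<bar>h 1 - h 0\<bar> \<le> e * (norm w)\<^sup>2"
      using mvt by (simp add: power2_eq_square)
    then show ?thesis
      by (simp add: h_def w_def q_def)
  qed
  then show ?thesis using d by blast
qed

lemma norm_eventually_less:
  assumes "(z \<longlongrightarrow> zs) L" "d > 0"
  shows "\<forall>\<^sub>F x in L. norm (z x - zs) < (d :: real)"
  using tendstoD[OF assms] by (simp add: dist_norm)

lemma grad_taylor_smallo:
  fixes f :: "real ^ 'n \<Rightarrow> real"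
  assumes f: "twice_lipschitz_differentiable f" and z: "(z \<longlongrightarrow> zs) L"
  shows "(\<lambda>x. norm (grad f (z x) - grad f zs - hess f zs *v (z x - zs))) \<in> o[L](\<lambda>x. norm (z x - zs))"
proof (rule landau_o.smallI)
  fix e :: real
  assume "e > 0"
  then obtain d where d: "d > 0" "\<And>y. norm (y - zs) < d \<Longrightarrow>
      norm (grad f y - grad f zs - hess f zs *v (y - zs)) \<le> e * norm (y - zs)"
    using grad_taylor[OF f] by blast
  then show "\<forall>\<^sub>F x in L. norm (norm (grad f (z x) - grad f zs - hess f zs *v (z x - zs)))
      \<le> e * norm (norm (z x - zs))"
    using norm_eventually_less[OF z d(1)] d(2) by (auto elim!: eventually_mono)
qed

lemma function_taylor_smallo:
  fixes f :: "real ^ 'n \<Rightarrow> real"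
  assumes f: "twice_lipschitz_differentiable f" and z: "(z \<longlongrightarrow> zs) L"
  shows "(\<lambda>x. f (z x) - f zs - grad f zs \<bullet> (z x - zs) - 1/2 * ((z x - zs) \<bullet> (hess f zs *v (z x - zs))))
    \<in> o[L](\<lambda>x. (norm (z x - zs))\<^sup>2)"
proof (rule landau_o.smallI)
  fix e :: real
  assume "e > 0"
  then obtain d where d: "d > 0" "\<And>y. norm (y - zs) < d \<Longrightarrow>
      \<bar>f y - f zs - grad f zs \<bullet> (y - zs) - 1/2 * ((y - zs) \<bullet> (hess f zs *v (y - zs)))\<bar> \<le> e * (norm (y - zs))\<^sup>2"
    using function_taylor[OF f] by blast
  then show "\<forall>\<^sub>F x in L. norm (f (z x) - f zs - grad f zs \<bullet> (z x - zs) - 1/2 * ((z x - zs) \<bullet> (hess f zs *v (z x - zs))))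
      \<le> e * norm ((norm (z x - zs))\<^sup>2)"
    using norm_eventually_less[OF z d(1)] d(2) by (auto elim!: eventually_mono)
qed

section \<open>Landau symbols for vectors\<close>

lemma finite_uniform_lower_bound:
  fixes f :: "'a \<Rightarrow> real"
  assumes "finite A" "\<And>i. i \<in> A \<Longrightarrow> f i > 0"
  obtains c where "c > 0" "\<And>i. i \<in> A \<Longrightarrow> c \<le> f i"
proof (cases "A = {}")
  case True
  then show ?thesis using that[of 1] by simp
next
  case False
  then show ?thesis using that[of "Min (f ` A)"] assms by simp
qed

lemma bigo_norm_dominated:
  fixes g :: "'x \<Rightarrow> real"
  assumes "\<forall>\<^sub>F x in L. norm (f x) \<le> g x" "g \<in> O[L](h)"
  shows "(\<lambda>x. norm (f x)) \<in> O[L](h)"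
proof (rule landau_o.big_trans[OF _ assms(2)])
  show "(\<lambda>x. norm (f x)) \<in> O[L](g)"
    by (rule landau_o.bigI[of 1]) (use assms(1) in \<open>auto elim!: eventually_mono\<close>)
qed

lemma bigo_norm_add:
  assumes "(\<lambda>x. norm (f x)) \<in> O[L](h)" "(\<lambda>x. norm (g x)) \<in> O[L](h)"
  shows "(\<lambda>x. norm (f x + g x)) \<in> O[L](h :: 'x \<Rightarrow> real)"
  by (rule bigo_norm_dominated[OF _ sum_in_bigo(1)[OF assms]]) (auto simp: norm_triangle_ineq)

lemma bigo_norm_diff:
  assumes "(\<lambda>x. norm (f x)) \<in> O[L](h)" "(\<lambda>x. norm (g x)) \<in> O[L](h)"
  shows "(\<lambda>x. norm (f x - g x)) \<in> O[L](h :: 'x \<Rightarrow> real)"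
  by (rule bigo_norm_dominated[OF _ sum_in_bigo(1)[OF assms]]) (auto simp: norm_triangle_ineq4)

lemma bigo_norm_sum:
  assumes "\<And>i. i \<in> I \<Longrightarrow> (\<lambda>x. norm (f i x)) \<in> O[L](h :: 'x \<Rightarrow> real)"
  shows "(\<lambda>x. norm (\<Sum>i\<in>I. f i x)) \<in> O[L](h)"
  by (rule bigo_norm_dominated[OF _ big_sum_in_bigo[OF assms]]) (auto simp: norm_sum)

lemma bigo_norm_scaleR:
  assumes "a \<in> O[L](h1)" "(\<lambda>x. norm (v x)) \<in> O[L](h2)"
  shows "(\<lambda>x. norm (a x *\<^sub>R v x)) \<in> O[L](\<lambda>x. h1 x * h2 x :: real)"
  using landau_o.big.mult[of "\<lambda>x. norm (a x)", OF _ assms(2)] assms(1) by simp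

lemma bigo_norm_matrix_vector_mult:
  fixes A :: "'x \<Rightarrow> real ^ 'n ^ 'm"
  assumes "(\<lambda>x. norm (A x)) \<in> O[L](h1)" "(\<lambda>x. norm (v x)) \<in> O[L](h2)"
  shows "(\<lambda>x. norm (A x *v v x)) \<in> O[L](\<lambda>x. h1 x * h2 x :: real)"
  by (rule bigo_norm_dominated[OF _ landau_o.big.mult[OF assms]])
    (auto simp: norm_matrix_vector_mult_le)

lemma bigo_norm_inner:
  assumes "(\<lambda>x. norm (w x)) \<in> O[L](h1)" "(\<lambda>x. norm (v x)) \<in> O[L](h2)"
  shows "(\<lambda>x. w x \<bullet> v x) \<in> O[L](\<lambda>x. h1 x * h2 x :: real)"
  using bigo_norm_dominated[OF _ landau_o.big.mult[OF assms], of "\<lambda>x. w x \<bullet> v x"]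
  by (auto simp: Cauchy_Schwarz_ineq2)

lemma bigo_norm_nth:
  fixes v :: "'x \<Rightarrow> 'a :: real_normed_vector ^ 'n" and h :: "'x \<Rightarrow> real"
  assumes "(\<lambda>x. norm (v x)) \<in> O[L](h)"
  shows "(\<lambda>x. norm (v x $ i)) \<in> O[L](h)"
  by (rule bigo_norm_dominated[OF _ assms]) (auto simp: Finite_Cartesian_Product.norm_nth_le)

lemma bigo_vec_nth:
  fixes v :: "'x \<Rightarrow> real ^ 'n" and h :: "'x \<Rightarrow> real"
  assumes "(\<lambda>x. norm (v x)) \<in> O[L](h)"
  shows "(\<lambda>x. v x $ i) \<in> O[L](h)"
  using bigo_norm_nth[OF assms, of i] by simp

lemma bigo_norm_vecI:
  fixes v :: "'x \<Rightarrow> 'a :: real_normed_vector ^ 'n" and h :: "'x \<Rightarrow> real"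
  assumes "\<And>i. (\<lambda>x. norm (v x $ i)) \<in> O[L](h)"
  shows "(\<lambda>x. norm (v x)) \<in> O[L](h)"
proof (rule bigo_norm_dominated)
  show "(\<lambda>x. \<Sum>i\<in>UNIV. norm (v x $ i)) \<in> O[L](h)"
    by (rule big_sum_in_bigo) (rule assms)
qed (auto simp: norm_vec_def L2_set_le_sum)

lemma bigo_norm_tendsto:
  assumes "(f \<longlongrightarrow> l) L"
  shows "(\<lambda>x. norm (f x)) \<in> O[L](\<lambda>_. 1 :: real)"
proof (rule landau_o.bigI[of "norm l + 1"])
  show "\<forall>\<^sub>F x in L. norm (norm (f x)) \<le> (norm l + 1) * norm (1 :: real)"
    using order_tendstoD(2)[OF tendsto_norm[OF assms], of "norm l + 1"]
    by (auto elim!: eventually_mono)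
qed (simp add: add_nonneg_pos)

lemma bigo_mult_eventually_eq:
  assumes "f \<in> O[L](a)" "g \<in> O[L](b)" "\<forall>\<^sub>F x in L. a x * b x = (h x :: real)"
  shows "(\<lambda>x. f x * g x) \<in> O[L](h)"
  using landau_o.big.mult[OF assms(1,2)] landau_o.big.cong[OF assms(3)] by simp

lemma bigo_const_mult:
  fixes f h :: "'x \<Rightarrow> real"
  assumes "f \<in> O[L](h)"
  shows "(\<lambda>x. c * f x) \<in> O[L](h)"
  using landau_o.big.mult[OF _ assms, of "\<lambda>_. c" "\<lambda>_. 1"] by simp

lemma bigo_L2_set:
  fixes h :: "'x \<Rightarrow> real"
  assumes "\<And>i. i \<in> I \<Longrightarrow> f i \<in> O[L](h)"
  shows "(\<lambda>x. L2_set (\<lambda>i. f i x) I) \<in> O[L](h)"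
proof -
  have "(\<lambda>x. \<Sum>i\<in>I. norm (f i x)) \<in> O[L](h)"
    by (rule big_sum_in_bigo) (use assms in simp)
  from bigo_norm_dominated[OF _ this, of "\<lambda>x. L2_set (\<lambda>i. f i x) I"] show ?thesis
    by (simp add: L2_set_nonneg L2_set_le_sum_abs)
qed

text \<open>For estimates in which \<open>f\<close> reappears on the right: eventually
  \<open>q\<close> is at most \<open>c / 2 * (f + h)\<close>, so half of \<open>c * f\<close>
  survives on the left. This is the form taken by the bounds on the energy, on \<open>w\<close> and
  on the solution of the linear system.\<close>

lemma bigo_absorb:
  fixes f h p q :: "'x \<Rightarrow> real"
  assumes c: "c > 0" and le: "\<forall>\<^sub>F x in L. c * f x \<le> p x + q x"
    and f: "\<forall>\<^sub>F x in L. 0 \<le> f x" and h: "\<forall>\<^sub>F x in L. 0 \<le> h x"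
    and p: "p \<in> O[L](h)" and q: "q \<in> o[L](\<lambda>x. f x + h x)"
  shows "f \<in> O[L](h)"
proof -
  obtain K where K: "K > 0" "\<forall>\<^sub>F x in L. norm (p x) \<le> K * norm (h x)"
    using landau_o.bigE[OF p] by blast
  have q': "\<forall>\<^sub>F x in L. norm (q x) \<le> c / 2 * norm (f x + h x)"
    using landau_o.smallD[OF q, of "c / 2"] c by simp
  show ?thesis
  proof (rule landau_o.bigI[of "2 / c * K + 1"])
    show "\<forall>\<^sub>F x in L. norm (f x) \<le> (2 / c * K + 1) * norm (h x)"
      using le f h K(2) q'
    proof eventually_elim
      case (elim x)
      then have "c * f x \<le> K * h x + c / 2 * (f x + h x)" by simp
      then show ?case using elim c by (simp add: field_simps)
    qed
  qed (use c K in \<open>simp add: add_pos_pos\<close>)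
qed

section \<open>Active constraint gradients and multipliers\<close>

text \<open>The inactive columns are set to zero instead of being removed, which keeps the type.\<close>

definition active_nabla :: "(real ^ 'n \<Rightarrow> real ^ 'm) \<Rightarrow> real ^ 'n \<Rightarrow> real ^ 'm ^ 'n" where
  "active_nabla g zs = (\<chi> j i. if i \<in> active g zs then nabla g zs $ j $ i else 0)"

lemma transpose_active_nabla_mult:
  "(transpose (active_nabla g zs) *v w) $ i = (if i \<in> active g zs then column i (nabla g zs) \<bullet> w else 0)"
  by (simp add: active_nabla_def transpose_def matrix_vector_mult_def inner_vec_def column_def
      del: transpose_matrix_vector)

lemma transpose_active_nabla_mult_svd:
  assumes svd: "active_svd g zs r P \<sigma> Q" and k: "k \<in> active g zs"
  shows "(transpose (active_nabla g zs) *v w) $ k = (\<Sum>j<r. \<sigma> j * Q j k * (P j \<bullet> w))"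
proof -
  have "(transpose (active_nabla g zs) *v w) $ k = (\<Sum>l\<in>UNIV. (\<Sum>j<r. P j $ l * \<sigma> j * Q j k) * w $ l)"
    using svd k by (simp add: active_nabla_def transpose_def matrix_vector_mult_def active_svd_def
        del: transpose_matrix_vector)
  also have "\<dots> = (\<Sum>j<r. \<Sum>l\<in>UNIV. P j $ l * \<sigma> j * Q j k * w $ l)"
    unfolding sum_distrib_right by (rule sum.swap)
  also have "\<dots> = (\<Sum>j<r. \<sigma> j * Q j k * (P j \<bullet> w))"
    by (simp add: inner_vec_def sum_distrib_left mult_ac)
  finally show ?thesis .
qed

text \<open>The coordinates of the active part of \<open>y\<close> along the columns of U can be
  read off from the image of \<open>y\<close>, up to division by the fixed singular values. A bound
  on the image is therefore a bound on these coordinates.\<close>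

lemma active_svd_right:
  assumes svd: "active_svd g zs r P \<sigma> Q" and j: "j < r"
  shows "(\<Sum>k\<in>active g zs. Q j k * y $ k) = (P j \<bullet> (active_nabla g zs *v y)) / \<sigma> j"
proof -
  have P: "P j \<bullet> P i = (if j = i then 1 else 0)" if "i < r" for i
    using svd j that by (auto simp: active_svd_def)
  have "P j \<bullet> (active_nabla g zs *v y) = (transpose (active_nabla g zs) *v P j) \<bullet> y"
    by (rule inner_matrix_vector_transpose)
  also have "\<dots> = (\<Sum>k\<in>active g zs. (transpose (active_nabla g zs) *v P j) $ k * y $ k)"
    unfolding inner_vec_def inner_real_def
    by (rule sum.mono_neutral_right) (auto simp: transpose_active_nabla_mult simp del: transpose_matrix_vector)
  also have "\<dots> = (\<Sum>k\<in>active g zs. (\<Sum>i<r. \<sigma> i * Q i k * (P i \<bullet> P j)) * y $ k)"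
    by (simp add: transpose_active_nabla_mult_svd[OF svd] del: transpose_matrix_vector)
  also have "\<dots> = (\<Sum>k\<in>active g zs. (\<sigma> j * Q j k) * y $ k)"
  proof (rule sum.cong[OF refl])
    fix k
    have "(\<Sum>i<r. \<sigma> i * Q i k * (P i \<bullet> P j)) = (\<Sum>i<r. if j = i then \<sigma> j * Q j k else 0)"
      by (rule sum.cong) (auto simp: inner_commute[of _ "P j"] P)
    then show "(\<Sum>i<r. \<sigma> i * Q i k * (P i \<bullet> P j)) * y $ k = \<sigma> j * Q j k * y $ k"
      using j by simp
  qed
  finally have "P j \<bullet> (active_nabla g zs *v y) = \<sigma> j * (\<Sum>k\<in>active g zs. Q j k * y $ k)"
    by (simp add: sum_distrib_left mult_ac)
  moreover have "\<sigma> j > 0" using svd j by (simp add: active_svd_def)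
  ultimately show ?thesis by simp
qed

text \<open>The dual formula: the coordinates of \<open>w\<close> along the columns of Uhat from its
  image under the transpose.\<close>

lemma active_svd_left:
  assumes svd: "active_svd g zs r P \<sigma> Q" and j: "j < r"
  shows "P j \<bullet> w = (\<Sum>k\<in>active g zs. Q j k * (transpose (active_nabla g zs) *v w) $ k) / \<sigma> j"
proof -
  have Q: "(\<Sum>k\<in>active g zs. Q j k * Q i k) = (if j = i then 1 else 0)" if "i < r" for i
    using svd j that by (auto simp: active_svd_def)
  have "(\<Sum>k\<in>active g zs. Q j k * (transpose (active_nabla g zs) *v w) $ k) =
      (\<Sum>k\<in>active g zs. \<Sum>i<r. (Q j k * Q i k) * (\<sigma> i * (P i \<bullet> w)))"
    by (simp add: transpose_active_nabla_mult_svd[OF svd] sum_distrib_left mult_ac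
        del: transpose_matrix_vector)
  also have "\<dots> = (\<Sum>i<r. \<Sum>k\<in>active g zs. (Q j k * Q i k) * (\<sigma> i * (P i \<bullet> w)))"
    by (rule sum.swap)
  also have "\<dots> = (\<Sum>i<r. if j = i then \<sigma> j * (P j \<bullet> w) else 0)"
    by (rule sum.cong) (auto simp: Q simp flip: sum_distrib_right)
  also have "\<dots> = \<sigma> j * (P j \<bullet> w)" using j by simp
  finally have "(\<Sum>k\<in>active g zs. Q j k * (transpose (active_nabla g zs) *v w) $ k) = \<sigma> j * (P j \<bullet> w)" .
  moreover have "\<sigma> j > 0" using svd j by (simp add: active_svd_def)
  ultimately show ?thesis by (simp del: transpose_matrix_vector)
qed

text \<open>Removing from \<open>w\<close> its orthogonal projection to the span of the columns of
  Uhat leaves a null vector, and the removed part is bounded through the pseudoinverse, of whose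
  norm \<kappa> is a crude bound.\<close>

lemma active_svd_projection:
  assumes svd: "active_svd g zs r P \<sigma> Q"
  obtains \<kappa> where "\<kappa> > 0" "\<And>w. \<exists>v. transpose (active_nabla g zs) *v v = 0 \<and>
    norm (w - v) \<le> \<kappa> * norm (transpose (active_nabla g zs) *v w)"
proof (rule that)
  \<comment> \<open>The summand 1 keeps \<kappa> positive when there are no singular values.\<close>
  define \<kappa> where "\<kappa> = (\<Sum>j<r. (\<Sum>k\<in>active g zs. \<bar>Q j k\<bar>) / \<sigma> j) + 1"
  have pos: "\<sigma> j > 0" if "j < r" for j using svd that by (simp add: active_svd_def)
  have \<kappa>0: "0 \<le> (\<Sum>j<r. (\<Sum>k\<in>active g zs. \<bar>Q j k\<bar>) / \<sigma> j)"
    by (intro sum_nonneg divide_nonneg_pos pos) auto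
  then show "\<kappa> > 0" by (simp add: \<kappa>_def)
  fix w
  define v where "v = w - (\<Sum>j<r. (P j \<bullet> w) *\<^sub>R P j)"
  have P: "P i \<bullet> P j = (if i = j then 1 else 0)" if "i < r" "j < r" for i j
    using svd that by (auto simp: active_svd_def)
  have "P i \<bullet> v = 0" if "i < r" for i
  proof -
    have "(\<Sum>j<r. (P j \<bullet> w) * (P i \<bullet> P j)) = (\<Sum>j<r. if i = j then P i \<bullet> w else 0)"
      by (rule sum.cong) (use that P in auto)
    then show ?thesis using that by (simp add: v_def inner_diff_right inner_sum_right)
  qed
  then have "(transpose (active_nabla g zs) *v v) $ k = 0" for k
    using transpose_active_nabla_mult_svd[OF svd, of k v] transpose_active_nabla_mult[of g zs v k]
    by (cases "k \<in> active g zs") (simp_all del: transpose_matrix_vector)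
  then have 1: "transpose (active_nabla g zs) *v v = 0" by (simp add: vec_eq_iff del: transpose_matrix_vector)
  define p where "p = norm (transpose (active_nabla g zs) *v w)"
  have "norm (w - v) \<le> (\<Sum>j<r. norm ((P j \<bullet> w) *\<^sub>R P j))"
    by (simp add: v_def del: norm_scaleR) (rule norm_sum)
  also have "\<dots> \<le> (\<Sum>j<r. (\<Sum>k\<in>active g zs. \<bar>Q j k\<bar>) / \<sigma> j * p)"
  proof (rule sum_mono)
    fix j assume "j \<in> {..<r}"
    then have j: "j < r" by simp
    have "norm (P j) = 1" using P[OF j j] by (simp add: norm_eq_sqrt_inner)
    then have "norm ((P j \<bullet> w) *\<^sub>R P j) = \<bar>P j \<bullet> w\<bar>" by simp
    also have "\<dots> = \<bar>\<Sum>k\<in>active g zs. Q j k * (transpose (active_nabla g zs) *v w) $ k\<bar> / \<sigma> j"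
      unfolding active_svd_left[OF svd j, of w] using pos[OF j] by (simp add: abs_divide)
    also have "\<dots> \<le> (\<Sum>k\<in>active g zs. \<bar>Q j k\<bar> * p) / \<sigma> j"
    proof (rule divide_right_mono[OF order_trans[OF sum_abs sum_mono]])
      show "\<bar>Q j k * (transpose (active_nabla g zs) *v w) $ k\<bar> \<le> \<bar>Q j k\<bar> * p" for k
        unfolding abs_mult p_def by (intro mult_left_mono component_le_norm_cart) auto
    qed (use pos[OF j] in simp)
    finally show "norm ((P j \<bullet> w) *\<^sub>R P j) \<le> (\<Sum>k\<in>active g zs. \<bar>Q j k\<bar>) / \<sigma> j * p"
      by (simp add: sum_distrib_right)
  qed
  also have "\<dots> \<le> \<kappa> * p"
    unfolding sum_distrib_right[symmetric] by (simp add: \<kappa>_def p_def distrib_right)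
  finally show "\<exists>v. transpose (active_nabla g zs) *v v = 0 \<and>
      norm (w - v) \<le> \<kappa> * norm (transpose (active_nabla g zs) *v w)"
    using 1 p_def by blast
qed

lemma KKT_complementary:
  assumes "KKT \<phi> g z lam"
  shows "lam $ i * g z $ i = 0"
proof -
  have "(\<Sum>i\<in>UNIV. - (lam $ i * g z $ i)) = 0"
    using assms by (simp add: KKT_def inner_vec_def sum_negf)
  then have "- (lam $ i * g z $ i) = 0"
    using assms by (subst (asm) sum_nonneg_eq_0_iff) (auto simp: KKT_def mult_nonneg_nonpos)
  then show ?thesis by simp
qed

lemma KKT_inactive: "KKT \<phi> g z lam \<Longrightarrow> i \<notin> active g z \<Longrightarrow> lam $ i = 0"
  using KKT_complementary[of \<phi> g z lam i] by (simp add: active_def)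

text \<open>Gauvin's argument: pairing stationarity with the MFCQ direction expresses
  \<open>grad \<phi> zs\<close> in that direction as a combination of the multipliers with
  coefficients of at least \<open>c\<close> on the active set, and inactive multipliers
  vanish.\<close>

lemma multipliers_bounded:
  assumes \<phi>: "\<phi> differentiable (at zs)" and g: "\<And>i. (\<lambda>y. g y $ i) differentiable (at zs)"
    and MFCQ: "MFCQ g zs"
  obtains M where "M > 0" "\<And>lam. lam \<in> multipliers \<phi> g zs \<Longrightarrow> norm lam \<le> M"
proof -
  obtain y where y: "\<And>i. i \<in> active g zs \<Longrightarrow> - (column i (nabla g zs) \<bullet> y) > 0"
    using MFCQ by (auto simp: MFCQ_def)
  obtain c where c: "c > 0" "\<And>i. i \<in> active g zs \<Longrightarrow> c \<le> - (column i (nabla g zs) \<bullet> y)"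
    using finite_uniform_lower_bound[of "active g zs" "\<lambda>i. - (column i (nabla g zs) \<bullet> y)"] y by auto
  show ?thesis
  proof (rule that[of "\<bar>grad \<phi> zs \<bullet> y\<bar> / c + 1"])
    show "\<bar>grad \<phi> zs \<bullet> y\<bar> / c + 1 > 0" using c by (simp add: add_nonneg_pos)
    fix lam assume "lam \<in> multipliers \<phi> g zs"
    then have K: "KKT \<phi> g zs lam" by (simp add: multipliers_def)
    then have "(grad \<phi> zs + nabla g zs *v lam) \<bullet> y = 0"
      using Lagr_z_eq[OF \<phi> g, of lam] by (simp add: KKT_def)
    then have "grad \<phi> zs \<bullet> y = (\<Sum>i\<in>UNIV. lam $ i * - (column i (nabla g zs) \<bullet> y))"
      by (simp add: nabla_mult_eq_sum column_nabla inner_add_left inner_sum_left sum_negf)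
    also have "\<dots> \<ge> (\<Sum>i\<in>UNIV. lam $ i * c)"
    proof (rule sum_mono)
      fix i
      show "lam $ i * c \<le> lam $ i * - (column i (nabla g zs) \<bullet> y)"
      proof (cases "i \<in> active g zs")
        case True
        then show ?thesis using K c(2)[OF True] by (intro mult_left_mono) (auto simp: KKT_def)
      next
        case False
        then show ?thesis using KKT_inactive[OF K] by simp
      qed
    qed
    finally have "(\<Sum>i\<in>UNIV. lam $ i) \<le> \<bar>grad \<phi> zs \<bullet> y\<bar> / c"
      using c(1) by (simp add: field_simps flip: sum_distrib_left sum_distrib_right)
    moreover have "norm lam \<le> (\<Sum>i\<in>UNIV. lam $ i)"
      using norm_le_l1_cart[of lam] K by (simp add: KKT_def)
    ultimately show "norm lam \<le> \<bar>grad \<phi> zs \<bullet> y\<bar> / c + 1" by linarith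
  qed
qed

text \<open>With B_+ = B the inequality part of the second-order condition is vacuous. The constant
  \<xi> is the same for all multipliers, so the multiplier may vary along a sequence.\<close>

lemma second_order_null_space:
  assumes "second_order_conditions \<phi> g zs" "strict_complementarity \<phi> g zs"
  obtains \<xi> where "\<xi> > 0" "\<And>lam v. lam \<in> multipliers \<phi> g zs \<Longrightarrow>
    transpose (active_nabla g zs) *v v = 0 \<Longrightarrow> \<xi> * (norm v)\<^sup>2 \<le> v \<bullet> (Lagr_zz \<phi> g zs lam *v v)"
proof -
  obtain \<xi> where \<xi>: "\<xi> > 0" and so: "\<And>lam w. lam \<in> multipliers \<phi> g zs \<Longrightarrow>
      \<forall>i\<in>active_plus \<phi> g zs. column i (nabla g zs) \<bullet> w = 0 \<Longrightarrow>
      \<forall>i\<in>active g zs - active_plus \<phi> g zs. column i (nabla g zs) \<bullet> w \<le> 0 \<Longrightarrow>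
      w \<bullet> (Lagr_zz \<phi> g zs lam *v w) \<ge> \<xi> * (norm w)\<^sup>2"
    using assms(1) unfolding second_order_conditions_def by blast
  have "active_plus \<phi> g zs = active g zs"
    using assms(2) by (auto simp: active_plus_def strict_complementarity_def)
  moreover have "column i (nabla g zs) \<bullet> v = 0"
    if "transpose (active_nabla g zs) *v v = 0" "i \<in> active g zs" for i v
    using that transpose_active_nabla_mult[of g zs v i] by simp
  ultimately show ?thesis using that[OF \<xi>] so by simp
qed

section \<open>Iterates approaching the solution\<close>

text \<open>All iteration data are functions on the carrier of a filter, while the problem, the
  solution and the SVD stay fixed. \<open>lam0 x\<close> is a multiplier close to
  \<open>lam x\<close>; neither of them has to converge, only their difference does.\<close>

locale nlp_iterates =
  fixes \<phi> :: "real ^ 'n \<Rightarrow> real" and g :: "real ^ 'n \<Rightarrow> real ^ 'm" and zs :: "real ^ 'n"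
    and C \<gamma> Ct :: real
    and r :: nat and P :: "nat \<Rightarrow> real ^ 'n" and \<sigma> :: "nat \<Rightarrow> real" and Q :: "nat \<Rightarrow> 'm \<Rightarrow> real"
    and L :: "'x filter" and z :: "'x \<Rightarrow> real ^ 'n" and lam lam0 s t :: "'x \<Rightarrow> real ^ 'm"
    and \<mu> :: "'x \<Rightarrow> real"
  assumes \<mu>_def: "\<And>x. \<mu> x = mu (lam x) (s x)"
    and \<phi>: "twice_lipschitz_differentiable \<phi>"
    and g: "\<And>i. twice_lipschitz_differentiable (\<lambda>z. g z $ i)"
    and feasible: "feasible g zs"
    and MFCQ: "MFCQ g zs"
    and second_order: "second_order_conditions \<phi> g zs"
    and strict: "strict_complementarity \<phi> g zs"
    and svd: "active_svd g zs r P \<sigma> Q"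
    and \<gamma>: "0 < \<gamma>" and Ct: "Ct > 0"
    and z: "(z \<longlongrightarrow> zs) L"
    and lam0: "\<forall>\<^sub>F x in L. lam0 x \<in> multipliers \<phi> g zs"
    and lam_lam0: "((\<lambda>x. lam x - lam0 x) \<longlongrightarrow> 0) L"
    and \<mu>_0: "(\<mu> \<longlongrightarrow> 0) L"
    and iterate: "\<forall>\<^sub>F x in L. iterate_conditions \<phi> g C \<gamma> (z x) (lam x) (s x)"
    and t: "\<forall>\<^sub>F x in L. norm (t x) \<le> Ct * (\<mu> x)\<^sup>2"
begin

abbreviation "B \<equiv> active g zs"
abbreviation "As \<equiv> active_nabla g zs"
abbreviation "w \<equiv> \<lambda>x. z x - zs"
abbreviation "gr \<equiv> \<lambda>i z. grad (\<lambda>y. g y $ i) z"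
abbreviation "hs \<equiv> \<lambda>i. hess (\<lambda>y. g y $ i) zs"
abbreviation "Hz \<equiv> \<lambda>x. Lagr_zz \<phi> g (z x) (lam x)"
abbreviation "Hs \<equiv> \<lambda>l. Lagr_zz \<phi> g zs l"
abbreviation "Lz \<equiv> \<lambda>x. Lagr_z \<phi> g (z x) (lam x)"

lemmas \<phi>_diff = twice_lipschitz_differentiableD[OF \<phi>]
lemmas g_diff = twice_lipschitz_differentiableD[OF g]
lemmas Lagr_z = Lagr_z_eq[OF \<phi>_diff(1) g_diff(1)]
lemmas Lagr_zz = Lagr_zz_eq[OF \<phi>_diff(1) g_diff(1) \<phi>_diff(2) g_diff(2)]

section \<open>Boundedness of the iterates and limits of the Hessians\<close>

lemma iterate_facts:
  "\<forall>\<^sub>F x in L. \<mu> x > 0 \<and> (\<forall>i. lam x $ i > 0 \<and> s x $ i > 0 \<and> \<gamma> * \<mu> x \<le> lam x $ i * s x $ i) \<and>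
    lam x \<bullet> s x = CARD('m) * \<mu> x \<and> norm (Lz x) \<le> C * \<mu> x \<and> norm (g (z x) + s x) \<le> C * \<mu> x"
  using iterate
proof eventually_elim
  case (elim x)
  then have "lam x \<bullet> s x > 0"
    unfolding inner_vec_def inner_real_def by (intro sum_pos) (auto simp: iterate_conditions_def)
  then have "\<mu> x > 0" by (simp add: \<mu>_def mu_def)
  moreover have "lam x \<bullet> s x = CARD('m) * \<mu> x" by (simp add: \<mu>_def mu_def)
  ultimately show ?case using elim by (auto simp: iterate_conditions_def \<mu>_def)
qed

lemma \<mu>_pos: "\<forall>\<^sub>F x in L. \<mu> x > 0"
  using iterate_facts by eventually_elim auto

lemma \<mu>_nonneg: "\<forall>\<^sub>F x in L. 0 \<le> \<mu> x"
  using \<mu>_pos by eventually_elim auto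

lemma \<mu>_bigo: "\<mu> \<in> O[L](\<lambda>_. 1)"
  using bigo_norm_tendsto[OF \<mu>_0] by simp

lemma Lz_bigo: "(\<lambda>x. norm (Lz x)) \<in> O[L](\<mu>)"
  by (rule bigo_norm_dominated[where g = "\<lambda>x. C * \<mu> x"]) (use iterate_facts in \<open>auto elim: eventually_mono\<close>)

lemma residual_bigo: "(\<lambda>x. norm (g (z x) + s x)) \<in> O[L](\<mu>)"
  by (rule bigo_norm_dominated[where g = "\<lambda>x. C * \<mu> x"]) (use iterate_facts in \<open>auto elim: eventually_mono\<close>)

lemma lam0_bigo: "(\<lambda>x. norm (lam0 x)) \<in> O[L](\<lambda>_. 1)"
proof -
  obtain M where "M > 0" and M: "\<And>lam. lam \<in> multipliers \<phi> g zs \<Longrightarrow> norm lam \<le> M"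
    using multipliers_bounded[OF \<phi>_diff(1) g_diff(1) MFCQ] by blast
  show ?thesis
    by (rule bigo_norm_dominated[where g = "\<lambda>_. M"]) (use lam0 M in \<open>auto elim!: eventually_mono\<close>)
qed

lemma lam_bigo: "(\<lambda>x. norm (lam x)) \<in> O[L](\<lambda>_. 1)"
  using bigo_norm_add[OF bigo_norm_tendsto[OF lam_lam0] lam0_bigo] by simp

lemma g_tendsto: "((\<lambda>x. g (z x)) \<longlongrightarrow> g zs) L"
proof (rule vec_tendstoI)
  fix i
  have "isCont (\<lambda>y. g y $ i) zs"
    using g_diff(1) differentiable_imp_continuous_within by blast
  then show "((\<lambda>x. g (z x) $ i) \<longlongrightarrow> g zs $ i) L"
    by (rule isCont_tendsto_compose[OF _ z])
qed

lemma g_bigo: "(\<lambda>x. norm (g (z x))) \<in> O[L](\<lambda>_. 1)"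
  by (rule bigo_norm_tendsto[OF g_tendsto])

lemma s_bigo: "(\<lambda>x. norm (s x)) \<in> O[L](\<lambda>_. 1)"
  using bigo_norm_diff[OF landau_o.big_trans[OF residual_bigo \<mu>_bigo] g_bigo] by simp

lemma hess_tendsto:
  assumes "twice_lipschitz_differentiable f"
  shows "((\<lambda>x. hess f (z x)) \<longlongrightarrow> hess f zs) L"
  by (rule isCont_tendsto_compose[OF twice_lipschitz_differentiableD(3)[OF assms] z])

text \<open>The difference splits into bounded multipliers times Hessian differences that vanish by
  continuity, and vanishing multiplier differences times fixed Hessians. No limit of
  \<open>Hz x\<close> itself is available.\<close>

lemma Hz_tendsto: "((\<lambda>x. Hz x - Hs (lam0 x)) \<longlongrightarrow> 0) L"
proof -
  have 1: "((\<lambda>x. (lam x - lam0 x) $ i *\<^sub>R hs i) \<longlongrightarrow> 0) L" for i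
    using tendsto_scaleR[OF tendsto_vec_nth[OF lam_lam0, of i] tendsto_const[of "hs i"]] by simp
  have 2: "((\<lambda>x. lam x $ i *\<^sub>R (hess (\<lambda>y. g y $ i) (z x) - hs i)) \<longlongrightarrow> 0) L" for i
  proof -
    obtain M where "M > 0" and M: "\<forall>\<^sub>F x in L. norm (norm (lam x)) \<le> M * norm (1 :: real)"
      using lam_bigo by (rule landau_o.bigE)
    have b: "Bfun (\<lambda>x. lam x $ i) L"
      by (rule BfunI[of _ M]) (use M in \<open>auto elim!: eventually_mono intro: order_trans[OF component_le_norm_cart]\<close>)
    have "Zfun (\<lambda>x. hess (\<lambda>y. g y $ i) (z x) - hs i) L"
      using hess_tendsto[OF g] by (simp add: tendsto_Zfun_iff)
    then have "Zfun (\<lambda>x. lam x $ i *\<^sub>R (hess (\<lambda>y. g y $ i) (z x) - hs i)) L"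
      by (rule bounded_bilinear.Bfun_prod_Zfun[OF bounded_bilinear_scaleR b])
    then show ?thesis by (simp add: tendsto_Zfun_iff)
  qed
  have "((\<lambda>x. (hess \<phi> (z x) - hess \<phi> zs) +
      ((\<Sum>i\<in>UNIV. lam x $ i *\<^sub>R (hess (\<lambda>y. g y $ i) (z x) - hs i)) + (\<Sum>i\<in>UNIV. (lam x - lam0 x) $ i *\<^sub>R hs i))) \<longlongrightarrow>
      0 + ((\<Sum>i\<in>(UNIV :: 'm set). 0) + (\<Sum>i\<in>(UNIV :: 'm set). 0))) L"
    using hess_tendsto[OF \<phi>] 1 2 by (intro tendsto_add tendsto_sum) (auto simp: Lim_null[symmetric])
  moreover have "(hess \<phi> (z x) - hess \<phi> zs) +
      ((\<Sum>i\<in>UNIV. lam x $ i *\<^sub>R (hess (\<lambda>y. g y $ i) (z x) - hs i)) + (\<Sum>i\<in>UNIV. (lam x - lam0 x) $ i *\<^sub>R hs i))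
      = Hz x - Hs (lam0 x)" for x
    unfolding Lagr_zz by (simp add: scaleR_diff_right scaleR_diff_left sum_subtractf)
  ultimately show ?thesis by simp
qed

lemma Hs_lam_tendsto: "((\<lambda>x. Hs (lam x) - Hs (lam0 x)) \<longlongrightarrow> 0) L"
proof -
  have 1: "((\<lambda>x. (lam x - lam0 x) $ i *\<^sub>R hs i) \<longlongrightarrow> 0) L" for i
    using tendsto_scaleR[OF tendsto_vec_nth[OF lam_lam0, of i] tendsto_const[of "hs i"]] by simp
  have "((\<lambda>x. \<Sum>i\<in>UNIV. (lam x - lam0 x) $ i *\<^sub>R hs i) \<longlongrightarrow> (\<Sum>i\<in>(UNIV :: 'm set). 0)) L"
    using 1 by (intro tendsto_sum)
  moreover have "(\<Sum>i\<in>UNIV. (lam x - lam0 x) $ i *\<^sub>R hs i) = Hs (lam x) - Hs (lam0 x)" for x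
    unfolding Lagr_zz by (simp add: scaleR_diff_left sum_subtractf)
  ultimately show ?thesis by simp
qed

lemma Hs_lam0_bigo: "(\<lambda>x. norm (Hs (lam0 x))) \<in> O[L](\<lambda>_. 1)"
proof -
  have "(\<lambda>x. norm (hess \<phi> zs + (\<Sum>i\<in>UNIV. lam0 x $ i *\<^sub>R hs i))) \<in> O[L](\<lambda>_. 1)"
    using bigo_norm_scaleR[OF bigo_vec_nth[OF lam0_bigo] bigo_norm_tendsto[OF tendsto_const]]
    by (intro bigo_norm_add bigo_norm_sum bigo_norm_tendsto[OF tendsto_const]) simp
  then show ?thesis by (simp add: Lagr_zz)
qed

lemma near_Hs_bigo:
  assumes "((\<lambda>x. H x - Hs (lam0 x)) \<longlongrightarrow> 0) L"
  shows "(\<lambda>x. norm (H x)) \<in> O[L](\<lambda>_. 1)"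
  using bigo_norm_add[OF bigo_norm_tendsto[OF assms] Hs_lam0_bigo] by simp

text \<open>A perturbation of norm below \<xi> / 2 leaves half of the uniform coercivity. This
  extends it to Hessians at \<open>lam x\<close>, which is not a multiplier, and to the Hessians of
  the computed system.\<close>

lemma near_Hs_coercive:
  assumes "((\<lambda>x. H x - Hs (lam0 x)) \<longlongrightarrow> 0) L"
  obtains \<xi> where "\<xi> > 0"
    "\<forall>\<^sub>F x in L. \<forall>v. transpose As *v v = 0 \<longrightarrow> \<xi> * (norm v)\<^sup>2 \<le> v \<bullet> (H x *v v)"
proof -
  obtain \<xi> where \<xi>: "\<xi> > 0" and so: "\<And>lam v. lam \<in> multipliers \<phi> g zs \<Longrightarrow>
    transpose As *v v = 0 \<Longrightarrow> \<xi> * (norm v)\<^sup>2 \<le> v \<bullet> (Hs lam *v v)"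
    using second_order_null_space[OF second_order strict] by blast
  have "\<forall>\<^sub>F x in L. norm (H x - Hs (lam0 x)) < \<xi> / 2"
    using tendstoD[OF assms, of "\<xi> / 2"] \<xi> by simp
  then have "\<forall>\<^sub>F x in L. \<forall>v. transpose As *v v = 0 \<longrightarrow> \<xi> / 2 * (norm v)\<^sup>2 \<le> v \<bullet> (H x *v v)"
    using lam0
  proof eventually_elim
    case (elim x)
    show ?case
    proof (intro allI impI)
      fix v assume v: "transpose As *v v = 0"
      have "\<bar>v \<bullet> ((H x - Hs (lam0 x)) *v v)\<bar> \<le> norm v * (norm (H x - Hs (lam0 x)) * norm v)"
        by (rule order_trans[OF Cauchy_Schwarz_ineq2])
          (intro mult_left_mono norm_matrix_vector_mult_le norm_ge_zero)
      also have "\<dots> \<le> norm v * (\<xi> / 2 * norm v)"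
        using elim by (intro mult_left_mono mult_right_mono) auto
      also have "\<dots> = \<xi> / 2 * (norm v)\<^sup>2" by (simp add: power2_eq_square)
      finally have "\<bar>v \<bullet> (H x *v v) - v \<bullet> (Hs (lam0 x) *v v)\<bar> \<le> \<xi> / 2 * (norm v)\<^sup>2"
        by (simp add: matrix_vector_mult_diff_rdistrib inner_diff_right)
      then show "\<xi> / 2 * (norm v)\<^sup>2 \<le> v \<bullet> (H x *v v)"
        using so[OF elim(2) v] by linarith
    qed
  qed
  then show ?thesis using that[of "\<xi> / 2"] \<xi> by simp
qed

section \<open>Expansions at the solution\<close>

lemma w_tendsto: "(w \<longlongrightarrow> 0) L"
  using z Lim_null by blast

text \<open>The first-order remainder of the gradient of the Lagrangian with the multiplier frozen
  at \<open>lam x\<close>.\<close>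

definition grad_remainder :: "'x \<Rightarrow> real ^ 'n" where
  "grad_remainder x = (grad \<phi> (z x) - grad \<phi> zs - hess \<phi> zs *v w x) +
     (\<Sum>i\<in>UNIV. lam x $ i *\<^sub>R (gr i (z x) - gr i zs - hs i *v w x))"

lemma grad_remainder_smallo: "(\<lambda>x. norm (grad_remainder x)) \<in> o[L](\<lambda>x. norm (w x))"
proof -
  let ?f = "\<lambda>x. norm (grad \<phi> (z x) - grad \<phi> zs - hess \<phi> zs *v w x) +
     (\<Sum>i\<in>UNIV. \<bar>lam x $ i\<bar> * norm (gr i (z x) - gr i zs - hs i *v w x))"
  have 1: "(\<lambda>x. \<bar>lam x $ i\<bar> * norm (gr i (z x) - gr i zs - hs i *v w x)) \<in> o[L](\<lambda>x. norm (w x))" for i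
    using landau_o.big_small_mult[OF bigo_norm_nth[OF lam_bigo, of i] grad_taylor_smallo[OF g[of i] z]] by simp
  have f: "?f \<in> o[L](\<lambda>x. norm (w x))"
    by (intro sum_in_smallo(1) grad_taylor_smallo[OF \<phi> z] big_sum_in_smallo 1)
  have "(\<lambda>x. norm (grad_remainder x)) \<in> O[L](?f)"
  proof (rule landau_o.bigI[of 1], simp, rule always_eventually, rule allI)
    fix x
    have "norm (grad_remainder x) \<le> ?f x"
      unfolding grad_remainder_def
      by (rule order_trans[OF norm_triangle_ineq add_left_mono[OF order_trans[OF norm_sum]]]) simp
    then show "norm (norm (grad_remainder x)) \<le> 1 * norm (?f x)" by simp
  qed
  then show ?thesis using f by (rule landau_o.big_small_trans)
qed

lemma Hs_mult: "Hs l *v v = hess \<phi> zs *v v + (\<Sum>i\<in>UNIV. l $ i *\<^sub>R (hs i *v v))"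
proof -
  have "(\<Sum>i\<in>I. l $ i *\<^sub>R hs i) *v v = (\<Sum>i\<in>I. l $ i *\<^sub>R (hs i *v v))" for I
    by (induction I rule: infinite_finite_induct)
      (auto simp: matrix_vector_mult_add_rdistrib scaleR_matrix_vector_assoc)
  then show ?thesis by (simp add: Lagr_zz matrix_vector_mult_add_rdistrib)
qed

text \<open>Subtracting stationarity at \<open>zs\<close> introduces an arbitrary multiplier
  \<open>l\<close>, which affects only the first-order term; the Hessian and the remainder keep
  \<open>lam x\<close>.\<close>

lemma Lz_expansion:
  assumes "l \<in> multipliers \<phi> g zs"
  shows "Lz x = grad_remainder x + (\<Sum>i\<in>UNIV. (lam x - l) $ i *\<^sub>R gr i zs) + Hs (lam x) *v w x"
proof -
  have "grad \<phi> zs + (\<Sum>i\<in>UNIV. l $ i *\<^sub>R gr i zs) = 0"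
    using assms unfolding multipliers_def KKT_def Lagr_z nabla_mult_eq_sum by simp
  then have "grad \<phi> zs = - (\<Sum>i\<in>UNIV. l $ i *\<^sub>R gr i zs)" by (simp add: add_eq_0_iff2)
  then show ?thesis
    unfolding Lagr_z nabla_mult_eq_sum grad_remainder_def Hs_mult
    by (simp add: scaleR_diff_left scaleR_diff_right sum_subtractf sum.distrib algebra_simps)
qed

lemma strict_multiplier:
  obtains ls c where "ls \<in> multipliers \<phi> g zs" "c > 0" "\<And>i. i \<in> B \<Longrightarrow> c \<le> ls $ i"
    "\<And>i. i \<notin> B \<Longrightarrow> ls $ i = 0" "\<And>i. i \<notin> B \<Longrightarrow> c \<le> - (g zs $ i)" "\<And>i. 0 \<le> ls $ i"
proof -
  obtain ls where ls: "ls \<in> multipliers \<phi> g zs" "\<And>i. i \<in> B \<Longrightarrow> ls $ i > 0"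
    using strict by (auto simp: strict_complementarity_def)
  obtain c1 where c1: "c1 > 0" "\<And>i. i \<in> B \<Longrightarrow> c1 \<le> ls $ i"
    using finite_uniform_lower_bound[of B "\<lambda>i. ls $ i"] ls(2) by auto
  have "- (g zs $ i) > 0" if "i \<in> - B" for i
    using feasible that by (auto simp: feasible_def active_def less_le)
  then obtain c2 where c2: "c2 > 0" "\<And>i. i \<in> - B \<Longrightarrow> c2 \<le> - (g zs $ i)"
    using finite_uniform_lower_bound[of "- B" "\<lambda>i. - (g zs $ i)"] by auto
  have K: "KKT \<phi> g zs ls" using ls(1) by (simp add: multipliers_def)
  show ?thesis
  proof (rule that[of ls "min c1 c2"])
    show "0 \<le> ls $ i" for i using K by (simp add: KKT_def)
    show "min c1 c2 \<le> ls $ i" if "i \<in> B" for i using c1(2)[OF that] by simp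
    show "min c1 c2 \<le> - (g zs $ i)" if "i \<notin> B" for i using c2(2)[of i] that by simp
  qed (use ls c1 c2 KKT_inactive[OF K] in auto)
qed

definition value_remainder :: "'m \<Rightarrow> 'x \<Rightarrow> real" where
  "value_remainder i x = g (z x) $ i - g zs $ i - gr i zs \<bullet> w x - 1/2 * (w x \<bullet> (hs i *v w x))"

lemma value_remainder_smallo: "value_remainder i \<in> o[L](\<lambda>x. (norm (w x))\<^sup>2)"
  using function_taylor_smallo[OF g[of i] z] by (simp add: value_remainder_def[abs_def])

text \<open>Second-order expansions around \<open>zs\<close> are needed of both \<open>Lz\<close> and \<open>g\<close>: their
  quadratic terms combine to the average of the two Hessians, so that a multiplier \<open>l\<close> far from
  \<open>lam x\<close>, such as a strictly complementary one, can be used.\<close>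

lemma energy_identity:
  assumes l: "l \<in> multipliers \<phi> g zs"
  shows "1/2 * (w x \<bullet> (Hs (lam x) *v w x)) + 1/2 * (w x \<bullet> (Hs l *v w x)) + l \<bullet> s x - lam x \<bullet> g zs =
    lam x \<bullet> s x + Lz x \<bullet> w x - (lam x - l) \<bullet> (g (z x) + s x)
    - (grad_remainder x \<bullet> w x - (\<Sum>i\<in>UNIV. (lam x - l) $ i * value_remainder i x))"
proof -
  have "l \<bullet> g zs = 0" using l by (simp add: multipliers_def KKT_def)
  moreover have "Lz x \<bullet> w x = grad_remainder x \<bullet> w x + (\<Sum>i\<in>UNIV. (lam x - l) $ i * (gr i zs \<bullet> w x))
      + w x \<bullet> (Hs (lam x) *v w x)"
    unfolding Lz_expansion[OF l, of x] by (simp add: inner_add_left inner_sum_left inner_commute[of "w x"])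
  moreover have "(\<Sum>i\<in>UNIV. (lam x - l) $ i * (gr i zs \<bullet> w x)) = (lam x - l) \<bullet> (g (z x) - g zs)
      - (\<Sum>i\<in>UNIV. (lam x - l) $ i * value_remainder i x)
      - 1/2 * (\<Sum>i\<in>UNIV. (lam x - l) $ i * (w x \<bullet> (hs i *v w x)))"
    unfolding inner_vec_def[of "lam x - l"] inner_real_def sum_distrib_left sum_subtractf[symmetric]
  proof (rule sum.cong[OF refl])
    fix i
    have eq: "c * a = c * d - c * (d - a - 1/2 * q) - 1/2 * (c * q)" for a c d q :: real
      by (simp add: algebra_simps)
    show "(lam x - l) $ i * (gr i zs \<bullet> w x) = (lam x - l) $ i * (g (z x) - g zs) $ i
        - (lam x - l) $ i * value_remainder i x - 1/2 * ((lam x - l) $ i * (w x \<bullet> (hs i *v w x)))"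
      unfolding value_remainder_def vector_minus_component[of "g (z x)"] by (rule eq)
  qed
  \<comment> \<open>The Hessian of \<phi> occurs once in each of the two Lagrangian Hessians and
    cancels.\<close>
  moreover have "(\<Sum>i\<in>UNIV. (lam x - l) $ i * (w x \<bullet> (hs i *v w x))) =
      w x \<bullet> (Hs (lam x) *v w x) - w x \<bullet> (Hs l *v w x)"
    unfolding Hs_mult by (simp add: inner_add_right inner_sum_right left_diff_distrib sum_subtractf)
  moreover have "(lam x - l) \<bullet> (g (z x) - g zs) = lam x \<bullet> g (z x) - l \<bullet> g (z x) - lam x \<bullet> g zs + l \<bullet> g zs"
    "(lam x - l) \<bullet> (g (z x) + s x) = lam x \<bullet> g (z x) - l \<bullet> g (z x) + lam x \<bullet> s x - l \<bullet> s x"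
    by (simp_all add: inner_diff_left inner_diff_right inner_add_right)
  ultimately show ?thesis by linarith
qed

section \<open>The energy estimate and the linear rate of the primal error\<close>

lemma null_projection:
  obtains \<kappa> and pr :: "real ^ 'n \<Rightarrow> real ^ 'n" where "\<kappa> > 0" "\<And>v. transpose As *v pr v = 0"
    "\<And>v. norm (v - pr v) \<le> \<kappa> * norm (transpose As *v v)"
proof -
  obtain \<kappa> where "\<kappa> > 0" "\<forall>v. \<exists>p. transpose As *v p = 0 \<and> norm (v - p) \<le> \<kappa> * norm (transpose As *v v)"
    using active_svd_projection[OF svd] by metis
  then show ?thesis using that choice[of "\<lambda>v p. transpose As *v p = 0 \<and> norm (v - p) \<le> \<kappa> * norm (transpose As *v v)"]
    by blast
qed

text \<open>The three parts have to be bounded together: the distance of \<open>w\<close> from the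
  null space depends on the active slacks, whose bound in turn depends on \<open>w\<close>.
  Positivity of \<open>s\<close> and \<open>lam\<close> lets a bound on the sum bound each
  part.\<close>

definition energy :: "'x \<Rightarrow> real" where
  "energy x = (norm (w x))\<^sup>2 + (\<Sum>i\<in>B. s x $ i) + (\<Sum>i\<in>-B. lam x $ i)"

lemma energy_bounds:
  "\<forall>\<^sub>F x in L. 0 \<le> energy x \<and> (norm (w x))\<^sup>2 \<le> energy x \<and>
    (\<forall>i\<in>B. s x $ i \<le> energy x) \<and> (\<forall>i\<in>-B. lam x $ i \<le> energy x)"
  using iterate_facts
proof eventually_elim
  case (elim x)
  have pos: "0 \<le> s x $ i" "0 \<le> lam x $ i" for i using elim by (auto intro: less_imp_le)
  have "0 \<le> (\<Sum>i\<in>B. s x $ i)" "0 \<le> (\<Sum>i\<in>-B. lam x $ i)"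
    using pos by (auto intro: sum_nonneg)
  moreover from this have "s x $ i \<le> energy x" if "i \<in> B" for i
    using member_le_sum[OF that, of "\<lambda>i. s x $ i"] pos zero_le_power2[of "norm (w x)"]
    unfolding energy_def by (simp add: add_increasing add_increasing2)
  moreover from calculation have "lam x $ i \<le> energy x" if "i \<in> -B" for i
    using member_le_sum[OF that, of "\<lambda>i. lam x $ i"] pos zero_le_power2[of "norm (w x)"]
    unfolding energy_def by (simp add: add_increasing add_increasing2)
  ultimately show ?case
    by (simp add: energy_def)
qed

lemma energy_nonneg: "\<forall>\<^sub>F x in L. 0 \<le> energy x"
  using energy_bounds by eventually_elim auto

lemma bigo_energy_plus_\<mu>I:
  assumes "\<forall>\<^sub>F x in L. \<bar>f x\<bar> \<le> energy x + \<mu> x"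
  shows "f \<in> O[L](\<lambda>x. energy x + \<mu> x)"
  by (rule landau_o.bigI[of 1]) (use assms in \<open>auto elim!: eventually_mono\<close>)

lemma \<mu>_bigo_energy: "\<mu> \<in> O[L](\<lambda>x. energy x + \<mu> x)"
  by (rule bigo_energy_plus_\<mu>I) (use energy_nonneg \<mu>_nonneg in \<open>eventually_elim, auto\<close>)

lemma w_sq_bigo_energy: "(\<lambda>x. (norm (w x))\<^sup>2) \<in> O[L](\<lambda>x. energy x + \<mu> x)"
proof (rule bigo_energy_plus_\<mu>I)
  show "\<forall>\<^sub>F x in L. \<bar>(norm (w x))\<^sup>2\<bar> \<le> energy x + \<mu> x"
    using energy_bounds \<mu>_nonneg by eventually_elim auto
qed

lemma active_linearization:
  assumes "i \<in> B"
  shows "(transpose As *v w x) $ i = (g (z x) + s x) $ i - s x $ i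
    - 1/2 * (w x \<bullet> (hs i *v w x)) - value_remainder i x"
proof -
  have "g zs $ i = 0" using assms by (simp add: active_def)
  then show ?thesis
    using assms unfolding transpose_active_nabla_mult column_nabla value_remainder_def by simp
qed

text \<open>On active constraints g vanishes at \<open>zs\<close> and \<open>g + s\<close> is
  O(\<mu>), so the linear term is the negative slack up to terms of order \<mu> and second order.
  The comparison function is kept general for two uses: \<open>energy + \<mu>\<close> before the
  energy is bounded, and \<mu> afterwards.\<close>

lemma active_linearization_bigo:
  assumes s: "\<And>i. i \<in> B \<Longrightarrow> (\<lambda>x. s x $ i) \<in> O[L](h)"
    and w2: "(\<lambda>x. (norm (w x))\<^sup>2) \<in> O[L](h)" and \<mu>: "\<mu> \<in> O[L](h)"
  shows "(\<lambda>x. norm (transpose As *v w x)) \<in> O[L](h :: 'x \<Rightarrow> real)"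
proof (rule bigo_norm_vecI)
  fix i
  show "(\<lambda>x. norm ((transpose As *v w x) $ i)) \<in> O[L](h)"
  proof (cases "i \<in> B")
    case False
    then show ?thesis by (simp add: transpose_active_nabla_mult del: transpose_matrix_vector)
  next
    case True
    have 1: "(\<lambda>x. (g (z x) + s x) $ i) \<in> O[L](h)"
      by (rule landau_o.big_trans[OF bigo_vec_nth[OF residual_bigo] \<mu>])
    have "(\<lambda>x. norm (w x)) \<in> O[L](\<lambda>x. norm (w x))" by simp
    moreover have "(\<lambda>x. norm (hs i *v w x)) \<in> O[L](\<lambda>x. 1 * norm (w x))"
      by (rule bigo_norm_matrix_vector_mult) (auto intro: bigo_norm_tendsto[OF tendsto_const])
    ultimately have "(\<lambda>x. w x \<bullet> (hs i *v w x)) \<in> O[L](\<lambda>x. norm (w x) * (1 * norm (w x)))"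
      by (rule bigo_norm_inner)
    then have "(\<lambda>x. w x \<bullet> (hs i *v w x)) \<in> O[L](\<lambda>x. (norm (w x))\<^sup>2)"
      by (simp add: power2_eq_square)
    then have 2: "(\<lambda>x. 1/2 * (w x \<bullet> (hs i *v w x))) \<in> O[L](h)"
      using landau_o.big_trans[OF _ w2] by simp
    have 3: "value_remainder i \<in> O[L](h)"
      by (rule landau_o.big_trans[OF landau_o.small_imp_big[OF value_remainder_smallo] w2])
    have "(\<lambda>x. (transpose As *v w x) $ i) \<in> O[L](h)"
      unfolding active_linearization[OF True]
      by (intro sum_in_bigo(2) 1 2 3 s[OF True])
    then show ?thesis by (simp del: transpose_matrix_vector)
  qed
qed

text \<open>One factor is O(energy + \<mu>) and the other tends to 0. This makes the failure of
  \<open>w\<close> to lie in the null space absorbable.\<close>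

lemma active_linearization_sq_smallo:
  "(\<lambda>x. (norm (transpose As *v w x))\<^sup>2) \<in> o[L](\<lambda>x. energy x + \<mu> x)"
proof -
  have O: "(\<lambda>x. norm (transpose As *v w x)) \<in> O[L](\<lambda>x. energy x + \<mu> x)"
  proof (rule active_linearization_bigo[OF _ w_sq_bigo_energy \<mu>_bigo_energy])
    fix i assume i: "i \<in> B"
    show "(\<lambda>x. s x $ i) \<in> O[L](\<lambda>x. energy x + \<mu> x)"
    proof (rule bigo_energy_plus_\<mu>I)
      show "\<forall>\<^sub>F x in L. \<bar>s x $ i\<bar> \<le> energy x + \<mu> x"
        using energy_bounds iterate_facts
      proof eventually_elim
        case (elim x)
        then have "0 < s x $ i" "s x $ i \<le> energy x" "0 < \<mu> x" using i by auto
        then show ?case by linarith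
      qed
    qed
  qed
  have "((\<lambda>x. transpose As *v w x) \<longlongrightarrow> transpose As *v 0) L"
    by (rule bounded_linear.tendsto[OF matrix_vector_mul_bounded_linear w_tendsto])
  then have "((\<lambda>x. norm (transpose As *v w x)) \<longlongrightarrow> 0) L"
    using tendsto_norm_zero by (simp del: transpose_matrix_vector)
  then have "(\<lambda>x. norm (transpose As *v w x)) \<in> o[L](\<lambda>_. 1)"
    by (intro smalloI_tendsto) auto
  then have "(\<lambda>x. norm (transpose As *v w x) * norm (transpose As *v w x)) \<in> o[L](\<lambda>x. 1 * (energy x + \<mu> x))"
    using O by (rule landau_o.small_big_mult)
  then show ?thesis by (simp add: power2_eq_square del: transpose_matrix_vector)
qed

text \<open>In \<open>energy_identity\<close> with a strictly complementary \<open>ls\<close>, the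
  term \<open>ls \<bullet> s x\<close> dominates the active slacks and
  \<open>- (lam x \<bullet> g zs)\<close> the inactive multipliers, because \<open>ls\<close> on B
  and \<open>- g zs\<close> off B are bounded below. The Hessian terms supply
  \<open>(norm w)\<^sup>2\<close> up to the square of the linearized constraints. Everything on the
  right is O(\<mu>) or o(energy + \<mu>).\<close>

lemma energy_bigo: "energy \<in> O[L](\<mu>)"
proof -
  obtain ls c where ls: "ls \<in> multipliers \<phi> g zs" and c: "c > 0" and lsB: "\<And>i. i \<in> B \<Longrightarrow> c \<le> ls $ i"
    and ls0: "\<And>i. 0 \<le> ls $ i" and gN: "\<And>i. i \<notin> B \<Longrightarrow> c \<le> - (g zs $ i)"
    using strict_multiplier by metis
  obtain \<xi>1 where \<xi>1: "\<xi>1 > 0"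
    "\<forall>\<^sub>F x in L. \<forall>v. transpose As *v v = 0 \<longrightarrow> \<xi>1 * (norm v)\<^sup>2 \<le> v \<bullet> (Hs (lam x) *v v)"
    using near_Hs_coercive[OF Hs_lam_tendsto] by blast
  obtain \<xi>2 where \<xi>2: "\<xi>2 > 0" "\<And>lam v. lam \<in> multipliers \<phi> g zs \<Longrightarrow>
    transpose As *v v = 0 \<Longrightarrow> \<xi>2 * (norm v)\<^sup>2 \<le> v \<bullet> (Hs lam *v v)"
    using second_order_null_space[OF second_order strict] by blast
  obtain M1 where M1: "M1 > 0" "\<forall>\<^sub>F x in L. norm (norm (Hs (lam x))) \<le> M1 * norm (1 :: real)"
    using near_Hs_bigo[OF Hs_lam_tendsto] by (rule landau_o.bigE)
  obtain \<kappa> and pr where \<kappa>: "\<kappa> > 0" and pr: "\<And>v. transpose As *v pr v = 0"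
    "\<And>v. norm (v - pr v) \<le> \<kappa> * norm (transpose As *v v)"
    using null_projection by metis
  \<comment> \<open>\<open>E1\<close> and \<open>E2\<close> are the constants of
    \<open>quadratic_form_lower_bound\<close> for the Hessians at \<open>lam x\<close> and at
    \<open>ls\<close>; each enters \<open>E\<close> with the weight 1/2 that its Hessian has in the
    identity.\<close>
  define E1 where "E1 = \<xi>1 / 2 + 2 * M1\<^sup>2 / \<xi>1 + M1"
  define E2 where "E2 = \<xi>2 / 2 + 2 * (norm (Hs ls))\<^sup>2 / \<xi>2 + norm (Hs ls)"
  define pw where "pw x = norm (transpose As *v w x)" for x
  define E where "E = 1/2 * E1 * \<kappa>\<^sup>2 + 1/2 * E2 * \<kappa>\<^sup>2"
  \<comment> \<open>The coefficient \<xi>1 / 8 is half of \<xi>1 / 4. The positive contribution of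
    the Hessian at \<open>ls\<close> is dropped.\<close>
  define c0 where "c0 = min (min (\<xi>1 / 8) c) c"
  have c0: "c0 > 0" unfolding c0_def using \<xi>1 c by simp
  define p where "p x = lam x \<bullet> s x + Lz x \<bullet> w x - (lam x - ls) \<bullet> (g (z x) + s x)" for x
  define R where "R x = grad_remainder x \<bullet> w x - (\<Sum>i\<in>UNIV. (lam x - ls) $ i * value_remainder i x)" for x
  have main: "\<forall>\<^sub>F x in L. c0 * energy x \<le> p x + (E * (pw x)\<^sup>2 - R x)"
    using \<xi>1(2) M1(2) iterate_facts
  proof eventually_elim
    case (elim x)
    have d: "(norm (w x - pr (w x)))\<^sup>2 \<le> \<kappa>\<^sup>2 * (pw x)\<^sup>2"
      using power_mono[OF pr(2)[of "w x"], of 2] by (simp add: pw_def power_mult_distrib del: transpose_matrix_vector)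
    have "E1 * (norm (w x - pr (w x)))\<^sup>2 \<le> E1 * (\<kappa>\<^sup>2 * (pw x)\<^sup>2)"
      using \<xi>1 M1 by (intro mult_left_mono d) (simp add: E1_def)
    moreover have "\<xi>1 / 4 * (norm (w x))\<^sup>2 - E1 * (norm (w x - pr (w x)))\<^sup>2 \<le> w x \<bullet> (Hs (lam x) *v w x)"
      unfolding E1_def by (rule quadratic_form_lower_bound[OF \<xi>1(1)]) (use elim pr(1) in auto)
    ultimately have q1: "\<xi>1 / 4 * (norm (w x))\<^sup>2 - E1 * (\<kappa>\<^sup>2 * (pw x)\<^sup>2) \<le> w x \<bullet> (Hs (lam x) *v w x)"
      by linarith
    have "E2 * (norm (w x - pr (w x)))\<^sup>2 \<le> E2 * (\<kappa>\<^sup>2 * (pw x)\<^sup>2)"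
      using \<xi>2 by (intro mult_left_mono d) (simp add: E2_def)
    moreover have "\<xi>2 / 4 * (norm (w x))\<^sup>2 - E2 * (norm (w x - pr (w x)))\<^sup>2 \<le> w x \<bullet> (Hs ls *v w x)"
      unfolding E2_def by (rule quadratic_form_lower_bound[OF \<xi>2(1)]) (use \<xi>2(2)[OF ls pr(1)] in auto)
    moreover have "0 \<le> \<xi>2 / 4 * (norm (w x))\<^sup>2" using \<xi>2 by simp
    ultimately have q2: "- E2 * (\<kappa>\<^sup>2 * (pw x)\<^sup>2) \<le> w x \<bullet> (Hs ls *v w x)" by linarith
    have lspos: "0 \<le> s x $ i" "0 \<le> lam x $ i" for i using elim by (auto intro: less_imp_le)
    have "c * (\<Sum>i\<in>B. s x $ i) \<le> (\<Sum>i\<in>B. ls $ i * s x $ i)"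
      unfolding sum_distrib_left by (intro sum_mono mult_right_mono lsB lspos) auto
    also have "\<dots> \<le> ls \<bullet> s x"
      unfolding inner_vec_def inner_real_def by (rule sum_mono2) (auto intro: mult_nonneg_nonneg ls0 lspos)
    finally have s1: "c * (\<Sum>i\<in>B. s x $ i) \<le> ls \<bullet> s x" .
    have gB: "g zs $ i \<le> 0" for i using feasible by (simp add: feasible_def)
    have "c * (\<Sum>i\<in>-B. lam x $ i) \<le> (\<Sum>i\<in>-B. - (g zs $ i) * lam x $ i)"
      unfolding sum_distrib_left by (intro sum_mono mult_right_mono gN lspos) auto
    also have "\<dots> \<le> (\<Sum>i\<in>UNIV. - (g zs $ i) * lam x $ i)"
      using gB lspos by (intro sum_mono2) (auto intro!: mult_nonneg_nonneg mult_nonpos_nonneg)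
    also have "\<dots> = - (lam x \<bullet> g zs)" by (simp add: inner_vec_def sum_negf mult.commute)
    finally have s2: "c * (\<Sum>i\<in>-B. lam x $ i) \<le> - (lam x \<bullet> g zs)" .
    have "c0 \<le> \<xi>1 / 8" "c0 \<le> c" by (simp_all add: c0_def)
    from mult_right_mono[OF this(1)] mult_right_mono[OF this(2)]
    have "c0 * (norm (w x))\<^sup>2 \<le> \<xi>1 / 8 * (norm (w x))\<^sup>2" "c0 * (\<Sum>i\<in>B. s x $ i) \<le> c * (\<Sum>i\<in>B. s x $ i)"
      "c0 * (\<Sum>i\<in>-B. lam x $ i) \<le> c * (\<Sum>i\<in>-B. lam x $ i)"
      using lspos by (metis zero_le_power2, meson sum_nonneg, meson sum_nonneg)
    then have "c0 * energy x \<le> \<xi>1 / 8 * (norm (w x))\<^sup>2 + ls \<bullet> s x - lam x \<bullet> g zs"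
      using s1 s2 by (simp add: energy_def distrib_left)
    moreover have "E * (pw x)\<^sup>2 = 1/2 * (E1 * (\<kappa>\<^sup>2 * (pw x)\<^sup>2)) + 1/2 * (E2 * (\<kappa>\<^sup>2 * (pw x)\<^sup>2))"
      by (simp add: E_def algebra_simps)
    moreover have "1/2 * (w x \<bullet> (Hs (lam x) *v w x)) + 1/2 * (w x \<bullet> (Hs ls *v w x)) + ls \<bullet> s x - lam x \<bullet> g zs
        = p x - R x"
      unfolding p_def R_def using energy_identity[OF ls, of x] by linarith
    ultimately show ?case using q1 q2 by linarith
  qed
  show ?thesis
  proof (rule bigo_absorb[OF c0 main energy_nonneg \<mu>_nonneg])
    have "(\<lambda>x. lam x \<bullet> s x) \<in> O[L](\<mu>)"
    proof (rule landau_o.bigI[of "CARD('m)"])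
      show "\<forall>\<^sub>F x in L. norm (lam x \<bullet> s x) \<le> real CARD('m) * norm (\<mu> x)"
        using iterate_facts by eventually_elim (auto simp: abs_mult)
    qed simp
    moreover have "(\<lambda>x. Lz x \<bullet> w x) \<in> O[L](\<lambda>x. \<mu> x * 1)"
      by (rule bigo_norm_inner[OF Lz_bigo bigo_norm_tendsto[OF w_tendsto]])
    moreover have "(\<lambda>x. (lam x - ls) \<bullet> (g (z x) + s x)) \<in> O[L](\<lambda>x. 1 * \<mu> x)"
      by (intro bigo_norm_inner residual_bigo bigo_norm_diff lam_bigo bigo_norm_tendsto[OF tendsto_const])
    ultimately show "p \<in> O[L](\<mu>)"
      unfolding p_def[abs_def] by (intro sum_in_bigo) simp_all
    have "(\<lambda>x. grad_remainder x \<bullet> w x) \<in> o[L](\<lambda>x. norm (w x) * norm (w x))"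
    proof (rule landau_o.big_small_trans)
      show "(\<lambda>x. norm (grad_remainder x) * norm (w x)) \<in> o[L](\<lambda>x. norm (w x) * norm (w x))"
        by (intro landau_o.small_big_mult grad_remainder_smallo) simp
      show "(\<lambda>x. grad_remainder x \<bullet> w x) \<in> O[L](\<lambda>x. norm (grad_remainder x) * norm (w x))"
        by (rule landau_o.bigI[of 1]) (auto simp: Cauchy_Schwarz_ineq2 abs_mult intro!: always_eventually)
    qed
    then have 1: "(\<lambda>x. grad_remainder x \<bullet> w x) \<in> o[L](\<lambda>x. energy x + \<mu> x)"
      using landau_o.small_big_trans[OF _ w_sq_bigo_energy] by (simp add: power2_eq_square)
    have 2: "(\<lambda>x. (lam x - ls) $ i * value_remainder i x) \<in> o[L](\<lambda>x. energy x + \<mu> x)" for i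
    proof -
      have "(\<lambda>x. (lam x - ls) $ i) \<in> O[L](\<lambda>_. 1)"
        by (intro bigo_vec_nth bigo_norm_diff lam_bigo bigo_norm_tendsto[OF tendsto_const])
      then have "(\<lambda>x. (lam x - ls) $ i * value_remainder i x) \<in> o[L](\<lambda>x. 1 * (norm (w x))\<^sup>2)"
        using value_remainder_smallo by (rule landau_o.big_small_mult)
      then show ?thesis
        using landau_o.small_big_trans[OF _ w_sq_bigo_energy] by simp
    qed
    have "R \<in> o[L](\<lambda>x. energy x + \<mu> x)"
      unfolding R_def[abs_def] by (intro sum_in_smallo(2) 1 big_sum_in_smallo 2)
    moreover have "(\<lambda>x. E * (pw x)\<^sup>2) \<in> o[L](\<lambda>x. energy x + \<mu> x)"
    proof -
      have "(\<lambda>x. E * (pw x)\<^sup>2) \<in> O[L](\<lambda>x. (pw x)\<^sup>2)"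
        by (rule landau_o.bigI[of "\<bar>E\<bar> + 1"]) (auto simp: abs_mult mult_right_mono intro!: always_eventually)
      then show ?thesis
        using active_linearization_sq_smallo unfolding pw_def[symmetric] by (rule landau_o.big_small_trans)
    qed
    ultimately show "(\<lambda>x. E * (pw x)\<^sup>2 - R x) \<in> o[L](\<lambda>x. energy x + \<mu> x)"
      by (intro sum_in_smallo(2))
  qed
qed

lemma energy_component_bigo:
  assumes "\<forall>\<^sub>F x in L. 0 \<le> f x \<and> f x \<le> energy x"
  shows "f \<in> O[L](\<mu>)"
proof (rule landau_o.big_trans[OF _ energy_bigo])
  show "f \<in> O[L](energy)"
    by (rule landau_o.bigI[of 1]) (use assms in \<open>auto elim!: eventually_mono\<close>)
qed

lemma s_active_bigo: "i \<in> B \<Longrightarrow> (\<lambda>x. s x $ i) \<in> O[L](\<mu>)"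
  by (rule energy_component_bigo)
    (use energy_bounds iterate_facts in \<open>eventually_elim, auto intro: less_imp_le\<close>)

lemma lam_inactive_bigo: "i \<notin> B \<Longrightarrow> (\<lambda>x. lam x $ i) \<in> O[L](\<mu>)"
  by (rule energy_component_bigo)
    (use energy_bounds iterate_facts in \<open>eventually_elim, auto intro: less_imp_le\<close>)

lemma w_sq_bigo: "(\<lambda>x. (norm (w x))\<^sup>2) \<in> O[L](\<mu>)"
  by (rule energy_component_bigo) (use energy_bounds in \<open>eventually_elim, auto\<close>)

text \<open>The energy gives only \<open>(norm w)\<^sup>2 = O(\<mu>)\<close>, since there the
  pairing with \<open>w\<close> meets active multiplier differences that are not small. The null
  space component is orthogonal to the active gradients, so these differences disappear; every
  remaining term is linear in \<open>norm v\<close>, and cancelling this factor gives the rate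
  \<mu>.\<close>

lemma w_bigo: "(\<lambda>x. norm (w x)) \<in> O[L](\<mu>)"
proof -
  obtain ls where ls: "ls \<in> multipliers \<phi> g zs" and lsN: "\<And>i. i \<notin> B \<Longrightarrow> ls $ i = 0"
    using strict_multiplier by metis
  obtain \<xi> where \<xi>: "\<xi> > 0"
    "\<forall>\<^sub>F x in L. \<forall>v. transpose As *v v = 0 \<longrightarrow> \<xi> * (norm v)\<^sup>2 \<le> v \<bullet> (Hs (lam x) *v v)"
    using near_Hs_coercive[OF Hs_lam_tendsto] by blast
  obtain \<kappa> and pr where \<kappa>: "\<kappa> > 0" and pr: "\<And>v. transpose As *v pr v = 0"
    "\<And>v. norm (v - pr v) \<le> \<kappa> * norm (transpose As *v v)"
    using null_projection by metis
  define pw where "pw x = norm (transpose As *v w x)" for x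
  define p where "p x = norm (Lz x) + (\<Sum>i\<in>-B. \<bar>lam x $ i\<bar> * norm (gr i zs)) + (norm (Hs (lam x)) + \<xi>) * (\<kappa> * pw x)" for x
  have main: "\<forall>\<^sub>F x in L. \<xi> * norm (w x) \<le> p x + norm (grad_remainder x)"
    using \<xi>(2)
  proof eventually_elim
    case (elim x)
    define v where "v = pr (w x)"
    have v0: "gr i zs \<bullet> v = 0" if "i \<in> B" for i
      using that transpose_active_nabla_mult[of g zs v i] by (simp add: v_def pr(1) column_nabla del: transpose_matrix_vector)
    have d: "norm (w x - v) \<le> \<kappa> * pw x" using pr(2)[of "w x"] by (simp only: v_def pw_def)
    \<comment> \<open>Active terms vanish with \<open>gr i zs \<bullet> v\<close>; for inactive ones
      \<open>ls\<close> is zero, which leaves \<open>lam x\<close>, of order \<mu>.\<close>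
    have "(\<Sum>i\<in>UNIV. (lam x - ls) $ i * (gr i zs \<bullet> v)) = (\<Sum>i\<in>-B. lam x $ i * (gr i zs \<bullet> v))"
      by (rule sum.mono_neutral_cong_right) (auto simp: v0 lsN)
    then have "v \<bullet> Lz x = v \<bullet> grad_remainder x + (\<Sum>i\<in>-B. lam x $ i * (gr i zs \<bullet> v)) + v \<bullet> (Hs (lam x) *v w x)"
      unfolding Lz_expansion[OF ls, of x] by (simp add: inner_add_right inner_sum_right inner_commute[of v])
    moreover have "v \<bullet> (Hs (lam x) *v w x) = v \<bullet> (Hs (lam x) *v v) + v \<bullet> (Hs (lam x) *v (w x - v))"
      by (simp add: matrix_vector_mult_diff_distrib inner_diff_right)
    ultimately have "\<xi> * (norm v)\<^sup>2 \<le> v \<bullet> Lz x - v \<bullet> grad_remainder x - (\<Sum>i\<in>-B. lam x $ i * (gr i zs \<bullet> v))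
        - v \<bullet> (Hs (lam x) *v (w x - v))"
      using elim pr(1)[of "w x"] unfolding v_def[symmetric] by fastforce
    also have "\<dots> \<le> norm v * norm (Lz x) + norm v * norm (grad_remainder x)
        + norm v * (\<Sum>i\<in>-B. \<bar>lam x $ i\<bar> * norm (gr i zs)) + norm v * (norm (Hs (lam x)) * (\<kappa> * pw x))"
    proof -
      have "\<bar>\<Sum>i\<in>-B. lam x $ i * (gr i zs \<bullet> v)\<bar> \<le> (\<Sum>i\<in>-B. \<bar>lam x $ i\<bar> * (norm (gr i zs) * norm v))"
        by (rule order_trans[OF sum_abs sum_mono]) (auto simp: abs_mult intro!: mult_left_mono Cauchy_Schwarz_ineq2)
      also have "\<dots> = norm v * (\<Sum>i\<in>-B. \<bar>lam x $ i\<bar> * norm (gr i zs))"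
        by (simp add: sum_distrib_left mult_ac)
      finally have 1: "\<bar>\<Sum>i\<in>-B. lam x $ i * (gr i zs \<bullet> v)\<bar> \<le> norm v * (\<Sum>i\<in>-B. \<bar>lam x $ i\<bar> * norm (gr i zs))" .
      have "\<bar>v \<bullet> (Hs (lam x) *v (w x - v))\<bar> \<le> norm v * norm (Hs (lam x) *v (w x - v))"
        by (rule Cauchy_Schwarz_ineq2)
      also have "\<dots> \<le> norm v * (norm (Hs (lam x)) * (\<kappa> * pw x))"
        by (intro mult_left_mono order_trans[OF norm_matrix_vector_mult_le] d) auto
      finally have 2: "\<bar>v \<bullet> (Hs (lam x) *v (w x - v))\<bar> \<le> norm v * (norm (Hs (lam x)) * (\<kappa> * pw x))" .
      show ?thesis
        using 1 2 Cauchy_Schwarz_ineq2[of v "Lz x"] Cauchy_Schwarz_ineq2[of v "grad_remainder x"] by linarith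
    qed
    finally have *: "norm v * (\<xi> * norm v) \<le> norm v * (norm (Lz x) + norm (grad_remainder x)
        + (\<Sum>i\<in>-B. \<bar>lam x $ i\<bar> * norm (gr i zs)) + norm (Hs (lam x)) * (\<kappa> * pw x))"
      by (simp add: power2_eq_square algebra_simps)
    have pos: "0 \<le> (\<Sum>i\<in>-B. \<bar>lam x $ i\<bar> * norm (gr i zs))" "0 \<le> norm (Hs (lam x)) * (\<kappa> * pw x)"
      using \<kappa> by (auto intro!: sum_nonneg mult_nonneg_nonneg simp: pw_def)
    have **: "\<xi> * norm v \<le> norm (Lz x) + norm (grad_remainder x)
        + (\<Sum>i\<in>-B. \<bar>lam x $ i\<bar> * norm (gr i zs)) + norm (Hs (lam x)) * (\<kappa> * pw x)"
    proof (cases "v = 0")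
      case True
      show ?thesis unfolding True using pos by simp
    next
      case False
      then show ?thesis using * by simp
    qed
    have "norm (w x) \<le> norm v + \<kappa> * pw x"
      using d norm_triangle_sub[of "w x" v] by linarith
    then have "\<xi> * norm (w x) \<le> \<xi> * (norm v + \<kappa> * pw x)"
      using \<xi>(1) by (intro mult_left_mono) auto
    then show ?case
      using ** by (simp add: p_def distrib_left distrib_right)
  qed
  \<comment> \<open>The second use of the linearization: the active slacks and
    \<open>(norm w)\<^sup>2\<close> are now known to be O(\<mu>).\<close>
  have pw: "pw \<in> O[L](\<mu>)"
    unfolding pw_def[abs_def] by (intro active_linearization_bigo s_active_bigo w_sq_bigo) auto
  show ?thesis
  proof (rule bigo_absorb[OF \<xi>(1) main])
    have "(\<lambda>x. \<Sum>i\<in>-B. \<bar>lam x $ i\<bar> * norm (gr i zs)) \<in> O[L](\<mu>)"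
    proof (rule big_sum_in_bigo)
      fix i assume "i \<in> -B"
      then have "(\<lambda>x. \<bar>lam x $ i\<bar> * norm (gr i zs)) \<in> O[L](\<lambda>x. \<mu> x * 1)"
        using lam_inactive_bigo[of i] by (intro landau_o.big.mult) auto
      then show "(\<lambda>x. \<bar>lam x $ i\<bar> * norm (gr i zs)) \<in> O[L](\<mu>)" by simp
    qed
    moreover have "(\<lambda>x. (norm (Hs (lam x)) + \<xi>) * (\<kappa> * pw x)) \<in> O[L](\<lambda>x. 1 * (1 * \<mu> x))"
      by (intro landau_o.big.mult pw sum_in_bigo(1) near_Hs_bigo[OF Hs_lam_tendsto]) auto
    ultimately show "p \<in> O[L](\<mu>)"
      unfolding p_def[abs_def] by (intro sum_in_bigo Lz_bigo) auto
    have "(\<lambda>x. norm (w x)) \<in> O[L](\<lambda>x. norm (w x) + \<mu> x)"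
      by (rule landau_o.bigI[of 1]) (use \<mu>_nonneg in \<open>auto elim!: eventually_mono\<close>)
    then show "(\<lambda>x. norm (grad_remainder x)) \<in> o[L](\<lambda>x. norm (w x) + \<mu> x)"
      by (rule landau_o.small_big_trans[OF grad_remainder_smallo])
  qed (auto simp: \<mu>_nonneg)
qed

section \<open>Componentwise sizes and the entries of D\<close>

lemma uniform_component_bounds:
  obtains K where "K > 0" "\<forall>\<^sub>F x in L. \<forall>i. \<bar>lam x $ i\<bar> \<le> K \<and> \<bar>s x $ i\<bar> \<le> K \<and>
    (i \<in> B \<longrightarrow> s x $ i \<le> K * \<mu> x) \<and> (i \<notin> B \<longrightarrow> lam x $ i \<le> K * \<mu> x)"
proof -
  obtain K1 where K1: "K1 > 0" "\<forall>\<^sub>F x in L. norm (energy x) \<le> K1 * norm (\<mu> x)"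
    using energy_bigo by (rule landau_o.bigE)
  obtain K2 where K2: "K2 > 0" "\<forall>\<^sub>F x in L. norm (norm (lam x)) \<le> K2 * norm (1 :: real)"
    using lam_bigo by (rule landau_o.bigE)
  obtain K3 where K3: "K3 > 0" "\<forall>\<^sub>F x in L. norm (norm (s x)) \<le> K3 * norm (1 :: real)"
    using s_bigo by (rule landau_o.bigE)
  show ?thesis
  proof (rule that[of "max K1 (max K2 K3)"])
    show "\<forall>\<^sub>F x in L. \<forall>i. \<bar>lam x $ i\<bar> \<le> max K1 (max K2 K3) \<and> \<bar>s x $ i\<bar> \<le> max K1 (max K2 K3) \<and>
      (i \<in> B \<longrightarrow> s x $ i \<le> max K1 (max K2 K3) * \<mu> x) \<and> (i \<notin> B \<longrightarrow> lam x $ i \<le> max K1 (max K2 K3) * \<mu> x)"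
      using K1(2) K2(2) K3(2) energy_bounds \<mu>_pos
    proof eventually_elim
      case (elim x)
      have "energy x \<le> K1 * \<mu> x" using elim by simp
      also have "\<dots> \<le> max K1 (max K2 K3) * \<mu> x" using elim by (intro mult_right_mono) auto
      finally have e: "energy x \<le> max K1 (max K2 K3) * \<mu> x" .
      show ?case
      proof (intro allI conjI impI)
        fix i
        show "\<bar>lam x $ i\<bar> \<le> max K1 (max K2 K3)" "\<bar>s x $ i\<bar> \<le> max K1 (max K2 K3)"
          using elim component_le_norm_cart[of "lam x" i] component_le_norm_cart[of "s x" i] by auto
        show "s x $ i \<le> max K1 (max K2 K3) * \<mu> x" if "i \<in> B"
          using elim that e by (meson order_trans)
        show "lam x $ i \<le> max K1 (max K2 K3) * \<mu> x" if "i \<notin> B"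
          using elim that e by (meson ComplI order_trans)
      qed
    qed
  qed (use K1 in simp)
qed

text \<open>Since \<open>s / lam = lam * s / lam\<^sup>2\<close>, the centrality bound \<gamma>
  \<mu> divided by the square of an upper bound on \<open>lam\<close>, namely \<open>K\<close> on B
  and \<open>K * \<mu>\<close> off B, gives the lower bounds. On B, \<open>s \<le> K * \<mu>\<close>
  and centrality force \<open>lam \<ge> \<gamma> / K\<close>, hence the upper bound.\<close>

lemma ratio_bounds:
  obtains c K where "c > 0" "K > 0"
    "\<forall>\<^sub>F x in L. \<forall>i\<in>B. c * \<mu> x \<le> s x $ i / lam x $ i \<and> s x $ i / lam x $ i \<le> K * \<mu> x"
    "\<forall>\<^sub>F x in L. \<forall>i\<in>-B. c / \<mu> x \<le> s x $ i / lam x $ i"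
proof -
  obtain K where K: "K > 0" and bd: "\<forall>\<^sub>F x in L. \<forall>i. \<bar>lam x $ i\<bar> \<le> K \<and> \<bar>s x $ i\<bar> \<le> K \<and>
    (i \<in> B \<longrightarrow> s x $ i \<le> K * \<mu> x) \<and> (i \<notin> B \<longrightarrow> lam x $ i \<le> K * \<mu> x)"
    using uniform_component_bounds by blast
  have lower: "\<gamma> * m / b\<^sup>2 \<le> si / li"
    if "0 < li" "li \<le> b" "\<gamma> * m \<le> li * si" "0 < m" for m b si li :: real
  proof -
    have "\<gamma> * m / b\<^sup>2 \<le> \<gamma> * m / li\<^sup>2"
      using that \<gamma> by (intro divide_left_mono power_mono mult_pos_pos) auto
    also have "\<dots> \<le> li * si / li\<^sup>2" using that by (intro divide_right_mono) auto
    also have "\<dots> = si / li" using that by (simp add: power2_eq_square)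
    finally show ?thesis .
  qed
  show ?thesis
  proof (rule that[of "\<gamma> / K\<^sup>2" "K\<^sup>2 / \<gamma>"])
    show "\<forall>\<^sub>F x in L. \<forall>i\<in>B. \<gamma> / K\<^sup>2 * \<mu> x \<le> s x $ i / lam x $ i \<and> s x $ i / lam x $ i \<le> K\<^sup>2 / \<gamma> * \<mu> x"
      using bd iterate_facts
    proof eventually_elim
      case (elim x)
      show ?case
      proof (intro ballI conjI)
        fix i assume i: "i \<in> B"
        have e: "0 < lam x $ i" "0 < s x $ i" "lam x $ i \<le> K" "s x $ i \<le> K * \<mu> x" "0 < \<mu> x"
          "\<gamma> * \<mu> x \<le> lam x $ i * s x $ i"
          using elim i abs_le_D1 by (auto dest: spec[of _ i])
        show "\<gamma> / K\<^sup>2 * \<mu> x \<le> s x $ i / lam x $ i"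
          using lower[OF e(1,3,6,5)] by simp
        have "\<gamma> * s x $ i \<le> \<gamma> * (K * \<mu> x)" using e \<gamma> by (intro mult_left_mono) auto
        also have "\<dots> = K * (\<gamma> * \<mu> x)" by simp
        also have "\<dots> \<le> K * (lam x $ i * (K * \<mu> x))"
          using e K by (intro mult_left_mono order_trans[OF e(6)]) auto
        finally show "s x $ i / lam x $ i \<le> K\<^sup>2 / \<gamma> * \<mu> x"
          using e \<gamma> by (simp add: field_simps power2_eq_square)
      qed
    qed
    show "\<forall>\<^sub>F x in L. \<forall>i\<in>-B. \<gamma> / K\<^sup>2 / \<mu> x \<le> s x $ i / lam x $ i"
      using bd iterate_facts
    proof eventually_elim
      case (elim x)
      show ?case
      proof
        fix i assume i: "i \<in> -B"
        have e: "0 < lam x $ i" "lam x $ i \<le> K * \<mu> x" "0 < \<mu> x" "\<gamma> * \<mu> x \<le> lam x $ i * s x $ i"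
          using elim i by (auto dest: spec[of _ i])
        show "\<gamma> / K\<^sup>2 / \<mu> x \<le> s x $ i / lam x $ i"
          using lower[OF e(1,2,4,3)] e(3) by (simp add: power2_eq_square field_simps)
      qed
    qed
  qed (use K \<gamma> in auto)
qed

text \<open>Centrality with bounded slacks gives \<open>lam \<ge> \<gamma> * \<mu> / K\<close> for
  every index, so division by \<open>lam\<close> costs at most one of the two factors \<mu> in
  \<open>t\<close>.\<close>

lemma t_over_lam_bigo: "(\<lambda>x. t x $ i / lam x $ i) \<in> O[L](\<mu>)"
proof -
  obtain K where K: "K > 0" and bd: "\<forall>\<^sub>F x in L. \<forall>i. \<bar>lam x $ i\<bar> \<le> K \<and> \<bar>s x $ i\<bar> \<le> K \<and>
    (i \<in> B \<longrightarrow> s x $ i \<le> K * \<mu> x) \<and> (i \<notin> B \<longrightarrow> lam x $ i \<le> K * \<mu> x)"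
    using uniform_component_bounds by blast
  show ?thesis
  proof (rule landau_o.bigI[of "Ct * K / \<gamma>"])
    show "\<forall>\<^sub>F x in L. norm (t x $ i / lam x $ i) \<le> Ct * K / \<gamma> * norm (\<mu> x)"
      using bd iterate_facts t
    proof eventually_elim
      case (elim x)
      then have e: "0 < lam x $ i" "s x $ i \<le> K" "0 < \<mu> x" "\<gamma> * \<mu> x \<le> lam x $ i * s x $ i"
        "norm (t x) \<le> Ct * (\<mu> x)\<^sup>2"
        by (auto dest: spec[of _ i] abs_le_D1)
      have "\<bar>t x $ i\<bar> \<le> Ct * (\<mu> x)\<^sup>2" using component_le_norm_cart[of "t x" i] e(5) by linarith
      then have "\<gamma> * \<bar>t x $ i\<bar> \<le> \<gamma> * (Ct * (\<mu> x)\<^sup>2)" using \<gamma> by (intro mult_left_mono) auto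
      also have "\<dots> = Ct * \<mu> x * (\<gamma> * \<mu> x)" by (simp add: power2_eq_square)
      also have "\<dots> \<le> Ct * \<mu> x * (lam x $ i * K)"
        using e Ct by (intro mult_left_mono order_trans[OF e(4)]) auto
      finally show ?case using e \<gamma> by (simp add: abs_divide field_simps)
    qed
  qed (use Ct K \<gamma> in simp)
qed

lemma g_active_bigo:
  assumes "i \<in> B"
  shows "(\<lambda>x. g (z x) $ i) \<in> O[L](\<mu>)"
  using sum_in_bigo(2)[OF bigo_vec_nth[OF residual_bigo, of i] s_active_bigo[OF assms]] by simp

text \<open>Here the linear rate of \<open>w\<close> pays off: \<open>condensed_system_bound\<close>
  needs matrices within O(\<mu>) of their limit, whereas the energy estimate alone would only give
  O(sqrt \<mu>).\<close>

lemma nabla_bigo: "(\<lambda>x. norm (nabla g (z x) - nabla g zs)) \<in> O[L](\<mu>)"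
proof (intro bigo_norm_vecI)
  fix j i
  have "(\<lambda>x. norm (hs i *v w x)) \<in> O[L](\<lambda>x. 1 * \<mu> x)"
    by (intro bigo_norm_matrix_vector_mult w_bigo bigo_norm_tendsto[OF tendsto_const])
  moreover have "(\<lambda>x. norm (gr i (z x) - gr i zs - hs i *v w x)) \<in> O[L](\<mu>)"
    by (rule landau_o.big_trans[OF landau_o.small_imp_big[OF grad_taylor_smallo[OF g z]] w_bigo])
  ultimately have "(\<lambda>x. norm ((gr i (z x) - gr i zs - hs i *v w x) + hs i *v w x)) \<in> O[L](\<mu>)"
    by (intro bigo_norm_add) auto
  then have "(\<lambda>x. norm ((gr i (z x) - gr i zs) $ j)) \<in> O[L](\<mu>)"
    by (intro bigo_norm_nth) simp
  then show "(\<lambda>x. norm ((nabla g (z x) - nabla g zs) $ j $ i)) \<in> O[L](\<mu>)"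
    by (simp add: nabla_def)
qed

lemma near_nabla_bigo:
  assumes "(\<lambda>x. norm (A x - nabla g (z x))) \<in> O[L](\<mu>)"
  shows "(\<lambda>x. norm (A x - nabla g zs)) \<in> O[L](\<mu>)" "(\<lambda>x. norm (A x)) \<in> O[L](\<lambda>_. 1)"
proof -
  show 1: "(\<lambda>x. norm (A x - nabla g zs)) \<in> O[L](\<mu>)"
    using bigo_norm_add[OF assms nabla_bigo] by simp
  show "(\<lambda>x. norm (A x)) \<in> O[L](\<lambda>_. 1)"
    using bigo_norm_add[OF landau_o.big_trans[OF 1 \<mu>_bigo] bigo_norm_tendsto[OF tendsto_const[of "nabla g zs"]]]
    by simp
qed

section \<open>The linear system along the filter\<close>

lemma inverse_inactive_bigo:
  assumes c: "c > 0" and e: "\<forall>\<^sub>F x in L. \<forall>i\<in>-B. c / \<mu> x \<le> e x $ i" and i: "i \<notin> B"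
  shows "(\<lambda>x. inverse (e x $ i)) \<in> O[L](\<mu>)"
proof (rule landau_o.bigI[of "1 / c"])
  show "\<forall>\<^sub>F x in L. norm (inverse (e x $ i)) \<le> 1 / c * norm (\<mu> x)"
    using e \<mu>_pos
  proof eventually_elim
    case (elim x)
    then have 1: "c / \<mu> x \<le> e x $ i" using i by simp
    have 2: "0 < c / \<mu> x" using c elim by simp
    then have "0 < e x $ i" using 1 by linarith
    then show ?case
      using le_imp_inverse_le[OF 1 2] elim c by simp
  qed
qed (use c in simp)

lemma product_with_inner_bigo:
  assumes A: "(\<lambda>x. norm (A x)) \<in> O[L](\<lambda>_. 1)"
  shows "(\<lambda>x. (transpose (A x) *v v x) $ i) \<in> O[L](\<lambda>x. norm (v x))"
proof -
  have "(\<lambda>x. norm (transpose (A x) *v v x)) \<in> O[L](\<lambda>x. 1 * norm (v x))"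
    by (rule bigo_norm_matrix_vector_mult) (simp_all add: norm_transpose A)
  then show ?thesis by (intro bigo_vec_nth) simp
qed

text \<open>The inactive unknowns are eliminated first: dividing by \<open>e\<close> of order at
  least 1/\<mu> gives them as O(\<theta> + \<mu> norm v), even with data \<open>b\<close> as large
  as \<theta> / \<mu>, and they are moved into the right-hand side \<open>a2\<close>. The active
  part then falls under \<open>condensed_system_bound\<close>, and the feedback
  \<open>\<mu> * norm v\<close> is absorbed.\<close>

lemma system_bound:
  assumes H: "((\<lambda>x. H x - Hz x) \<longlongrightarrow> 0) L"
    and A: "(\<lambda>x. norm (A x - nabla g (z x))) \<in> O[L](\<mu>)"
    and c: "c > 0" and K: "K > 0"
    and eB: "\<forall>\<^sub>F x in L. \<forall>i\<in>B. c * \<mu> x \<le> e x $ i \<and> e x $ i \<le> K * \<mu> x"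
    and eN: "\<forall>\<^sub>F x in L. \<forall>i\<in>-B. c / \<mu> x \<le> e x $ i"
    and eq1: "\<forall>\<^sub>F x in L. H x *v v x + A x *v y x = a x"
    and eq2: "\<forall>\<^sub>F x in L. \<forall>i. e x $ i * y x $ i = (transpose (A x) *v v x) $ i + b x $ i"
    and \<theta>: "\<forall>\<^sub>F x in L. 0 \<le> \<theta> x"
    and a: "(\<lambda>x. norm (a x)) \<in> O[L](\<theta>)"
    and bB: "\<And>i. i \<in> B \<Longrightarrow> (\<lambda>x. b x $ i) \<in> O[L](\<theta>)"
    and bN: "\<And>i. i \<notin> B \<Longrightarrow> (\<lambda>x. b x $ i) \<in> O[L](\<lambda>x. \<theta> x / \<mu> x)"
  shows "(\<lambda>x. norm (v x)) \<in> O[L](\<theta>)"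
    and "\<And>i. i \<in> B \<Longrightarrow> (\<lambda>x. y x $ i) \<in> O[L](\<lambda>x. \<theta> x / \<mu> x)"
    and "\<And>i. i \<notin> B \<Longrightarrow> (\<lambda>x. y x $ i) \<in> O[L](\<theta>)"
proof -
  note A' = near_nabla_bigo[OF A]
  have H': "((\<lambda>x. H x - Hs (lam0 x)) \<longlongrightarrow> 0) L"
    using tendsto_add[OF H Hz_tendsto] by simp
  define AB where "AB x = (\<chi> j i. if i \<in> B then A x $ j $ i else 0)" for x
  define yB where "yB x = (\<chi> i. if i \<in> B then y x $ i else 0)" for x
  define yN where "yN x = (\<chi> i. if i \<in> B then 0 else y x $ i)" for x
  define b2 where "b2 x = (\<chi> i. if i \<in> B then b x $ i else 0)" for x
  \<comment> \<open>Off B the truncated equations read 0 = 0, so any diagonal entry is admissible;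
    \<open>c * \<mu>\<close> meets both bounds once the upper constant is
    \<open>max K c\<close>.\<close>
  define e2 where "e2 x = (\<chi> i. if i \<in> B then e x $ i else c * \<mu> x)" for x
  define a2 where "a2 x = a x - A x *v yN x" for x
  obtain \<xi> where \<xi>: "\<xi> > 0"
    "\<forall>\<^sub>F x in L. \<forall>v. transpose As *v v = 0 \<longrightarrow> \<xi> * (norm v)\<^sup>2 \<le> v \<bullet> (H x *v v)"
    using near_Hs_coercive[OF H'] by blast
  obtain M1 where M1: "M1 > 0" "\<forall>\<^sub>F x in L. norm (norm (H x)) \<le> M1 * norm (1 :: real)"
    using near_Hs_bigo[OF H'] by (rule landau_o.bigE)
  have "(\<lambda>x. norm (AB x - As)) \<in> O[L](\<mu>)"
  proof (intro bigo_norm_vecI)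
    fix j i
    show "(\<lambda>x. norm ((AB x - As) $ j $ i)) \<in> O[L](\<mu>)"
      using bigo_norm_nth[OF bigo_norm_nth[OF A'(1)], of j i]
      by (cases "i \<in> B") (simp_all add: AB_def active_nabla_def)
  qed
  then obtain M2 where M2: "M2 > 0" "\<forall>\<^sub>F x in L. norm (norm (AB x - As)) \<le> M2 * norm (\<mu> x)"
    by (rule landau_o.bigE)
  obtain \<kappa> where \<kappa>: "\<kappa> > 0" "\<And>w. \<exists>v. transpose As *v v = 0 \<and>
      norm (w - v) \<le> \<kappa> * norm (transpose As *v w)"
    using active_svd_projection[OF svd] by blast
  define M where "M = max M1 M2"
  have M: "M > 0" using M1 by (simp add: M_def)
  have Kc: "max K c > 0" using c by simp
  obtain \<mu>0 K' where \<mu>0: "\<mu>0 > 0" and K': "K' > 0" and core: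
    "\<And>H A e w y a b \<mu> \<theta>. \<lbrakk>0 < \<mu>; \<mu> \<le> \<mu>0; 0 \<le> \<theta>; norm H \<le> M;
       \<And>v. transpose As *v v = 0 \<Longrightarrow> \<xi> * (norm v)\<^sup>2 \<le> v \<bullet> (H *v v);
       norm (A - As) \<le> M * \<mu>; \<And>i. c * \<mu> \<le> e $ i; \<And>i. e $ i \<le> max K c * \<mu>;
       H *v w + A *v y = a; \<And>i. e $ i * y $ i = (transpose A *v w) $ i + b $ i;
       norm a \<le> \<theta>; norm b \<le> \<theta>\<rbrakk> \<Longrightarrow> norm w \<le> K' * \<theta> \<and> norm y \<le> K' * \<theta> / \<mu>"
    using condensed_system_bound[OF \<kappa>(2,1) \<xi>(1) M c Kc] by metis
  have "\<forall>\<^sub>F x in L. \<mu> x < \<mu>0" using order_tendstoD(2)[OF \<mu>_0 \<mu>0] .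
  then have bound: "\<forall>\<^sub>F x in L. norm (v x) \<le> K' * (norm (a2 x) + norm (b2 x)) \<and>
      norm (yB x) \<le> K' * (norm (a2 x) + norm (b2 x)) / \<mu> x"
    using \<xi>(2) M1(2) M2(2) \<mu>_pos eB eq1 eq2
  proof eventually_elim
    case (elim x)
    have y: "y x = yB x + yN x" by (simp add: vec_eq_iff yB_def yN_def)
    have AyB: "AB x *v yB x = A x *v yB x"
      by (auto simp: vec_eq_iff AB_def yB_def matrix_vector_mult_def intro!: sum.cong)
    show ?case
    proof (rule core)
      show "0 < \<mu> x" "\<mu> x \<le> \<mu>0" "norm (H x) \<le> M"
        using elim by (auto simp: M_def)
      show "\<xi> * (norm v)\<^sup>2 \<le> v \<bullet> (H x *v v)" if "transpose As *v v = 0" for v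
        using elim that by blast
      have "norm (AB x - As) \<le> M2 * \<mu> x" using elim by simp
      also have "\<dots> \<le> M * \<mu> x" using elim by (intro mult_right_mono) (auto simp: M_def)
      finally show "norm (AB x - As) \<le> M * \<mu> x" .
      fix i
      have "K * \<mu> x \<le> max K c * \<mu> x" "c * \<mu> x \<le> max K c * \<mu> x"
        using elim by (auto intro!: mult_right_mono)
      then show "c * \<mu> x \<le> e2 x $ i" "e2 x $ i \<le> max K c * \<mu> x"
        using elim by (auto simp: e2_def intro: order_trans)
      show "H x *v v x + AB x *v yB x = a2 x"
        using elim unfolding AyB a2_def y by (simp add: matrix_vector_right_distrib algebra_simps)
      show "e2 x $ i * yB x $ i = (transpose (AB x) *v v x) $ i + b2 x $ i"
      proof (cases "i \<in> B")
        case True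
        then have "(transpose (AB x) *v v x) $ i = (transpose (A x) *v v x) $ i"
          by (simp add: AB_def transpose_def matrix_vector_mult_def del: transpose_matrix_vector)
        then show ?thesis using elim True by (simp add: e2_def yB_def b2_def del: transpose_matrix_vector)
      next
        case False
        then show ?thesis
          by (simp add: AB_def transpose_def matrix_vector_mult_def yB_def b2_def del: transpose_matrix_vector)
      qed
    qed auto
  qed
  have Av: "(\<lambda>x. (transpose (A x) *v v x) $ i) \<in> O[L](\<lambda>x. norm (v x))" for i
    by (rule product_with_inner_bigo[OF A'(2)])
  have pos: "\<forall>\<^sub>F x in L. 0 \<le> \<theta> x + \<mu> x * norm (v x)"
    using \<theta> \<mu>_nonneg by eventually_elim auto
  have \<theta>O: "\<theta> \<in> O[L](\<lambda>x. \<theta> x + \<mu> x * norm (v x))"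
    by (rule landau_o.bigI[of 1]) (use \<theta> \<mu>_nonneg in \<open>simp, eventually_elim, auto\<close>)
  have yNO: "(\<lambda>x. y x $ i) \<in> O[L](\<lambda>x. \<theta> x + \<mu> x * norm (v x))" if i: "i \<notin> B" for i
  proof -
    have "(\<lambda>x. (transpose (A x) *v v x) $ i) \<in> O[L](\<lambda>x. norm (v x) + \<theta> x / \<mu> x)"
      by (rule landau_o.big_trans[OF Av], rule landau_o.bigI[of 1])
        (use \<theta> \<mu>_nonneg in \<open>simp, eventually_elim, auto\<close>)
    moreover have "(\<lambda>x. b x $ i) \<in> O[L](\<lambda>x. norm (v x) + \<theta> x / \<mu> x)"
      by (rule landau_o.big_trans[OF bN[OF i]], rule landau_o.bigI[of 1])
        (use \<theta> \<mu>_nonneg in \<open>simp, eventually_elim, auto\<close>)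
    ultimately have "(\<lambda>x. (transpose (A x) *v v x) $ i + b x $ i) \<in> O[L](\<lambda>x. norm (v x) + \<theta> x / \<mu> x)"
      by (rule sum_in_bigo)
    with inverse_inactive_bigo[OF c eN i]
    have "(\<lambda>x. inverse (e x $ i) * ((transpose (A x) *v v x) $ i + b x $ i)) \<in> O[L](\<lambda>x. \<theta> x + \<mu> x * norm (v x))"
      by (rule bigo_mult_eventually_eq) (use \<mu>_pos in \<open>eventually_elim, simp add: field_simps\<close>)
    moreover have "\<forall>\<^sub>F x in L. y x $ i = inverse (e x $ i) * ((transpose (A x) *v v x) $ i + b x $ i)"
      using eN eq2 \<mu>_pos
    proof eventually_elim
      case (elim x)
      have "0 < c / \<mu> x" using elim c by simp
      also have "\<dots> \<le> e x $ i" using elim i by simp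
      finally show ?case using elim by (simp add: field_simps flip: elim(2) del: transpose_matrix_vector)
    qed
    ultimately show ?thesis using landau_o.big.in_cong by fastforce
  qed
  have yN: "(\<lambda>x. norm (yN x)) \<in> O[L](\<lambda>x. \<theta> x + \<mu> x * norm (v x))"
  proof (rule bigo_norm_vecI)
    show "(\<lambda>x. norm (yN x $ i)) \<in> O[L](\<lambda>x. \<theta> x + \<mu> x * norm (v x))" for i
      using yNO[of i] by (cases "i \<in> B") (simp_all add: yN_def)
  qed
  have "(\<lambda>x. norm (A x *v yN x)) \<in> O[L](\<lambda>x. 1 * (\<theta> x + \<mu> x * norm (v x)))"
    by (rule bigo_norm_matrix_vector_mult[OF A'(2) yN])
  then have a2: "(\<lambda>x. norm (a2 x)) \<in> O[L](\<lambda>x. \<theta> x + \<mu> x * norm (v x))"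
    unfolding a2_def by (intro bigo_norm_diff landau_o.big_trans[OF a \<theta>O]) simp
  have b2: "(\<lambda>x. norm (b2 x)) \<in> O[L](\<theta>)"
  proof (rule bigo_norm_vecI)
    show "(\<lambda>x. norm (b2 x $ i)) \<in> O[L](\<theta>)" for i
      using bB[of i] by (cases "i \<in> B") (simp_all add: b2_def)
  qed
  obtain K2 where K2: "K2 > 0" "\<forall>\<^sub>F x in L. norm (norm (a2 x) + norm (b2 x)) \<le> K2 * norm (\<theta> x + \<mu> x * norm (v x))"
    using sum_in_bigo(1)[OF a2 landau_o.big_trans[OF b2 \<theta>O]] by (rule landau_o.bigE)
  show v: "(\<lambda>x. norm (v x)) \<in> O[L](\<theta>)"
  proof (rule bigo_absorb[of 1])
    show "\<forall>\<^sub>F x in L. 1 * norm (v x) \<le> K' * K2 * \<theta> x + K' * K2 * (\<mu> x * norm (v x))"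
      using bound K2(2) pos
    proof eventually_elim
      case (elim x)
      then have "norm (a2 x) + norm (b2 x) \<le> K2 * (\<theta> x + \<mu> x * norm (v x))" by simp
      then have "K' * (norm (a2 x) + norm (b2 x)) \<le> K' * (K2 * (\<theta> x + \<mu> x * norm (v x)))"
        using K' by (intro mult_left_mono) auto
      then show ?case using elim by (simp add: algebra_simps)
    qed
    show "(\<lambda>x. K' * K2 * \<theta> x) \<in> O[L](\<theta>)" by simp
    have "\<mu> \<in> o[L](\<lambda>_. 1)" using \<mu>_0 by (intro smalloI_tendsto) auto
    then have "(\<lambda>x. \<mu> x * norm (v x)) \<in> o[L](\<lambda>x. 1 * norm (v x))"
      by (rule landau_o.small_big_mult) simp
    then have "(\<lambda>x. K' * K2 * (\<mu> x * norm (v x))) \<in> o[L](\<lambda>x. norm (v x))"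
      using K' K2 by simp
    moreover have "(\<lambda>x. norm (v x)) \<in> O[L](\<lambda>x. norm (v x) + \<theta> x)"
      by (rule landau_o.bigI[of 1]) (use \<theta> in \<open>simp, eventually_elim, auto\<close>)
    ultimately show "(\<lambda>x. K' * K2 * (\<mu> x * norm (v x))) \<in> o[L](\<lambda>x. norm (v x) + \<theta> x)"
      by (rule landau_o.small_big_trans)
  qed (use \<theta> in auto)
  have "(\<lambda>x. \<mu> x * norm (v x)) \<in> O[L](\<lambda>x. 1 * \<theta> x)"
    by (rule landau_o.big.mult[OF \<mu>_bigo v])
  then have \<theta>': "(\<lambda>x. \<theta> x + \<mu> x * norm (v x)) \<in> O[L](\<theta>)"
    by (intro sum_in_bigo) auto
  show "(\<lambda>x. y x $ i) \<in> O[L](\<theta>)" if "i \<notin> B" for i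
    by (rule landau_o.big_trans[OF yNO[OF that] \<theta>'])
  fix i assume i: "i \<in> B"
  have "(\<lambda>x. norm (yB x)) \<in> O[L](\<lambda>x. \<theta> x / \<mu> x)"
  proof (rule bigo_norm_dominated)
    show "\<forall>\<^sub>F x in L. norm (yB x) \<le> K' * (norm (a2 x) + norm (b2 x)) / \<mu> x"
      using bound by eventually_elim auto
    show "(\<lambda>x. K' * (norm (a2 x) + norm (b2 x)) / \<mu> x) \<in> O[L](\<lambda>x. \<theta> x / \<mu> x)"
      unfolding divide_inverse
      by (intro landau_o.big.mult landau_o.big_refl)
        (use K' sum_in_bigo(1)[OF landau_o.big_trans[OF a2 \<theta>'] b2] in simp)
  qed
  from bigo_vec_nth[OF this, of i] show "(\<lambda>x. y x $ i) \<in> O[L](\<lambda>x. \<theta> x / \<mu> x)"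
    using i by (simp add: yB_def)
qed

lemma step_bound:
  assumes H: "((\<lambda>x. H x - Hz x) \<longlongrightarrow> 0) L"
    and A: "(\<lambda>x. norm (A x - nabla g (z x))) \<in> O[L](\<mu>)"
    and c: "c > 0" and K: "K > 0"
    and eB: "\<forall>\<^sub>F x in L. \<forall>i\<in>B. c * \<mu> x \<le> e x $ i \<and> e x $ i \<le> K * \<mu> x"
    and eN: "\<forall>\<^sub>F x in L. \<forall>i\<in>-B. c / \<mu> x \<le> e x $ i"
    and eq1: "\<forall>\<^sub>F x in L. H x *v v x + A x *v y x = a x"
    and eq2: "\<forall>\<^sub>F x in L. \<forall>i. e x $ i * y x $ i = (transpose (A x) *v v x) $ i + (gc x $ i - t x $ i / lam x $ i)"
    and a: "(\<lambda>x. norm (a x)) \<in> O[L](\<mu>)"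
    and gc: "(\<lambda>x. norm (gc x - g (z x))) \<in> O[L](\<mu>)"
  shows "(\<lambda>x. norm (v x)) \<in> O[L](\<mu>)" and "(\<lambda>x. norm (y x)) \<in> O[L](\<lambda>_. 1)"
    and "\<And>i. i \<notin> B \<Longrightarrow> (\<lambda>x. y x $ i) \<in> O[L](\<mu>)"
proof -
  define b where "b x = (\<chi> i. gc x $ i - t x $ i / lam x $ i)" for x
  have eq2': "\<forall>\<^sub>F x in L. \<forall>i. e x $ i * y x $ i = (transpose (A x) *v v x) $ i + b x $ i"
    using eq2 by (simp add: b_def)
  have one: "\<forall>\<^sub>F x in L. \<mu> x / \<mu> x = 1" using \<mu>_pos by eventually_elim auto
  have \<mu>\<mu>: "O[L](\<lambda>x. \<mu> x / \<mu> x) = O[L](\<lambda>_. 1)" by (rule landau_o.big.cong[OF one])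
  have gc': "(\<lambda>x. gc x $ i - g (z x) $ i) \<in> O[L](\<mu>)" for i
    using bigo_vec_nth[OF gc, of i] by simp
  have bB: "(\<lambda>x. b x $ i) \<in> O[L](\<mu>)" if "i \<in> B" for i
    using sum_in_bigo(2)[OF sum_in_bigo(1)[OF gc'[of i] g_active_bigo[OF that]] t_over_lam_bigo[of i]]
    by (simp add: b_def)
  have "(\<lambda>x. b x $ i) \<in> O[L](\<lambda>_. 1)" for i
    using sum_in_bigo(2)[OF sum_in_bigo(1)[OF landau_o.big_trans[OF gc'[of i] \<mu>_bigo] bigo_vec_nth[OF g_bigo, of i]]
        landau_o.big_trans[OF t_over_lam_bigo[of i] \<mu>_bigo]]
    by (simp add: b_def)
  then have bN: "(\<lambda>x. b x $ i) \<in> O[L](\<lambda>x. \<mu> x / \<mu> x)" for i unfolding \<mu>\<mu> .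
  note sb = system_bound[OF H A c K eB eN eq1 eq2' \<mu>_nonneg a bB bN]
  show "(\<lambda>x. norm (v x)) \<in> O[L](\<mu>)" by (rule sb(1))
  show N: "(\<lambda>x. y x $ i) \<in> O[L](\<mu>)" if "i \<notin> B" for i by (rule sb(3)) (simp_all add: that)
  show "(\<lambda>x. norm (y x)) \<in> O[L](\<lambda>_. 1)"
  proof (rule bigo_norm_vecI)
    fix i
    have "(\<lambda>x. y x $ i) \<in> O[L](\<lambda>_. 1)"
    proof (cases "i \<in> B")
      case True
      have "(\<lambda>x. y x $ i) \<in> O[L](\<lambda>x. \<mu> x / \<mu> x)" by (rule sb(2)) (simp_all add: True)
      then show ?thesis unfolding \<mu>\<mu> .
    next
      case False
      then show ?thesis using landau_o.big_trans[OF N \<mu>_bigo] by simp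
    qed
    then show "(\<lambda>x. norm (y x $ i)) \<in> O[L](\<lambda>_. 1)" by simp
  qed
qed

end

section \<open>Exact and computed steps\<close>

lemma diagm_mult: "diagm d *v v = (\<chi> i. d $ i * v $ i)"
  by (simp add: vec_eq_iff diagm_def matrix_vector_mult_def if_distrib[of "\<lambda>x. x * _"] cong: if_cong)

text \<open>Elimination of \<open>ds\<close> from the last two block rows, followed by division by
  \<open>lam\<close>.\<close>

lemma exact_step_condensed:
  assumes "exact_step \<phi> g z lam s t dz dlam ds" and lam: "lam $ i \<noteq> 0"
  shows "s $ i / lam $ i * dlam $ i = (transpose (nabla g z) *v dz) $ i + (g z $ i - t $ i / lam $ i)"
    and "ds $ i = - (g z $ i) - s $ i - (transpose (nabla g z) *v dz) $ i"
proof -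
  have "(transpose (nabla g z) *v dz + ds) $ i = (- (g z + s)) $ i"
    and "(diagm s *v dlam + diagm lam *v ds) $ i = (- (diagm s *v (diagm lam *v (\<chi> i. 1)) + t)) $ i"
    using assms(1) by (auto simp: exact_step_def)
  then have 1: "ds $ i = - (g z $ i) - s $ i - (transpose (nabla g z) *v dz) $ i"
    and 2: "s $ i * dlam $ i + lam $ i * ds $ i = - (s $ i * lam $ i + t $ i)"
    by (simp_all add: diagm_mult del: transpose_matrix_vector)
  show "ds $ i = - (g z $ i) - s $ i - (transpose (nabla g z) *v dz) $ i" by fact
  have "s $ i * dlam $ i = - (s $ i * lam $ i + t $ i) - lam $ i * ds $ i" using 2 by linarith
  also have "\<dots> = lam $ i * ((transpose (nabla g z) *v dz) $ i + (g z $ i - t $ i / lam $ i))"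
    unfolding 1 using lam by (simp add: field_simps del: transpose_matrix_vector)
  finally have 3: "s $ i * dlam $ i = lam $ i * ((transpose (nabla g z) *v dz) $ i + (g z $ i - t $ i / lam $ i))" .
  show "s $ i / lam $ i * dlam $ i = (transpose (nabla g z) *v dz) $ i + (g z $ i - t $ i / lam $ i)"
    unfolding times_divide_eq_left 3 by (rule nonzero_mult_div_cancel_left[OF lam])
qed

text \<open>Undoes the condensation: the terms containing \<open>A ** diagm dinv\<close> are
  collected into one multiplier vector. In this form \<open>Fhat\<close> merely perturbs the Hessian
  block, and the system has the shape of the exact one.\<close>

lemma computed_dz_split:
  assumes "computed_dz \<phi> g z lam t A c dinv Fbar fbar Fhat fhat dz"
  shows "(Lagr_zz \<phi> g z lam + Fbar + Fhat) *v dz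
    + A *v (\<chi> i. dinv $ i * ((c $ i - t $ i / lam $ i) + (transpose A *v dz) $ i)) = - Lagr_z \<phi> g z lam - fbar + fhat"
proof -
  have eq: "(\<chi> i. dinv $ i * ((c $ i - t $ i / lam $ i) + (transpose A *v dz) $ i))
      = diagm dinv *v (c - (\<chi> i. t $ i / lam $ i)) + diagm dinv *v (transpose A *v dz)"
    by (simp add: diagm_mult vec_eq_iff distrib_left del: transpose_matrix_vector)
  show ?thesis
    using assms unfolding computed_dz_def eq
    by (simp add: matrix_vector_mult_add_rdistrib matrix_vector_right_distrib algebra_simps
        flip: matrix_vector_mul_assoc del: transpose_matrix_vector)
qed

text \<open>Primes mark computed quantities. The arithmetic itself, given by \<open>u\<close>,
  \<open>FP\<close> and \<open>fl\<close>, changes with the iterate.\<close>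

locale nlp_computed_steps = nlp_iterates \<phi> g zs C \<gamma> Ct r P \<sigma> Q L z lam lam0 s t \<mu>
  for \<phi> :: "real ^ 'n \<Rightarrow> real" and g :: "real ^ 'n \<Rightarrow> real ^ 'm" and zs :: "real ^ 'n"
    and C \<gamma> Ct :: real
    and r :: nat and P :: "nat \<Rightarrow> real ^ 'n" and \<sigma> :: "nat \<Rightarrow> real" and Q :: "nat \<Rightarrow> 'm \<Rightarrow> real"
    and L :: "'x filter" and z :: "'x \<Rightarrow> real ^ 'n" and lam lam0 s t :: "'x \<Rightarrow> real ^ 'm"
    and \<mu> :: "'x \<Rightarrow> real" +
  fixes K :: real and u :: "'x \<Rightarrow> real" and FP :: "'x \<Rightarrow> real set"
    and fl :: "'x \<Rightarrow> fop \<Rightarrow> real \<Rightarrow> real \<Rightarrow> real"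
    and dz :: "'x \<Rightarrow> real ^ 'n" and dlam ds :: "'x \<Rightarrow> real ^ 'm"
    and Fbar :: "'x \<Rightarrow> real ^ 'n ^ 'n" and fbar :: "'x \<Rightarrow> real ^ 'n" and F :: "'x \<Rightarrow> real ^ 'm ^ 'n"
    and f G :: "'x \<Rightarrow> real ^ 'm" and Fhat :: "'x \<Rightarrow> real ^ 'n ^ 'n" and fhat :: "'x \<Rightarrow> real ^ 'n"
    and A :: "'x \<Rightarrow> real ^ 'm ^ 'n" and gc dinv :: "'x \<Rightarrow> real ^ 'm"
    and dz' :: "'x \<Rightarrow> real ^ 'n" and dlam' ds' :: "'x \<Rightarrow> real ^ 'm"
  assumes K: "K > 0"
    and u_0: "(u \<longlongrightarrow> 0) L" and u_\<mu>: "((\<lambda>x. u x / \<mu> x) \<longlongrightarrow> 0) L"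
    and exact: "\<forall>\<^sub>F x in L. exact_step \<phi> g (z x) (lam x) (s x) (t x) (dz x) (dlam x) (ds x)"
    and fp: "\<forall>\<^sub>F x in L. fp_arithmetic (u x) (FP x) (fl x) \<and> fp_vec (FP x) (lam x) \<and>
      fp_vec (FP x) (s x) \<and> fp_vec (FP x) (t x) \<and> (\<forall>j. fp_vec (FP x) (A x $ j)) \<and>
      fp_vec (FP x) (gc x) \<and> fp_vec (FP x) (dinv x) \<and> fp_vec (FP x) (dz' x)"
    and perturbation: "\<forall>\<^sub>F x in L. perturbation_bounds g zs K (u x) (\<mu> x)
      (Fbar x) (fbar x) (F x) (f x) (G x) (Fhat x) (fhat x)"
    and A_def: "\<And>x. A x = nabla g (z x) + F x" and gc_def: "\<And>x. gc x = g (z x) + f x"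
    and dinv_def: "\<And>x. dinv x = Dinv_computed (lam x) (s x) (G x)"
    and computed: "\<forall>\<^sub>F x in L.
      computed_dz \<phi> g (z x) (lam x) (t x) (A x) (gc x) (dinv x) (Fbar x) (fbar x) (Fhat x) (fhat x) (dz' x) \<and>
      computed_dlam (fl x) (lam x) (t x) (A x) (gc x) (dinv x) (dz' x) (dlam' x) \<and>
      computed_ds (fl x) (s x) (A x) (gc x) (dz' x) (ds' x)"
begin

definition e :: "'x \<Rightarrow> real ^ 'm" where
  "e x = (\<chi> i. s x $ i / lam x $ i + G x $ i)"

text \<open>The multiplier step that exact arithmetic would give for the computed \<open>dz'\<close>.\<close>

definition y' :: "'x \<Rightarrow> real ^ 'm" where
  "y' x = (\<chi> i. dinv x $ i * ((gc x $ i - t x $ i / lam x $ i) + (transpose (A x) *v dz' x) $ i))"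

section \<open>Sizes of the perturbations\<close>

lemma u_pos: "\<forall>\<^sub>F x in L. u x > 0"
  using fp by eventually_elim (auto simp: fp_arithmetic_def)

lemma u_nonneg: "\<forall>\<^sub>F x in L. 0 \<le> u x"
  using u_pos by eventually_elim auto

lemma u_le_1: "\<forall>\<^sub>F x in L. u x \<le> 1"
  using order_tendstoD(2)[OF u_0, of 1] by (auto elim: eventually_mono)

lemma u_bigo_1: "u \<in> O[L](\<lambda>_. 1)"
  using bigo_norm_tendsto[OF u_0] by simp

lemma u_bigo_\<mu>: "u \<in> O[L](\<mu>)"
proof (rule landau_o.bigI[of 1])
  show "\<forall>\<^sub>F x in L. norm (u x) \<le> 1 * norm (\<mu> x)"
    using order_tendstoD(2)[OF u_\<mu>, of 1, simplified] \<mu>_pos u_pos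
    by eventually_elim (simp add: field_simps)
qed simp

lemma bigo_\<mu>_u: "h \<in> O[L](\<lambda>x. \<mu> x * u x) \<Longrightarrow> h \<in> O[L](u)" for h :: "'x \<Rightarrow> real"
  using landau_o.big_trans[OF _ landau_o.big.mult[OF \<mu>_bigo, of u u]] by simp

lemma u_bigo_u_over_\<mu>: "u \<in> O[L](\<lambda>x. u x / \<mu> x)"
proof -
  have "(\<lambda>x. \<mu> x * (u x / \<mu> x)) \<in> O[L](\<lambda>x. 1 * (u x / \<mu> x))"
    by (intro landau_o.big.mult \<mu>_bigo landau_o.big_refl)
  moreover have "\<forall>\<^sub>F x in L. \<mu> x * (u x / \<mu> x) = u x"
    using \<mu>_pos by eventually_elim auto
  ultimately show ?thesis using landau_o.big.in_cong by fastforce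
qed

lemma perturbation_bigo:
  "(\<lambda>x. norm (Fbar x)) \<in> O[L](u)" "(\<lambda>x. norm (fbar x)) \<in> O[L](u)" "(\<lambda>x. norm (F x)) \<in> O[L](u)"
  "(\<lambda>x. norm (f x)) \<in> O[L](u)" "(\<lambda>x. norm (Fhat x)) \<in> O[L](\<lambda>x. u x / \<mu> x)" "(\<lambda>x. norm (fhat x)) \<in> O[L](u)"
proof -
  have I: "(\<lambda>x. norm (h x)) \<in> O[L](u)" if "\<forall>\<^sub>F x in L. norm (h x) \<le> K * u x" for h :: "'x \<Rightarrow> 'b :: real_normed_vector"
    by (rule bigo_norm_dominated[OF that bigo_const_mult[OF landau_o.big_refl]])
  show "(\<lambda>x. norm (Fbar x)) \<in> O[L](u)" "(\<lambda>x. norm (fbar x)) \<in> O[L](u)" "(\<lambda>x. norm (F x)) \<in> O[L](u)"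
    "(\<lambda>x. norm (f x)) \<in> O[L](u)" "(\<lambda>x. norm (fhat x)) \<in> O[L](u)"
    by (rule I, use perturbation in \<open>eventually_elim, simp add: perturbation_bounds_def\<close>)+
  have "\<forall>\<^sub>F x in L. norm (Fhat x) \<le> K * (u x / \<mu> x)"
    using perturbation by eventually_elim (simp add: perturbation_bounds_def)
  then show "(\<lambda>x. norm (Fhat x)) \<in> O[L](\<lambda>x. u x / \<mu> x)"
    by (rule bigo_norm_dominated[OF _ bigo_const_mult[OF landau_o.big_refl]])
qed

lemma G_bigo:
  "i \<in> B \<Longrightarrow> (\<lambda>x. G x $ i) \<in> O[L](\<lambda>x. \<mu> x * u x)"
  "i \<notin> B \<Longrightarrow> (\<lambda>x. G x $ i) \<in> O[L](\<lambda>x. u x / \<mu> x)"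
proof -
  assume "i \<in> B"
  then have "\<forall>\<^sub>F x in L. norm (G x $ i) \<le> K * (\<mu> x * u x)"
    using perturbation by (auto elim!: eventually_mono simp: perturbation_bounds_def mult.assoc)
  from bigo_norm_dominated[OF this bigo_const_mult[OF landau_o.big_refl]] show "(\<lambda>x. G x $ i) \<in> O[L](\<lambda>x. \<mu> x * u x)" by simp
next
  assume "i \<notin> B"
  then have "\<forall>\<^sub>F x in L. norm (G x $ i) \<le> K * (u x / \<mu> x)"
    using perturbation by (auto elim!: eventually_mono simp: perturbation_bounds_def inactive_def)
  from bigo_norm_dominated[OF this bigo_const_mult[OF landau_o.big_refl]] show "(\<lambda>x. G x $ i) \<in> O[L](\<lambda>x. u x / \<mu> x)" by simp
qed

text \<open>On B and off B alike, \<open>G\<close> is smaller than the lower bound for D by a factor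
  O(u). Once \<open>K * u\<close> is below \<open>c / 2\<close>, half of the lower bounds of
  \<open>ratio_bounds\<close> remains.\<close>

lemma e_bounds:
  obtains c M where "c > 0" "M > 0"
    "\<forall>\<^sub>F x in L. \<forall>i\<in>B. c * \<mu> x \<le> e x $ i \<and> e x $ i \<le> M * \<mu> x"
    "\<forall>\<^sub>F x in L. \<forall>i\<in>-B. c / \<mu> x \<le> e x $ i"
proof -
  obtain c M where c: "c > 0" "M > 0" and
    rB: "\<forall>\<^sub>F x in L. \<forall>i\<in>B. c * \<mu> x \<le> s x $ i / lam x $ i \<and> s x $ i / lam x $ i \<le> M * \<mu> x" and
    rN: "\<forall>\<^sub>F x in L. \<forall>i\<in>-B. c / \<mu> x \<le> s x $ i / lam x $ i"
    using ratio_bounds by blast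
  have small: "\<forall>\<^sub>F x in L. K * u x < c / 2"
    using order_tendstoD(2)[OF u_0, of "c / (2 * K)"] c K by (auto elim!: eventually_mono simp: field_simps)
  show ?thesis
  proof (rule that[of "c / 2" "M + c / 2"])
    show "\<forall>\<^sub>F x in L. \<forall>i\<in>B. c / 2 * \<mu> x \<le> e x $ i \<and> e x $ i \<le> (M + c / 2) * \<mu> x"
      using rB small \<mu>_pos perturbation
    proof eventually_elim
      case (elim x)
      show ?case
      proof
        fix i assume i: "i \<in> B"
        have "\<bar>G x $ i\<bar> \<le> (K * u x) * \<mu> x" using elim i by (simp add: perturbation_bounds_def mult_ac)
        also have "\<dots> \<le> c / 2 * \<mu> x" using elim by (intro mult_right_mono) auto
        finally have G: "\<bar>G x $ i\<bar> \<le> c / 2 * \<mu> x" .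
        have "c * \<mu> x \<le> s x $ i / lam x $ i" "s x $ i / lam x $ i \<le> M * \<mu> x" using elim i by auto
        moreover have "c * \<mu> x = c / 2 * \<mu> x + c / 2 * \<mu> x" "(M + c / 2) * \<mu> x = M * \<mu> x + c / 2 * \<mu> x"
          by (simp_all add: algebra_simps)
        ultimately show "c / 2 * \<mu> x \<le> e x $ i \<and> e x $ i \<le> (M + c / 2) * \<mu> x"
          using G unfolding e_def vec_lambda_beta by linarith
      qed
    qed
    show "\<forall>\<^sub>F x in L. \<forall>i\<in>-B. c / 2 / \<mu> x \<le> e x $ i"
      using rN small \<mu>_pos perturbation
    proof eventually_elim
      case (elim x)
      show ?case
      proof
        fix i assume i: "i \<in> -B"
        have "\<bar>G x $ i\<bar> \<le> (K * u x) / \<mu> x" using elim i by (simp add: perturbation_bounds_def inactive_def)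
        also have "\<dots> \<le> c / 2 / \<mu> x" using elim by (intro divide_right_mono) auto
        finally have G: "\<bar>G x $ i\<bar> \<le> c / 2 / \<mu> x" .
        have "c / \<mu> x \<le> s x $ i / lam x $ i" using elim i by auto
        moreover have "c / \<mu> x = c / 2 / \<mu> x + c / 2 / \<mu> x" by (simp add: field_simps)
        ultimately show "c / 2 / \<mu> x \<le> e x $ i"
          using G unfolding e_def vec_lambda_beta by linarith
      qed
    qed
  qed (use c in auto)
qed

lemma e_pos: "\<forall>\<^sub>F x in L. \<forall>i. e x $ i > 0"
proof -
  obtain c M where c: "c > 0" "M > 0" and
    eB: "\<forall>\<^sub>F x in L. \<forall>i\<in>B. c * \<mu> x \<le> e x $ i \<and> e x $ i \<le> M * \<mu> x" and
    eN: "\<forall>\<^sub>F x in L. \<forall>i\<in>-B. c / \<mu> x \<le> e x $ i"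
    using e_bounds by blast
  show ?thesis using eB eN \<mu>_pos
  proof eventually_elim
    case (elim x)
    have "0 < c * \<mu> x" "0 < c / \<mu> x" using c elim by auto
    then show ?case using elim by (meson ComplI order_less_le_trans)
  qed
qed

lemma dinv_eq: "dinv x $ i = inverse (e x $ i)"
  by (simp add: dinv_def Dinv_computed_def e_def)

lemma dinv_bigo:
  "i \<in> B \<Longrightarrow> (\<lambda>x. dinv x $ i) \<in> O[L](\<lambda>x. 1 / \<mu> x)"
  "i \<notin> B \<Longrightarrow> (\<lambda>x. dinv x $ i) \<in> O[L](\<mu>)"
proof -
  obtain c M where c: "c > 0" "M > 0" and
    eB: "\<forall>\<^sub>F x in L. \<forall>i\<in>B. c * \<mu> x \<le> e x $ i \<and> e x $ i \<le> M * \<mu> x" and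
    eN: "\<forall>\<^sub>F x in L. \<forall>i\<in>-B. c / \<mu> x \<le> e x $ i"
    using e_bounds by blast
  show "(\<lambda>x. dinv x $ i) \<in> O[L](\<mu>)" if "i \<notin> B"
    using inverse_inactive_bigo[OF c(1) eN that] by (simp add: dinv_eq)
  show "(\<lambda>x. dinv x $ i) \<in> O[L](\<lambda>x. 1 / \<mu> x)" if "i \<in> B"
  proof (rule landau_o.bigI[of "1 / c"])
    show "\<forall>\<^sub>F x in L. norm (dinv x $ i) \<le> 1 / c * norm (1 / \<mu> x)"
      using eB \<mu>_pos e_pos
    proof eventually_elim
      case (elim x)
      have "inverse (e x $ i) \<le> inverse (c * \<mu> x)"
        using elim that c by (intro le_imp_inverse_le) auto
      moreover have "0 < e x $ i" using elim by blast
      ultimately show ?case using elim c by (simp add: dinv_eq inverse_eq_divide abs_of_pos)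
    qed
  qed (use c in simp)
qed

lemma A_near: "(\<lambda>x. norm (A x - nabla g (z x))) \<in> O[L](\<mu>)"
  using landau_o.big_trans[OF perturbation_bigo(3) u_bigo_\<mu>] by (simp add: A_def)

lemmas A_bigo = near_nabla_bigo(2)[OF A_near]

lemma nabla_bigo_1: "(\<lambda>x. norm (nabla g (z x))) \<in> O[L](\<lambda>_. 1)"
  by (rule near_nabla_bigo(2)) simp

section \<open>The computed step and its difference from the exact step\<close>

lemma computed_equation:
  "\<forall>\<^sub>F x in L. (Hz x + Fbar x + Fhat x) *v dz' x + A x *v y' x = - Lz x - fbar x + fhat x"
  using computed by eventually_elim (simp only: y'_def computed_dz_split)

lemma y'_equation:
  "\<forall>\<^sub>F x in L. \<forall>i. e x $ i * y' x $ i = (transpose (A x) *v dz' x) $ i + (gc x $ i - t x $ i / lam x $ i)"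
  using e_pos
proof eventually_elim
  case (elim x)
  then have "e x $ i \<noteq> 0" for i by (metis less_irrefl)
  then show ?case by (simp add: y'_def dinv_eq add_ac flip: mult.assoc del: transpose_matrix_vector)
qed

text \<open>\<open>Fhat\<close> is only O(u/\<mu>), but since u/\<mu> tends to 0 the perturbed
  Hessian stays close to \<open>Hz\<close>. All other perturbations are O(u) and hence O(\<mu>), so
  \<open>step_bound\<close> applies to the computed system.\<close>

lemma computed_bigo:
  "(\<lambda>x. norm (dz' x)) \<in> O[L](\<mu>)" "(\<lambda>x. norm (y' x)) \<in> O[L](\<lambda>_. 1)"
  "i \<notin> B \<Longrightarrow> (\<lambda>x. y' x $ i) \<in> O[L](\<mu>)"
proof -
  obtain c M where c: "c > 0" "M > 0" and
    eB: "\<forall>\<^sub>F x in L. \<forall>i\<in>B. c * \<mu> x \<le> e x $ i \<and> e x $ i \<le> M * \<mu> x" and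
    eN: "\<forall>\<^sub>F x in L. \<forall>i\<in>-B. c / \<mu> x \<le> e x $ i"
    using e_bounds by blast
  have tend: "(h \<longlongrightarrow> 0) L" if h: "(\<lambda>x. norm (h x)) \<in> O[L](k)" and k: "(k \<longlongrightarrow> 0) L"
    for h :: "'x \<Rightarrow> real ^ 'n ^ 'n" and k :: "'x \<Rightarrow> real"
  proof -
    obtain M where "M > 0" and M: "\<forall>\<^sub>F x in L. norm (norm (h x)) \<le> M * norm (k x)"
      using h by (rule landau_o.bigE)
    have "((\<lambda>x. M * norm (k x)) \<longlongrightarrow> 0) L"
      using tendsto_mult_right_zero[OF tendsto_norm_zero[OF k]] .
    then show ?thesis
      by (rule Lim_null_comparison[rotated]) (use M in simp)
  qed
  have "((\<lambda>x. Fbar x + Fhat x) \<longlongrightarrow> 0) L"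
    using tendsto_add[OF tend[OF perturbation_bigo(1) u_0] tend[OF perturbation_bigo(5) u_\<mu>]] by simp
  then have H: "((\<lambda>x. (Hz x + Fbar x + Fhat x) - Hz x) \<longlongrightarrow> 0) L"
    by (simp add: algebra_simps)
  have a: "(\<lambda>x. norm (- Lz x - fbar x + fhat x)) \<in> O[L](\<mu>)"
    using Lz_bigo by (intro bigo_norm_add bigo_norm_diff landau_o.big_trans[OF perturbation_bigo(2) u_bigo_\<mu>]
        landau_o.big_trans[OF perturbation_bigo(6) u_bigo_\<mu>]) simp
  have gc: "(\<lambda>x. norm (gc x - g (z x))) \<in> O[L](\<mu>)"
    using landau_o.big_trans[OF perturbation_bigo(4) u_bigo_\<mu>] by (simp add: gc_def)
  note sb = step_bound[OF H A_near c eB eN computed_equation y'_equation a gc]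
  show "(\<lambda>x. norm (dz' x)) \<in> O[L](\<mu>)" "(\<lambda>x. norm (y' x)) \<in> O[L](\<lambda>_. 1)"
    "i \<notin> B \<Longrightarrow> (\<lambda>x. y' x $ i) \<in> O[L](\<mu>)"
    by (rule sb(1), rule sb(2), rule sb(3))
qed

text \<open>The right-hand sides of the system satisfied by \<open>dz - dz'\<close> and \<open>dlam - y'\<close>.\<close>

definition b :: "'x \<Rightarrow> real ^ 'm" where
  "b x = (\<chi> i. G x $ i * y' x $ i - f x $ i - (transpose (F x) *v dz' x) $ i)"

definition a :: "'x \<Rightarrow> real ^ 'n" where
  "a x = fbar x - fhat x + (Fbar x + Fhat x) *v dz' x + F x *v y' x"

text \<open>The coefficients acting on the differences are the exact ones; each perturbation is
  moved to the right together with a computed vector, whose size is known from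
  \<open>computed_bigo\<close>.\<close>

lemma difference_equations:
  "\<forall>\<^sub>F x in L. Hz x *v (dz x - dz' x) + nabla g (z x) *v (dlam x - y' x) = a x"
  "\<forall>\<^sub>F x in L. \<forall>i. (\<chi> i. s x $ i / lam x $ i) $ i * (dlam x - y' x) $ i
    = (transpose (nabla g (z x)) *v (dz x - dz' x)) $ i + b x $ i"
proof -
  show "\<forall>\<^sub>F x in L. Hz x *v (dz x - dz' x) + nabla g (z x) *v (dlam x - y' x) = a x"
    using exact computed_equation
  proof eventually_elim
    case (elim x)
    then have "Hz x *v dz x + nabla g (z x) *v dlam x = - Lz x" by (simp add: exact_step_def)
    moreover have "Hz x *v dz' x + (Fbar x + Fhat x) *v dz' x + nabla g (z x) *v y' x + F x *v y' x = - Lz x - fbar x + fhat x"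
      using elim(2) by (simp add: A_def matrix_vector_mult_add_rdistrib algebra_simps)
    ultimately show ?case
      unfolding a_def by (simp add: matrix_vector_mult_diff_distrib algebra_simps)
  qed
  show "\<forall>\<^sub>F x in L. \<forall>i. (\<chi> i. s x $ i / lam x $ i) $ i * (dlam x - y' x) $ i
    = (transpose (nabla g (z x)) *v (dz x - dz' x)) $ i + b x $ i"
    using exact y'_equation iterate_facts
  proof eventually_elim
    case (elim x)
    show ?case
    proof
      fix i
      have "lam x $ i \<noteq> 0" using elim by (metis less_irrefl)
      note 1 = exact_step_condensed(1)[OF elim(1) this]
      have "transpose (A x) *v dz' x = transpose (nabla g (z x)) *v dz' x + transpose (F x) *v dz' x"
        by (simp add: A_def vec_eq_iff transpose_def matrix_vector_mult_def distrib_right sum.distrib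
            del: transpose_matrix_vector)
      then have 2: "(s x $ i / lam x $ i + G x $ i) * y' x $ i = (transpose (nabla g (z x)) *v dz' x) $ i
          + (transpose (F x) *v dz' x) $ i + (g (z x) $ i + f x $ i - t x $ i / lam x $ i)"
        using elim(2) by (simp add: e_def gc_def del: transpose_matrix_vector)
      show "(\<chi> i. s x $ i / lam x $ i) $ i * (dlam x - y' x) $ i
          = (transpose (nabla g (z x)) *v (dz x - dz' x)) $ i + b x $ i"
        unfolding b_def matrix_vector_mult_diff_distrib vec_lambda_beta vector_minus_component right_diff_distrib 1
        using 2 by (simp add: distrib_right del: transpose_matrix_vector)
    qed
  qed
qed

text \<open>The critical product is \<open>Fhat *v dz'\<close>: the size O(\<mu>) of the computed
  step makes up for the 1/\<mu> in \<open>Fhat\<close>.\<close>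

lemma a_bigo: "(\<lambda>x. norm (a x)) \<in> O[L](u)"
proof -
  have "(\<lambda>x. norm (Fbar x + Fhat x)) \<in> O[L](\<lambda>x. u x / \<mu> x)"
    by (intro bigo_norm_add perturbation_bigo landau_o.big_trans[OF perturbation_bigo(1) u_bigo_u_over_\<mu>])
  from bigo_norm_matrix_vector_mult[OF this computed_bigo(1)]
  have "(\<lambda>x. norm ((Fbar x + Fhat x) *v dz' x)) \<in> O[L](\<lambda>x. u x / \<mu> x * \<mu> x)" .
  also have "O[L](\<lambda>x. u x / \<mu> x * \<mu> x) = O[L](u)"
    by (rule landau_o.big.cong) (use \<mu>_pos in \<open>eventually_elim, auto\<close>)
  finally have 1: "(\<lambda>x. norm ((Fbar x + Fhat x) *v dz' x)) \<in> O[L](u)" .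
  have 2: "(\<lambda>x. norm (F x *v y' x)) \<in> O[L](u)"
    using bigo_norm_matrix_vector_mult[OF perturbation_bigo(3) computed_bigo(2)] by simp
  show ?thesis
    unfolding a_def by (intro bigo_norm_add bigo_norm_diff perturbation_bigo 1 2)
qed

lemma transpose_F_bigo: "(\<lambda>x. (transpose (F x) *v dz' x) $ i) \<in> O[L](u)"
proof -
  have "(\<lambda>x. norm (transpose (F x) *v dz' x)) \<in> O[L](\<lambda>x. u x * 1)"
    by (intro bigo_norm_matrix_vector_mult landau_o.big_trans[OF computed_bigo(1) \<mu>_bigo])
      (simp add: norm_transpose perturbation_bigo)
  then show ?thesis by (intro bigo_vec_nth) simp
qed

text \<open>For \<open>G * y'\<close> the sizes balance differently: \<mu> u times O(1) on B, and
  u/\<mu> times O(\<mu>) off B.\<close>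

lemma b_bigo: "(\<lambda>x. b x $ i) \<in> O[L](u)"
proof -
  have "(\<lambda>x. G x $ i * y' x $ i) \<in> O[L](u)"
  proof (cases "i \<in> B")
    case True
    from landau_o.big.mult[OF G_bigo(1)[OF True] bigo_vec_nth[OF computed_bigo(2), of i]]
    show ?thesis by (intro bigo_\<mu>_u) simp
  next
    case False
    show ?thesis
      by (rule bigo_mult_eventually_eq[OF G_bigo(2)[OF False] computed_bigo(3)[OF False]])
        (use \<mu>_pos in \<open>eventually_elim, auto\<close>)
  qed
  then show ?thesis
    unfolding b_def vec_lambda_beta
    by (intro sum_in_bigo bigo_vec_nth[OF perturbation_bigo(4)] transpose_F_bigo)
qed

text \<open>The general bound gives only O(u) for inactive components, because it admits data of
  size u/\<mu> there. As \<open>b\<close> is O(u) off B too, returning to the second equation and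
  dividing by \<open>s / lam\<close> gains the factor \<mu>.\<close>

lemma difference_bigo:
  "(\<lambda>x. norm (dz x - dz' x)) \<in> O[L](u)"
  "i \<in> B \<Longrightarrow> (\<lambda>x. (dlam x - y' x) $ i) \<in> O[L](\<lambda>x. u x / \<mu> x)"
  "i \<notin> B \<Longrightarrow> (\<lambda>x. (dlam x - y' x) $ i) \<in> O[L](\<lambda>x. \<mu> x * u x)"
proof -
  obtain c M where c: "c > 0" "M > 0" and
    rB: "\<forall>\<^sub>F x in L. \<forall>i\<in>B. c * \<mu> x \<le> (\<chi> i. s x $ i / lam x $ i) $ i \<and> (\<chi> i. s x $ i / lam x $ i) $ i \<le> M * \<mu> x" and
    rN: "\<forall>\<^sub>F x in L. \<forall>i\<in>-B. c / \<mu> x \<le> (\<chi> i. s x $ i / lam x $ i) $ i"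
    using ratio_bounds unfolding vec_lambda_beta by blast
  have H: "((\<lambda>x. Hz x - Hz x) \<longlongrightarrow> 0) L" by simp
  have A: "(\<lambda>x. norm (nabla g (z x) - nabla g (z x))) \<in> O[L](\<mu>)" by simp
  note sb = system_bound[OF H A c rB rN difference_equations u_nonneg a_bigo b_bigo
      landau_o.big_trans[OF b_bigo u_bigo_u_over_\<mu>]]
  show w: "(\<lambda>x. norm (dz x - dz' x)) \<in> O[L](u)" by (rule sb(1))
  show "(\<lambda>x. (dlam x - y' x) $ i) \<in> O[L](\<lambda>x. u x / \<mu> x)" if "i \<in> B"
    by (rule sb(2)) (rule that)
  assume i: "i \<notin> B"
  have "(\<lambda>x. (transpose (nabla g (z x)) *v (dz x - dz' x)) $ i + b x $ i) \<in> O[L](u)"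
    by (intro sum_in_bigo b_bigo landau_o.big_trans[OF product_with_inner_bigo[OF nabla_bigo_1] w])
  from landau_o.big.mult[OF inverse_inactive_bigo[OF c(1) rN i] this]
  have "(\<lambda>x. inverse ((\<chi> i. s x $ i / lam x $ i) $ i) *
      ((transpose (nabla g (z x)) *v (dz x - dz' x)) $ i + b x $ i)) \<in> O[L](\<lambda>x. \<mu> x * u x)" .
  moreover have "\<forall>\<^sub>F x in L. (dlam x - y' x) $ i = inverse ((\<chi> i. s x $ i / lam x $ i) $ i) *
      ((transpose (nabla g (z x)) *v (dz x - dz' x)) $ i + b x $ i)"
    using difference_equations(2) iterate_facts
  proof eventually_elim
    case (elim x)
    have "0 < lam x $ i" "0 < s x $ i" using elim by auto
    then have "(\<chi> i. s x $ i / lam x $ i) $ i \<noteq> 0" by simp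
    then show ?case using elim(1)[THEN spec[of _ i], symmetric] by (simp del: transpose_matrix_vector)
  qed
  ultimately show "(\<lambda>x. (dlam x - y' x) $ i) \<in> O[L](\<lambda>x. \<mu> x * u x)"
    using landau_o.big.in_cong by fastforce
qed

section \<open>Rounding in the multiplier and slack formulas\<close>

lemma products_bigo: "(\<lambda>x. \<Sum>j\<in>UNIV. \<bar>A x $ j $ i * dz' x $ j\<bar>) \<in> O[L](\<mu>)"
proof (rule big_sum_in_bigo)
  fix j
  from landau_o.big.mult[OF bigo_vec_nth[OF bigo_norm_nth[OF A_bigo]] bigo_vec_nth[OF computed_bigo(1), of j]]
  show "(\<lambda>x. \<bar>A x $ j $ i * dz' x $ j\<bar>) \<in> O[L](\<mu>)" by simp
qed

lemma f_bigo: "(\<lambda>x. f x $ i) \<in> O[L](u)"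
  by (rule bigo_vec_nth[OF perturbation_bigo(4)])

text \<open>The error is u times \<open>dinv\<close> times the sum \<open>T\<close> of absolute
  values. On B this sum is O(\<mu>) and cancels the 1/\<mu> of \<open>dinv\<close>; off B the sum is
  O(1), but \<open>dinv\<close> is O(\<mu>).\<close>

lemma rounding_bigo:
  "i \<in> B \<Longrightarrow> (\<lambda>x. (dlam' x - y' x) $ i) \<in> O[L](u)"
  "i \<notin> B \<Longrightarrow> (\<lambda>x. (dlam' x - y' x) $ i) \<in> O[L](\<lambda>x. \<mu> x * u x)"
proof -
  define N where "N = (2 :: real) ^ (CARD('n) + 6)"
  define T where "T x = \<bar>gc x $ i\<bar> + \<bar>t x $ i / lam x $ i\<bar> + (\<Sum>j\<in>UNIV. \<bar>A x $ j $ i * dz' x $ j\<bar>)" for x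
  have err: "\<forall>\<^sub>F x in L. norm ((dlam' x - y' x) $ i) \<le> N * (u x * (\<bar>dinv x $ i\<bar> * T x))"
    using fp computed u_le_1 iterate_facts
  proof eventually_elim
    case (elim x)
    have l: "lam x $ i \<noteq> 0" using elim by (metis less_irrefl)
    have "\<bar>dlam' x $ i - dinv x $ i * (gc x $ i - t x $ i / lam x $ i + (transpose (A x) *v dz' x) $ i)\<bar>
      \<le> N * u x * (\<bar>dinv x $ i\<bar> * T x)"
      unfolding T_def N_def by (rule computed_dlam_error[where fl = "fl x" and FP = "FP x"]) (use elim l in auto)
    then show ?case by (simp add: y'_def mult.assoc del: transpose_matrix_vector)
  qed
  have D: "(\<lambda>x. (dlam' x - y' x) $ i) \<in> O[L](h)" if "(\<lambda>x. u x * (\<bar>dinv x $ i\<bar> * T x)) \<in> O[L](h)" for h :: "'x \<Rightarrow> real"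
  proof -
    have "(\<lambda>x. N * (u x * (\<bar>dinv x $ i\<bar> * T x))) \<in> O[L](h)"
      by (rule landau_o.big_trans[OF _ that], rule landau_o.bigI[of N]) (auto simp: N_def abs_mult)
    from bigo_norm_dominated[OF err this] show ?thesis by simp
  qed
  have tl: "(\<lambda>x. \<bar>t x $ i / lam x $ i\<bar>) \<in> O[L](\<mu>)" using t_over_lam_bigo[of i] by (simp del: abs_divide)
  show "(\<lambda>x. (dlam' x - y' x) $ i) \<in> O[L](u)" if i: "i \<in> B"
  proof (rule D)
    have "(\<lambda>x. \<bar>gc x $ i\<bar>) \<in> O[L](\<mu>)"
      using sum_in_bigo(1)[OF g_active_bigo[OF i] landau_o.big_trans[OF f_bigo[of i] u_bigo_\<mu>]] by (simp add: gc_def)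
    then have "T \<in> O[L](\<mu>)"
      unfolding T_def[abs_def] by (intro sum_in_bigo tl products_bigo)
    then have "(\<lambda>x. \<bar>dinv x $ i\<bar> * T x) \<in> O[L](\<lambda>_. 1)"
      by (rule bigo_mult_eventually_eq[rotated]) (use dinv_bigo(1)[OF i] \<mu>_pos in \<open>auto elim: eventually_mono\<close>)
    then show "(\<lambda>x. u x * (\<bar>dinv x $ i\<bar> * T x)) \<in> O[L](u)"
      using landau_o.big.mult[of u L u] by fastforce
  qed
  show "(\<lambda>x. (dlam' x - y' x) $ i) \<in> O[L](\<lambda>x. \<mu> x * u x)" if i: "i \<notin> B"
  proof (rule D)
    have "(\<lambda>x. \<bar>gc x $ i\<bar>) \<in> O[L](\<lambda>_. 1)"
      using sum_in_bigo(1)[OF bigo_vec_nth[OF g_bigo, of i] landau_o.big_trans[OF f_bigo[of i] u_bigo_1]] by (simp add: gc_def)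
    then have T: "T \<in> O[L](\<lambda>_. 1)"
      unfolding T_def[abs_def]
      by (intro sum_in_bigo landau_o.big_trans[OF tl \<mu>_bigo] landau_o.big_trans[OF products_bigo \<mu>_bigo])
    have "(\<lambda>x. \<bar>dinv x $ i\<bar> * T x) \<in> O[L](\<lambda>x. \<mu> x * 1)"
      by (rule landau_o.big.mult[OF _ T]) (use dinv_bigo(2)[OF i] in simp)
    then have "(\<lambda>x. u x * (\<bar>dinv x $ i\<bar> * T x)) \<in> O[L](\<lambda>x. u x * (\<mu> x * 1))"
      by (rule landau_o.big.mult[OF landau_o.big_refl])
    then show "(\<lambda>x. u x * (\<bar>dinv x $ i\<bar> * T x)) \<in> O[L](\<lambda>x. \<mu> x * u x)" by (simp add: mult.commute)
  qed
qed

lemma dlam_error_split: "(dlam x - dlam' x) $ i = (dlam x - y' x) $ i - (dlam' x - y' x) $ i"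
  by simp

lemma dlam_active_bigo: "i \<in> B \<Longrightarrow> (\<lambda>x. (dlam x - dlam' x) $ i) \<in> O[L](\<lambda>x. u x / \<mu> x)"
  unfolding dlam_error_split
  by (intro sum_in_bigo difference_bigo landau_o.big_trans[OF rounding_bigo(1) u_bigo_u_over_\<mu>])

lemma dlam_inactive_bigo: "i \<notin> B \<Longrightarrow> (\<lambda>x. (dlam x - dlam' x) $ i) \<in> O[L](\<lambda>x. \<mu> x * u x)"
  unfolding dlam_error_split by (intro sum_in_bigo difference_bigo rounding_bigo)

lemma ds_bigo: "(\<lambda>x. norm (ds x - ds' x)) \<in> O[L](u)"
proof (rule bigo_norm_vecI)
  fix i
  define N where "N = (2 :: real) ^ (CARD('n) + 4)"
  define T where "T x = \<bar>gc x $ i\<bar> + \<bar>s x $ i\<bar> + (\<Sum>j\<in>UNIV. \<bar>A x $ j $ i * dz' x $ j\<bar>)" for x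
  define \<rho> where "\<rho> x = ds' x $ i - (- (gc x $ i) - s x $ i - (transpose (A x) *v dz' x) $ i)" for x
  have "\<forall>\<^sub>F x in L. norm (\<rho> x) \<le> N * (u x * T x)"
    using fp computed u_le_1
  proof eventually_elim
    case (elim x)
    have "\<bar>\<rho> x\<bar> \<le> N * u x * T x"
      unfolding T_def N_def \<rho>_def by (rule computed_ds_error[where fl = "fl x" and FP = "FP x"]) (use elim in auto)
    then show ?case by (simp add: mult.assoc)
  qed
  moreover have "(\<lambda>x. N * (u x * T x)) \<in> O[L](u)"
  proof -
    have "(\<lambda>x. \<bar>gc x $ i\<bar>) \<in> O[L](\<lambda>_. 1)"
      using sum_in_bigo(1)[OF bigo_vec_nth[OF g_bigo, of i] landau_o.big_trans[OF f_bigo[of i] u_bigo_1]] by (simp add: gc_def)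
    moreover have "(\<lambda>x. \<bar>s x $ i\<bar>) \<in> O[L](\<lambda>_. 1)" using bigo_vec_nth[OF s_bigo, of i] by simp
    ultimately have "T \<in> O[L](\<lambda>_. 1)"
      unfolding T_def[abs_def] by (intro sum_in_bigo landau_o.big_trans[OF products_bigo \<mu>_bigo])
    then have "(\<lambda>x. u x * T x) \<in> O[L](\<lambda>x. u x * 1)"
      by (intro landau_o.big.mult landau_o.big_refl)
    then show ?thesis by (simp add: N_def)
  qed
  ultimately have "(\<lambda>x. norm (\<rho> x)) \<in> O[L](u)" by (rule bigo_norm_dominated)
  then have \<rho>: "\<rho> \<in> O[L](u)" by simp
  \<comment> \<open>This expression is the slack error itself: the exact formula minus the computed
    one, in which the terms \<open>s\<close> cancel and \<rho> is the rounding.\<close>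
  have "(\<lambda>x. f x $ i + (transpose (F x) *v dz' x) $ i - (transpose (nabla g (z x)) *v (dz x - dz' x)) $ i - \<rho> x) \<in> O[L](u)"
    by (intro sum_in_bigo f_bigo transpose_F_bigo \<rho>
        landau_o.big_trans[OF product_with_inner_bigo[OF nabla_bigo_1] difference_bigo(1)])
  moreover have "\<forall>\<^sub>F x in L. norm ((ds x - ds' x) $ i)
      = \<bar>f x $ i + (transpose (F x) *v dz' x) $ i - (transpose (nabla g (z x)) *v (dz x - dz' x)) $ i - \<rho> x\<bar>"
    using exact iterate_facts
  proof eventually_elim
    case (elim x)
    have "lam x $ i \<noteq> 0" using elim by (metis less_irrefl)
    note 1 = exact_step_condensed(2)[OF elim(1) this]
    have 2: "transpose (A x) *v dz' x = transpose (nabla g (z x)) *v dz' x + transpose (F x) *v dz' x"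
      by (simp add: A_def vec_eq_iff transpose_def matrix_vector_mult_def distrib_right sum.distrib
          del: transpose_matrix_vector)
    show ?case
      by (simp add: \<rho>_def 1 2 gc_def matrix_vector_mult_diff_distrib del: transpose_matrix_vector)
  qed
  ultimately show "(\<lambda>x. norm ((ds x - ds' x) $ i)) \<in> O[L](u)"
    using landau_o.big.in_cong[of "\<lambda>x. norm ((ds x - ds' x) $ i)"] by simp
qed

text \<open>The active differences \<open>yB\<close> are only O(u/\<mu>), but after the first
  equation is used they meet just the matrix \<open>nabla g (z x) - nabla g zs\<close>, which is
  O(\<mu>). The inactive differences and the rounding \<rho> are O(u) and need only bounded
  matrices.\<close>

lemma active_nabla_dlam_bigo: "(\<lambda>x. norm (As *v (dlam x - dlam' x))) \<in> O[L](u)"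
proof -
  define yB where "yB x = (\<chi> i. if i \<in> B then (dlam x - y' x) $ i else 0)" for x
  define yN where "yN x = (\<chi> i. if i \<in> B then 0 else (dlam x - y' x) $ i)" for x
  define \<rho> where "\<rho> x = (\<chi> i. if i \<in> B then (dlam' x - y' x) $ i else 0)" for x
  have As: "As *v v = As *v v'" if "\<And>i. i \<in> B \<Longrightarrow> v $ i = v' $ i" for v v'
    using that by (auto simp: vec_eq_iff active_nabla_def matrix_vector_mult_def intro!: sum.cong)
  have AsB: "As *v yB x = nabla g zs *v yB x" for x
    by (auto simp: vec_eq_iff active_nabla_def matrix_vector_mult_def yB_def intro!: sum.cong)
  have split: "\<forall>\<^sub>F x in L. As *v (dlam x - dlam' x) = a x - Hz x *v (dz x - dz' x) - nabla g (z x) *v yN x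
      - (nabla g (z x) - nabla g zs) *v yB x - As *v \<rho> x"
    using difference_equations(1)
  proof eventually_elim
    case (elim x)
    have "As *v (dlam x - dlam' x) = As *v (yB x - \<rho> x)"
      by (rule As) (simp add: yB_def \<rho>_def)
    also have "\<dots> = nabla g zs *v yB x - As *v \<rho> x"
      by (simp add: matrix_vector_mult_diff_distrib AsB)
    also have "nabla g zs *v yB x = nabla g (z x) *v (dlam x - y' x) - nabla g (z x) *v yN x
        - (nabla g (z x) - nabla g zs) *v yB x"
    proof -
      have "dlam x - y' x = yB x + yN x" by (simp add: vec_eq_iff yB_def yN_def)
      then show ?thesis by (simp add: matrix_vector_mult_diff_rdistrib matrix_vector_right_distrib)
    qed
    also have "nabla g (z x) *v (dlam x - y' x) = a x - Hz x *v (dz x - dz' x)"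
      using elim by (simp add: algebra_simps)
    finally show ?case .
  qed
  have yB: "(\<lambda>x. norm (yB x)) \<in> O[L](\<lambda>x. u x / \<mu> x)"
  proof (rule bigo_norm_vecI)
    show "(\<lambda>x. norm (yB x $ i)) \<in> O[L](\<lambda>x. u x / \<mu> x)" for i
      using difference_bigo(2)[of i] by (cases "i \<in> B") (simp_all add: yB_def)
  qed
  have yN: "(\<lambda>x. norm (yN x)) \<in> O[L](u)"
  proof (rule bigo_norm_vecI)
    show "(\<lambda>x. norm (yN x $ i)) \<in> O[L](u)" for i
      using bigo_\<mu>_u[OF difference_bigo(3)[of i]] by (cases "i \<in> B") (simp_all add: yN_def)
  qed
  have \<rho>: "(\<lambda>x. norm (\<rho> x)) \<in> O[L](u)"
  proof (rule bigo_norm_vecI)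
    show "(\<lambda>x. norm (\<rho> x $ i)) \<in> O[L](u)" for i
      using rounding_bigo(1)[of i] by (cases "i \<in> B") (simp_all add: \<rho>_def)
  qed
  have "(\<lambda>x. norm (Hz x *v (dz x - dz' x))) \<in> O[L](\<lambda>x. 1 * u x)"
    by (intro bigo_norm_matrix_vector_mult near_Hs_bigo Hz_tendsto difference_bigo)
  moreover have "(\<lambda>x. norm (nabla g (z x) *v yN x)) \<in> O[L](\<lambda>x. 1 * u x)"
    by (intro bigo_norm_matrix_vector_mult nabla_bigo_1 yN)
  moreover have "(\<lambda>x. norm (As *v \<rho> x)) \<in> O[L](\<lambda>x. 1 * u x)"
    by (intro bigo_norm_matrix_vector_mult bigo_norm_tendsto[OF tendsto_const] \<rho>)
  moreover have "(\<lambda>x. norm ((nabla g (z x) - nabla g zs) *v yB x)) \<in> O[L](u)"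
  proof (rule landau_o.big_trans[OF bigo_norm_matrix_vector_mult[OF nabla_bigo yB]])
    show "(\<lambda>x. \<mu> x * (u x / \<mu> x)) \<in> O[L](u)"
      by (rule landau_o.bigI[of 1]) (use \<mu>_pos in \<open>auto elim: eventually_mono\<close>)
  qed
  ultimately have "(\<lambda>x. norm (a x - Hz x *v (dz x - dz' x) - nabla g (z x) *v yN x
      - (nabla g (z x) - nabla g zs) *v yB x - As *v \<rho> x)) \<in> O[L](u)"
    by (intro bigo_norm_diff a_bigo) simp_all
  moreover have "\<forall>\<^sub>F x in L. norm (As *v (dlam x - dlam' x)) = norm (a x - Hz x *v (dz x - dz' x) - nabla g (z x) *v yN x
      - (nabla g (z x) - nabla g zs) *v yB x - As *v \<rho> x)"
    using split by eventually_elim simp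
  ultimately show ?thesis
    using landau_o.big.in_cong[of "\<lambda>x. norm (As *v (dlam x - dlam' x))"] by simp
qed

section \<open>Multiplier errors in the coordinates of the SVD and off the active set\<close>

lemma range_error_bigo:
  "(\<lambda>x. L2_set (\<lambda>j. \<Sum>k\<in>B. Q j k * (dlam x $ k - dlam' x $ k)) {..<r}) \<in> O[L](u)"
proof (rule bigo_L2_set)
  fix j assume "j \<in> {..<r}"
  then have j: "j < r" by simp
  have eq: "(\<Sum>k\<in>B. Q j k * (dlam x $ k - dlam' x $ k)) = (P j \<bullet> (As *v (dlam x - dlam' x))) / \<sigma> j" for x
    using active_svd_right[OF svd j, of "dlam x - dlam' x"] by simp
  have "(\<lambda>x. P j \<bullet> (As *v (dlam x - dlam' x))) \<in> O[L](\<lambda>x. 1 * u x)"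
    by (intro bigo_norm_inner active_nabla_dlam_bigo bigo_norm_tendsto[OF tendsto_const])
  then show "(\<lambda>x. \<Sum>k\<in>B. Q j k * (dlam x $ k - dlam' x $ k)) \<in> O[L](u)"
    unfolding eq divide_inverse mult.commute[of _ "inverse _"] by (intro bigo_const_mult) simp
qed

lemma null_error_bigo:
  "(\<lambda>x. L2_set (\<lambda>j. \<Sum>k\<in>B. Q j k * (dlam x $ k - dlam' x $ k)) J) \<in> O[L](\<lambda>x. u x / \<mu> x)"
proof (intro bigo_L2_set big_sum_in_bigo bigo_const_mult)
  show "(\<lambda>x. dlam x $ k - dlam' x $ k) \<in> O[L](\<lambda>x. u x / \<mu> x)" if "k \<in> B" for k
    using dlam_active_bigo[OF that] by simp
qed

lemma inactive_error_bigo: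
  "(\<lambda>x. L2_set (\<lambda>i. dlam x $ i - dlam' x $ i) (inactive g zs)) \<in> O[L](\<lambda>x. \<mu> x * u x)"
  using dlam_inactive_bigo by (intro bigo_L2_set) (auto simp: inactive_def)

end

section \<open>Uniform constants\<close>

text \<open>Packs the hypotheses on a single step, with the tolerances as parameters, so that a
  counterexample for given tolerances can be chosen as a whole.\<close>

definition step_hypotheses where
  "step_hypotheses \<phi> g zs r P \<sigma> C \<gamma> Ct K \<epsilon> \<eta> \<beta>0
     z lam s t \<beta> u FP fl dz dlam ds Fbar fbar F f G Fhat fhat A c dinv dz' dlam' ds' \<longleftrightarrow>
     iterate_conditions \<phi> g C \<gamma> z lam s \<and>
     sol_dist \<phi> g zs z lam \<le> \<epsilon> \<and> mu lam s \<le> \<epsilon> \<and>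
     norm t \<le> Ct * (mu lam s)\<^sup>2 \<and>
     u / mu lam s \<le> \<eta> \<and> u \<le> \<eta> \<and>
     \<beta> \<ge> \<beta>0 \<and> conditioning_bounds \<phi> g zs r P \<sigma> \<beta> u (mu lam s) \<and>
     exact_step \<phi> g z lam s t dz dlam ds \<and>
     fp_arithmetic u FP fl \<and>
     fp_vec FP z \<and> fp_vec FP lam \<and> fp_vec FP s \<and> fp_vec FP t \<and>
     perturbation_bounds g zs K u (mu lam s) Fbar fbar F f G Fhat fhat \<and>
     A = nabla g z + F \<and> c = g z + f \<and> dinv = Dinv_computed lam s G \<and>
     (\<forall>j. fp_vec FP (A $ j)) \<and> fp_vec FP c \<and> fp_vec FP dinv \<and> fp_vec FP dz' \<and>
     computed_dz \<phi> g z lam t A c dinv Fbar fbar Fhat fhat dz' \<and>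
     computed_dlam fl lam t A c dinv dz' dlam' \<and>
     computed_ds fl s A c dz' ds'"

definition step_error_bounds where
  "step_error_bounds g zs r Q K' u \<mu> dz dlam ds dz' dlam' ds' \<longleftrightarrow>
     norm (dz - dz') \<le> K' * u \<and>
     L2_set (\<lambda>j. \<Sum>k\<in>active g zs. Q j k * (dlam $ k - dlam' $ k)) {..<r} \<le> K' * u \<and>
     norm (ds - ds') \<le> K' * u \<and>
     L2_set (\<lambda>j. \<Sum>k\<in>active g zs. Q j k * (dlam $ k - dlam' $ k)) {r..<card (active g zs)} \<le> K' * u / \<mu> \<and>
     L2_set (\<lambda>i. dlam $ i - dlam' $ i) (inactive g zs) \<le> K' * \<mu> * u"

lemma positive_constantsI:
  fixes a b c d :: real
  assumes "a > 0" "b > 0" "c > 0" "d > 0" "P a b c d"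
  shows "\<exists>a>0. \<exists>b>0. \<exists>c>0. \<exists>d>0. P a b c d"
  using assms by blast

text \<open>An infimum below \<open>d\<close> has a witness below \<open>d\<close>. Nonemptiness
  excludes the default value 0 of \<open>infdist\<close> on the empty set.\<close>

lemma sol_dist_lessE:
  assumes "multipliers \<phi> g zs \<noteq> {}" "sol_dist \<phi> g zs z lam < d"
  obtains l where "l \<in> multipliers \<phi> g zs" "dist (z, lam) (zs, l) < d"
proof -
  have "(INF y\<in>{zs} \<times> multipliers \<phi> g zs. dist (z, lam) y) < d"
    using assms by (simp add: sol_dist_def infdist_def)
  moreover have "bdd_below (dist (z, lam) ` ({zs} \<times> multipliers \<phi> g zs))"
    by (rule bdd_belowI[of _ 0]) auto
  ultimately obtain y where "y \<in> {zs} \<times> multipliers \<phi> g zs" "dist (z, lam) y < d"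
    using assms(1) cINF_less_iff[of "{zs} \<times> multipliers \<phi> g zs" "dist (z, lam)" d] by auto
  then show ?thesis using that by auto
qed

text \<open>Tolerances 1/(k+1) turn the hypotheses into limits along \<open>sequentially\<close>,
  and the growing constant k+1 in the conclusion eventually exceeds any constant hidden in a Landau
  symbol.\<close>

lemma step_error_bounds_eventually:
  fixes \<phi> :: "real ^ 'n \<Rightarrow> real" and g :: "real ^ 'n \<Rightarrow> real ^ 'm" and zs :: "real ^ 'n"
  assumes \<phi>: "twice_lipschitz_differentiable \<phi>"
    and g: "\<And>i. twice_lipschitz_differentiable (\<lambda>z. g z $ i)"
    and sol: "nlp_solution \<phi> g zs" and ne: "multipliers \<phi> g zs \<noteq> {}" and MFCQ: "MFCQ g zs"
    and so: "second_order_conditions \<phi> g zs" and sc: "strict_complementarity \<phi> g zs"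
    and svd: "active_svd g zs r P \<sigma> Q"
    and pos: "0 < \<gamma>" "Ct > 0" "K > 0"
    and hyp: "\<And>k :: nat. step_hypotheses \<phi> g zs r P \<sigma> C \<gamma> Ct K (inverse (real (Suc k))) (inverse (real (Suc k))) 1
      (z k) (lam k) (s k) (t k) (\<beta> k) (u k) (FP k) (fl k) (dz k) (dlam k) (ds k) (Fbar k) (fbar k) (F k) (f k)
      (G k) (Fhat k) (fhat k) (A k) (c k) (dinv k) (dz' k) (dlam' k) (ds' k)"
  shows "\<forall>\<^sub>F k in sequentially. step_error_bounds g zs r Q (real (Suc k)) (u k) (mu (lam k) (s k))
    (dz k) (dlam k) (ds k) (dz' k) (dlam' k) (ds' k)"
proof -
  note h = hyp[unfolded step_hypotheses_def]
  let ?d = "\<lambda>k. inverse (real (Suc k))"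
  define \<mu> where "\<mu> = (\<lambda>k. mu (lam k) (s k))"
  have d: "?d \<longlonglongrightarrow> 0" by (rule LIMSEQ_inverse_real_of_nat)
  have sd: "sol_dist \<phi> g zs (z k) (lam k) \<le> ?d k" and \<mu>_le: "\<mu> k \<le> ?d k"
    and u_le: "u k \<le> ?d k" and u_\<mu>_le: "u k / \<mu> k \<le> ?d k"
    and it: "iterate_conditions \<phi> g C \<gamma> (z k) (lam k) (s k)" and t: "norm (t k) \<le> Ct * (\<mu> k)\<^sup>2" for k
    using h[of k] unfolding \<mu>_def by blast+
  have exact: "exact_step \<phi> g (z k) (lam k) (s k) (t k) (dz k) (dlam k) (ds k)"
    and fp: "fp_arithmetic (u k) (FP k) (fl k)" "fp_vec (FP k) (lam k)" "fp_vec (FP k) (s k)" "fp_vec (FP k) (t k)"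
      "\<forall>j. fp_vec (FP k) (A k $ j)" "fp_vec (FP k) (c k)" "fp_vec (FP k) (dinv k)" "fp_vec (FP k) (dz' k)"
    and pert: "perturbation_bounds g zs K (u k) (\<mu> k) (Fbar k) (fbar k) (F k) (f k) (G k) (Fhat k) (fhat k)"
    and data: "A k = nabla g (z k) + F k" "c k = g (z k) + f k" "dinv k = Dinv_computed (lam k) (s k) (G k)"
    and comp: "computed_dz \<phi> g (z k) (lam k) (t k) (A k) (c k) (dinv k) (Fbar k) (fbar k) (Fhat k) (fhat k) (dz' k)"
      "computed_dlam (fl k) (lam k) (t k) (A k) (c k) (dinv k) (dz' k) (dlam' k)"
      "computed_ds (fl k) (s k) (A k) (c k) (dz' k) (ds' k)" for k
    using h[of k] unfolding \<mu>_def by blast+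
  \<comment> \<open>Doubling the tolerance makes the inequality strict, so a multiplier is found
    without knowing that the distance is attained.\<close>
  have "\<exists>l. l \<in> multipliers \<phi> g zs \<and> dist (z k, lam k) (zs, l) < 2 * ?d k" for k
  proof -
    have "?d k < 2 * ?d k" by simp
    with sd[of k] have "sol_dist \<phi> g zs (z k) (lam k) < 2 * ?d k" by (rule le_less_trans)
    from sol_dist_lessE[OF ne this] show ?thesis by metis
  qed
  then obtain lam0 where lam0: "\<And>k. lam0 k \<in> multipliers \<phi> g zs"
    and near: "\<And>k. dist (z k, lam k) (zs, lam0 k) < 2 * ?d k"
    by metis
  have d2: "(\<lambda>k. 2 * ?d k) \<longlonglongrightarrow> 0" using tendsto_mult_right_zero[OF d] .
  have \<mu>_gt_0: "\<mu> k > 0" for k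
  proof -
    have "lam k \<bullet> s k > 0"
      unfolding inner_vec_def inner_real_def
      using it[of k] by (intro sum_pos) (auto simp: iterate_conditions_def)
    then show ?thesis by (simp add: \<mu>_def mu_def)
  qed
  have u_gt_0: "u k > 0" for k using fp(1)[of k] by (simp add: fp_arithmetic_def)
  have squeeze: "X \<longlonglongrightarrow> 0" if "\<And>k. 0 \<le> X k" "\<And>k. X k \<le> ?d k" for X :: "nat \<Rightarrow> real"
    by (rule tendsto_sandwich[OF _ _ tendsto_const d]) (use that in auto)
  interpret nlp_computed_steps \<phi> g zs C \<gamma> Ct r P \<sigma> Q sequentially z lam lam0 s t \<mu>
    K u FP fl dz dlam ds Fbar fbar F f G Fhat fhat A c dinv dz' dlam' ds'
  proof unfold_locales
    show "\<mu> k = mu (lam k) (s k)" for k by (simp add: \<mu>_def)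
    show "feasible g zs" using sol by (simp add: nlp_solution_def)
    show "z \<longlonglongrightarrow> zs"
    proof (rule Lim_null[THEN iffD2], rule Lim_null_comparison[OF _ d2])
      have "norm (z k - zs) \<le> 2 * ?d k" for k
        using dist_fst_le[of "(z k, lam k)" "(zs, lam0 k)"] near[of k] by (simp add: dist_norm)
      then show "\<forall>\<^sub>F k in sequentially. norm (z k - zs) \<le> 2 * ?d k"
        by (intro always_eventually allI)
    qed
    show "(\<lambda>k. lam k - lam0 k) \<longlonglongrightarrow> 0"
    proof (rule Lim_null_comparison[OF _ d2])
      have "norm (lam k - lam0 k) \<le> 2 * ?d k" for k
        using dist_snd_le[of "(z k, lam k)" "(zs, lam0 k)"] near[of k] by (simp add: dist_norm)
      then show "\<forall>\<^sub>F k in sequentially. norm (lam k - lam0 k) \<le> 2 * ?d k"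
        by (intro always_eventually allI)
    qed
    show "\<mu> \<longlonglongrightarrow> 0"
      by (rule squeeze[OF less_imp_le[OF \<mu>_gt_0] \<mu>_le])
    show "u \<longlonglongrightarrow> 0"
      by (rule squeeze[OF less_imp_le[OF u_gt_0] u_le])
    show "(\<lambda>k. u k / \<mu> k) \<longlonglongrightarrow> 0"
      by (rule squeeze[OF less_imp_le[OF divide_pos_pos[OF u_gt_0 \<mu>_gt_0]] u_\<mu>_le])
    show "A k = nabla g (z k) + F k" for k by (rule data)
    show "c k = g (z k) + f k" for k by (rule data)
    show "dinv k = Dinv_computed (lam k) (s k) (G k)" for k by (rule data)
  qed (simp_all add: \<phi> g MFCQ so sc svd pos lam0 it t exact fp pert comp)
  have eventually_le: "\<forall>\<^sub>F k in sequentially. X k \<le> real (Suc k) * Y k"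
    if "X \<in> O(Y)" "\<And>k. 0 \<le> Y k" for X Y :: "nat \<Rightarrow> real"
  proof -
    obtain M where "M > 0" and M: "\<forall>\<^sub>F k in sequentially. norm (X k) \<le> M * norm (Y k)"
      using \<open>X \<in> O(Y)\<close> by (rule landau_o.bigE)
    have "\<forall>\<^sub>F k in sequentially. M \<le> real (Suc k)"
      using eventually_ge_at_top[of "nat \<lceil>M\<rceil>"] by eventually_elim linarith
    with M show ?thesis
    proof eventually_elim
      case (elim k)
      have "X k \<le> M * Y k" using elim(1) that(2)[of k] by simp
      also have "\<dots> \<le> real (Suc k) * Y k" using elim(2) that(2)[of k] by (rule mult_right_mono)
      finally show ?case .
    qed
  qed
  have nonneg: "0 \<le> u k" "0 \<le> u k / \<mu> k" "0 \<le> \<mu> k * u k" for k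
    using u_gt_0[of k] \<mu>_gt_0[of k] by simp_all
  show ?thesis
    using eventually_le[OF difference_bigo(1) nonneg(1)] eventually_le[OF range_error_bigo nonneg(1)]
      eventually_le[OF ds_bigo nonneg(1)] eventually_le[OF null_error_bigo nonneg(2)]
      eventually_le[OF inactive_error_bigo nonneg(3)]
    by eventually_elim (simp add: step_error_bounds_def \<mu>_def[symmetric] mult.assoc)
qed

theorem theorem5p1:
  fixes \<phi> :: "real ^ 'n \<Rightarrow> real" and g :: "real ^ 'n \<Rightarrow> real ^ 'm" and zs :: "real ^ 'n"
    and C \<gamma> Ct K :: real
    and r :: nat and P :: "nat \<Rightarrow> real ^ 'n" and \<sigma> :: "nat \<Rightarrow> real" and Q :: "nat \<Rightarrow> 'm \<Rightarrow> real"
  assumes "twice_lipschitz_differentiable \<phi>"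
    and "\<And>i. twice_lipschitz_differentiable (\<lambda>z. g z $ i)"
    and "nlp_solution \<phi> g zs"
    and "multipliers \<phi> g zs \<noteq> {}"
    and "MFCQ g zs"
    and "second_order_conditions \<phi> g zs"
    and "strict_complementarity \<phi> g zs"
    and "active_svd g zs r P \<sigma> Q"
    and "C > 0" and "0 < \<gamma>" and "\<gamma> < 1"
    and "Ct > 0" and "K > 0"
  shows "\<exists>\<epsilon>>0. \<exists>\<eta>>0. \<exists>\<beta>0>0. \<exists>K'>0.
    \<forall>(z :: real ^ 'n) (lam :: real ^ 'm) (s :: real ^ 'm) (t :: real ^ 'm) (\<beta> :: real)
     (u :: real) (FP :: real set) (fl :: fop \<Rightarrow> real \<Rightarrow> real \<Rightarrow> real)
     (dz :: real ^ 'n) (dlam :: real ^ 'm) (ds :: real ^ 'm)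
     (Fbar :: real ^ 'n ^ 'n) (fbar :: real ^ 'n) (F :: real ^ 'm ^ 'n) (f :: real ^ 'm)
     (G :: real ^ 'm) (Fhat :: real ^ 'n ^ 'n) (fhat :: real ^ 'n)
     (A :: real ^ 'm ^ 'n) (c :: real ^ 'm) (dinv :: real ^ 'm)
     (dz' :: real ^ 'n) (dlam' :: real ^ 'm) (ds' :: real ^ 'm).
      iterate_conditions \<phi> g C \<gamma> z lam s \<and>
      sol_dist \<phi> g zs z lam \<le> \<epsilon> \<and> mu lam s \<le> \<epsilon> \<and>
      norm t \<le> Ct * (mu lam s)\<^sup>2 \<and>
      u / mu lam s \<le> \<eta> \<and> u \<le> \<eta> \<and>
      \<beta> \<ge> \<beta>0 \<and> conditioning_bounds \<phi> g zs r P \<sigma> \<beta> u (mu lam s) \<and>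
      exact_step \<phi> g z lam s t dz dlam ds \<and>
      fp_arithmetic u FP fl \<and>
      fp_vec FP z \<and> fp_vec FP lam \<and> fp_vec FP s \<and> fp_vec FP t \<and>
      perturbation_bounds g zs K u (mu lam s) Fbar fbar F f G Fhat fhat \<and>
      A = nabla g z + F \<and> c = g z + f \<and> dinv = Dinv_computed lam s G \<and>
      (\<forall>j. fp_vec FP (A $ j)) \<and> fp_vec FP c \<and> fp_vec FP dinv \<and> fp_vec FP dz' \<and>
      computed_dz \<phi> g z lam t A c dinv Fbar fbar Fhat fhat dz' \<and>
      computed_dlam fl lam t A c dinv dz' dlam' \<and>
      computed_ds fl s A c dz' ds'
      \<longrightarrow>
      norm (dz - dz') \<le> K' * u \<and>
      L2_set (\<lambda>j. \<Sum>k\<in>active g zs. Q j k * (dlam $ k - dlam' $ k)) {..<r} \<le> K' * u \<and>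
      norm (ds - ds') \<le> K' * u \<and>
      L2_set (\<lambda>j. \<Sum>k\<in>active g zs. Q j k * (dlam $ k - dlam' $ k)) {r..<card (active g zs)} \<le> K' * u / mu lam s \<and>
      L2_set (\<lambda>i. dlam $ i - dlam' $ i) (inactive g zs) \<le> K' * mu lam s * u"
proof (rule ccontr)
  assume neg: "\<not> ?thesis"
  \<comment> \<open>The negated claim is used with \<epsilon> = \<eta> = 1/(k+1), \<beta>0 = 1 and
    K' = k+1. The problem and the constants of the hypotheses are fixed before k, so a contradiction
    yields constants depending on them alone.\<close>
  have "\<forall>k :: nat. \<exists>z lam s t \<beta> u FP fl dz dlam ds Fbar fbar F f G Fhat fhat A c dinv dz' dlam' ds'.
      step_hypotheses \<phi> g zs r P \<sigma> C \<gamma> Ct K (inverse (real (Suc k))) (inverse (real (Suc k))) 1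
        z lam s t \<beta> u FP fl dz dlam ds Fbar fbar F f G Fhat fhat A c dinv dz' dlam' ds' \<and>
      \<not> step_error_bounds g zs r Q (real (Suc k)) u (mu lam s) dz dlam ds dz' dlam' ds'"
    (is "\<forall>k. ?R k")
  proof (rule allI, rule ccontr)
    fix k :: nat
    assume no: "\<not> ?R k"
    have all: "\<forall>z lam s t \<beta> u FP fl dz dlam ds Fbar fbar F f G Fhat fhat A c dinv dz' dlam' ds'.
      step_hypotheses \<phi> g zs r P \<sigma> C \<gamma> Ct K (inverse (real (Suc k))) (inverse (real (Suc k))) 1
        z lam s t \<beta> u FP fl dz dlam ds Fbar fbar F f G Fhat fhat A c dinv dz' dlam' ds' \<longrightarrow>
      step_error_bounds g zs r Q (real (Suc k)) u (mu lam s) dz dlam ds dz' dlam' ds'"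
      using no by (simp only: not_ex de_Morgan_conj not_not imp_conv_disj simp_thms)
    have p: "inverse (real (Suc k)) > 0" "real (Suc k) > 0" "(1 :: real) > 0" by simp_all
    have "\<exists>\<epsilon>>0. \<exists>\<eta>>0. \<exists>\<beta>0>0. \<exists>K'>0. \<forall>z lam s t \<beta> u FP fl dz dlam ds Fbar fbar F f G Fhat fhat A c dinv dz' dlam' ds'.
      step_hypotheses \<phi> g zs r P \<sigma> C \<gamma> Ct K \<epsilon> \<eta> \<beta>0
        z lam s t \<beta> u FP fl dz dlam ds Fbar fbar F f G Fhat fhat A c dinv dz' dlam' ds' \<longrightarrow>
      step_error_bounds g zs r Q K' u (mu lam s) dz dlam ds dz' dlam' ds'"
      by (rule positive_constantsI[OF p(1) p(1) p(3) p(2)]) (rule all)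
    from neg this[unfolded step_hypotheses_def step_error_bounds_def] show False by (rule notE)
  qed
  \<comment> \<open>Choosing one counterexample for each k gives a sequence of iterates, step data
    and arithmetics to which the asymptotic bounds apply.\<close>
  then show False
    unfolding choice_iff
  proof (elim exE)
    fix z lam s t \<beta> u FP fl dz dlam ds Fbar fbar F f G Fhat fhat A c dinv dz' dlam' ds'
    assume *: "\<forall>k. step_hypotheses \<phi> g zs r P \<sigma> C \<gamma> Ct K (inverse (real (Suc k))) (inverse (real (Suc k))) 1
      (z k) (lam k) (s k) (t k) (\<beta> k) (u k) (FP k) (fl k) (dz k) (dlam k) (ds k) (Fbar k) (fbar k) (F k) (f k)
      (G k) (Fhat k) (fhat k) (A k) (c k) (dinv k) (dz' k) (dlam' k) (ds' k) \<and>
      \<not> step_error_bounds g zs r Q (real (Suc k)) (u k) (mu (lam k) (s k)) (dz k) (dlam k) (ds k) (dz' k) (dlam' k) (ds' k)"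
    have "\<forall>\<^sub>F k in sequentially. step_error_bounds g zs r Q (real (Suc k)) (u k) (mu (lam k) (s k))
        (dz k) (dlam k) (ds k) (dz' k) (dlam' k) (ds' k)"
      by (rule step_error_bounds_eventually[OF assms(1-8) assms(10,12,13)]) (rule conjunct1[OF spec[OF *]])
    then obtain k where "step_error_bounds g zs r Q (real (Suc k)) (u k) (mu (lam k) (s k))
        (dz k) (dlam k) (ds k) (dz' k) (dlam' k) (ds' k)"
      using eventually_happens'[OF sequentially_bot] by blast
    with conjunct2[OF spec[OF *]] show False by (rule notE)
  qed
qed

end
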